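(* Let $\mathbf c=(c_0,c_1)\in(\mathbb C^\times)^2$. For any $\mathbf s=(s_0,s_1)\in\mathbb C^2$ the following hold. (1) (Generalized factorization) $$\eta_{\mathbf c,\mathbf s}(\grave{\boldsymbol\Theta}(z))\equiv\xi_{\mathbf c,\mathbf s}(\grave{\boldsymbol\Theta}(z))\cdot\eta_{\mathbf c,0}(\grave{\boldsymbol\Theta}(z))\quad\bmod\ U_+[[z]].$$ (2) (Coproduct formula) $$\Delta_{\mathbf c,\mathbf s}(\grave{\boldsymbol\Theta}(z))\equiv\eta_{\mathbf c,\mathbf s}(\grave{\boldsymbol\Theta}(z))\otimes\eta_{\mathbf c,0}(\grave{\boldsymbol\Theta}(z))\quad\bmod\ \big(\mathcal O_q^{\mathbf c,\mathbf s}\otimes U_+\big)[[z]].$$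
   Context: $q\in\mathbb C^\times$ is not a root of unity; $[n]=\frac{q^n-q^{-n}}{q-q^{-1}}$, $[a,b]_p=ab-p\,ba$. **Quantum loop algebra.** $U=U_qL\mathfrak{sl}_2$ has generators $x^\pm_k$ ($k\in\mathbb Z$), $h_l$ ($l\in\mathbb Z\setminus\{0\}$), $K^{\pm1}$ and relations $[h_k,h_l]=0$, $Kh_k=h_kK$, $Kx^\pm_k=q^{\pm2}x_k^\pm K$, $[h_k,x_l^\pm]=\pm\frac{[2k]}{k}x^\pm_{k+l}$, $x^\pm_{k+1}x^\pm_l-q^{\pm2}x^\pm_lx^\pm_{k+1}=q^{\pm2}x^\pm_kx^\pm_{l+1}-x^\pm_{l+1}x^\pm_k$, $[x^+_k,x^-_l]=\frac{\phi^+_{k+l}-\phi^-_{k+l}}{q-q^{-1}}$, where $\sum_{k\ge0}\phi^+_kz^k=K\exp((q-q^{-1})\sum_{k\ge1}h_kz^k)$, $\sum_{k\ge0}\phi^-_{-k}z^{-k}=K^{-1}\exp(-(q-q^{-1})\sum_{k\ge1}h_{-k}z^{-k})$, $\phi^+_k=0$ for $k<0$ and $\phi^-_k=0$ for $k>0$. $U$ is $\mathbb Z$-graded by $\deg x^\pm_k=\pm1$, $\deg h_k=\deg K=0$; $U_+$ is the span of homogeneous elements of degree $\ge1$. In terms of $E_1=x_0^+$, $F_1=x_0^-$, $K_1=K$, $E_0=-K^{-1}x_1^-$, $F_0=-x^+_{-1}K$, $K_0=K^{-1}$, the coproduct is $\Delta(E_i)=E_i\otimes1+K_i\otimes E_i$,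 $\Delta(F_i)=F_i\otimes K_i^{-1}+1\otimes F_i$, $\Delta(K_i)=K_i\otimes K_i$, and the counit is $\varepsilon(E_i)=\varepsilon(F_i)=0$, $\varepsilon(K_i)=1$. **$q$-Onsager algebra.** Put $C=q^4c_0c_1$. $\mathcal O_q^{\mathbf c}$ is the algebra with generators $H_m$ ($m\ge1$), $A_r$ ($r\in\mathbb Z$) and relations $[H_m,H_n]=0$, $[H_m,A_r]=\frac{[2m]}{m}(A_{r+m}-C^mA_{r-m})$, $[A_r,A_{s+1}]_{q^{-2}}-q^{-2}[A_{r+1},A_s]_{q^2}=c_1C^r\Theta_{s-r+1}-q^{-2}c_1C^{r+1}\Theta_{s-r-1}+c_1C^s\Theta_{r-s+1}-q^{-2}c_1C^{s+1}\Theta_{r-s-1}$, where $1+\sum_{m\ge1}(q-q^{-1})\Theta_mz^m=\exp((q-q^{-1})\sum_{m\ge1}H_mz^m)$, $\Theta_0=(q-q^{-1})^{-1}$, $\Theta_m=0$ for $m<0$. It is generated by $A_0,A_{-1}$. Set $\grave{\boldsymbol\Theta}(z)=(q-q^{-1})\frac{1-q^{-2}Cz^2}{1-Cz^2}\sum_{r\ge0}\Theta_rz^r$. **Coideal structure.** $\eta_{\mathbf c,\mathbf s}:\mathcal O_q^{\mathbf c}\hookrightarrow U$ is the injective algebra homomorphism with $A_0\mapsto x^-_0-c_1q^2K^{-1}x^+_0+s_1K^{-1}$, $A_{-1}\mapsto-q^{-4}c_0^{-1}Kx^+_{-1}+x^-_1+q^{-2}c_0^{-1}s_0K$; $\eta_{\mathbf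 c,0}$ is the case $\mathbf s=(0,0)$. $\mathcal O_q^{\mathbf c,\mathbf s}=\eta_{\mathbf c,\mathbf s}(\mathcal O_q^{\mathbf c})$, a right coideal subalgebra of $U$; $\Delta_{\mathbf c,\mathbf s}=\Delta\circ\eta_{\mathbf c,\mathbf s}$; $\xi_{\mathbf c,\mathbf s}=\varepsilon\circ\eta_{\mathbf c,\mathbf s}:\mathcal O_q^{\mathbf c}\to\mathbb C$. *)

theory Defs
  imports
    Complex_Main
    "HOL-Algebra.QuotRing"
    "HOL-Algebra.Module"
    "HOL-Library.Poly_Mapping"
    "HOL-Computational_Algebra.Formal_Power_Series"
begin

section \<open>Complex associative algebras\<close>

text \<open>
  A complex algebra is represented by the record type \<^typ>\<open>(complex, 'a) module\<close>, which carries
  a (not necessarily commutative) multiplication as well as the scalar action.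
\<close>

definition complex_alg :: "(complex, complex) module" where
  "complex_alg = \<lparr>carrier = UNIV, monoid.mult = (*), one = 1, zero = 0, add = (+), smult = (*)\<rparr>"

definition alg_hom :: "(complex, 'a) module \<Rightarrow> (complex, 'b) module \<Rightarrow> ('a \<Rightarrow> 'b) set" where
  "alg_hom A B = {f \<in> ring_hom A B.
     \<forall>c. \<forall>x\<in>carrier A. f (c \<odot>\<^bsub>A\<^esub> x) = c \<odot>\<^bsub>B\<^esub> f x}"

definition lin_span :: "(complex, 'a) module \<Rightarrow> 'a set \<Rightarrow> 'a set" where
  "lin_span A S = \<Inter>{V. submodule V complex_alg A \<and> S \<subseteq> V}"

definition monoid_alg :: "('m, 'r) monoid_scheme \<Rightarrow> (complex, 'm \<Rightarrow>\<^sub>0 complex) module" where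
  "monoid_alg M =
     \<lparr>carrier = {f. Poly_Mapping.keys f \<subseteq> carrier M},
      monoid.mult = (\<lambda>f g. \<Sum>a\<in>Poly_Mapping.keys f. \<Sum>b\<in>Poly_Mapping.keys g.
        Poly_Mapping.single (a \<otimes>\<^bsub>M\<^esub> b) (Poly_Mapping.lookup f a * Poly_Mapping.lookup g b)),
      one = Poly_Mapping.single \<one>\<^bsub>M\<^esub> 1,
      zero = 0,
      add = (+),
      smult = (\<lambda>c. Poly_Mapping.map ((*) c))\<rparr>"

definition alg_class :: "(complex, 'a) module \<Rightarrow> 'a set \<Rightarrow> 'a \<Rightarrow> 'a set" where
  "alg_class A S x = (Idl\<^bsub>A\<^esub> S) +>\<^bsub>A\<^esub> x"

text \<open>The scalar action on the quotient is multiplication by the class of a multiple of the unit.\<close>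

definition quot_alg :: "(complex, 'a) module \<Rightarrow> 'a set \<Rightarrow> (complex, 'a set) module" where
  "quot_alg A S = ring.extend (A Quot (Idl\<^bsub>A\<^esub> S))
     (module.fields (\<lambda>c X. alg_class A S (c \<odot>\<^bsub>A\<^esub> \<one>\<^bsub>A\<^esub>) \<otimes>\<^bsub>A Quot (Idl\<^bsub>A\<^esub> S)\<^esub> X))"

definition free_alg :: "'g set \<Rightarrow> (complex, 'g list \<Rightarrow>\<^sub>0 complex) module" where
  "free_alg G = monoid_alg \<lparr>carrier = lists G, monoid.mult = (@), one = []\<rparr>"

definition free_gen :: "'g \<Rightarrow> ('g list \<Rightarrow>\<^sub>0 complex)" where
  "free_gen g = Poly_Mapping.single [g] 1"

text \<open>
  The tensor product of two algebras is the vector space with basis the pairs of elements, modulo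
  bilinearity. The product \<open>(a, b) (a', b') = (a a', b b')\<close> makes that vector space
  the monoid algebra of the product of the multiplicative monoids, in which the bilinearity
  relators span an ideal.
\<close>

definition tensor_relators ::
  "(complex, 'a) module \<Rightarrow> (complex, 'b) module \<Rightarrow> ('a \<times> 'b \<Rightarrow>\<^sub>0 complex) set" where
  "tensor_relators A B =
     {Poly_Mapping.single (a \<oplus>\<^bsub>A\<^esub> a', b) 1
        - Poly_Mapping.single (a, b) 1 - Poly_Mapping.single (a', b) 1 | a a' b.
        a \<in> carrier A \<and> a' \<in> carrier A \<and> b \<in> carrier B}
   \<union> {Poly_Mapping.single (a, b \<oplus>\<^bsub>B\<^esub> b') 1
        - Poly_Mapping.single (a, b) 1 - Poly_Mapping.single (a, b') 1 | a b b'.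
        a \<in> carrier A \<and> b \<in> carrier B \<and> b' \<in> carrier B}
   \<union> {Poly_Mapping.single (c \<odot>\<^bsub>A\<^esub> a, b) 1 - Poly_Mapping.single (a, b) c | c a b.
        a \<in> carrier A \<and> b \<in> carrier B}
   \<union> {Poly_Mapping.single (a, c \<odot>\<^bsub>B\<^esub> b) 1 - Poly_Mapping.single (a, b) c | c a b.
        a \<in> carrier A \<and> b \<in> carrier B}"

definition tensor_alg ::
  "(complex, 'a) module \<Rightarrow> (complex, 'b) module \<Rightarrow> (complex, ('a \<times> 'b \<Rightarrow>\<^sub>0 complex) set) module"
  where "tensor_alg A B = quot_alg (monoid_alg (A \<times>\<times> B)) (tensor_relators A B)"

definition tensor ::
  "(complex, 'a) module \<Rightarrow> (complex, 'b) module \<Rightarrow> 'a \<Rightarrow> 'b \<Rightarrow> ('a \<times> 'b \<Rightarrow>\<^sub>0 complex) set"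
  where "tensor A B a b =
    alg_class (monoid_alg (A \<times>\<times> B)) (tensor_relators A B) (Poly_Mapping.single (a, b) 1)"


section \<open>Power series with coefficients in an algebra\<close>

text \<open>A power series is the sequence of its coefficients.\<close>

definition cauchy_prod ::
  "(complex, 't) module \<Rightarrow> ('a \<Rightarrow> 'b \<Rightarrow> 't) \<Rightarrow> (nat \<Rightarrow> 'a) \<Rightarrow> (nat \<Rightarrow> 'b) \<Rightarrow> nat \<Rightarrow> 't" where
  "cauchy_prod T p f g n = (\<Oplus>\<^bsub>T\<^esub>i\<in>{..n}. p (f i) (g (n - i)))"

definition series_monoid :: "(complex, 'a) module \<Rightarrow> (nat \<Rightarrow> 'a) monoid" where
  "series_monoid A =
     \<lparr>carrier = UNIV \<rightarrow> carrier A,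
      monoid.mult = cauchy_prod A (monoid.mult A),
      one = (\<lambda>n. if n = 0 then \<one>\<^bsub>A\<^esub> else \<zero>\<^bsub>A\<^esub>)\<rparr>"

text \<open>
  Only series without constant term are exponentiated, so that the powers beyond the \<open>n\<close>-th do not
  contribute to the coefficient of \<open>z^n\<close>.
\<close>

definition series_exp :: "(complex, 'a) module \<Rightarrow> (nat \<Rightarrow> 'a) \<Rightarrow> nat \<Rightarrow> 'a" where
  "series_exp A f n = (\<Oplus>\<^bsub>A\<^esub>k\<in>{..n}. (1 / fact k) \<odot>\<^bsub>A\<^esub> ((f [^]\<^bsub>series_monoid A\<^esub> k) n))"

definition series_cong :: "(complex, 'a) module \<Rightarrow> 'a set \<Rightarrow> (nat \<Rightarrow> 'a) \<Rightarrow> (nat \<Rightarrow> 'a) \<Rightarrow> bool" where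
  "series_cong A V f g \<longleftrightarrow> (\<forall>n. f n \<ominus>\<^bsub>A\<^esub> g n \<in> V)"


section \<open>The quantum loop algebra of sl2\<close>

definition qint :: "complex \<Rightarrow> int \<Rightarrow> complex" where
  "qint q n = (q powi n - q powi (- n)) / (q - inverse q)"

definition twisted_comm :: "(complex, 'a) module \<Rightarrow> complex \<Rightarrow> 'a \<Rightarrow> 'a \<Rightarrow> 'a" where
  "twisted_comm A p a b = (a \<otimes>\<^bsub>A\<^esub> b) \<ominus>\<^bsub>A\<^esub> (p \<odot>\<^bsub>A\<^esub> (b \<otimes>\<^bsub>A\<^esub> a))"

datatype loop_gen = Xplus int | Xminus int | Hloop int | Kgen | Kgen_inv

definition loop_gens :: "loop_gen set" where
  "loop_gens = range Xplus \<union> range Xminus \<union> Hloop ` {l. l \<noteq> 0} \<union> {Kgen, Kgen_inv}"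

abbreviation loop_free :: "(complex, loop_gen list \<Rightarrow>\<^sub>0 complex) module" where
  "loop_free \<equiv> free_alg loop_gens"

definition phi_plus :: "complex \<Rightarrow> int \<Rightarrow> (loop_gen list \<Rightarrow>\<^sub>0 complex)" where
  "phi_plus q k = (if k < 0 then \<zero>\<^bsub>loop_free\<^esub> else
     free_gen Kgen \<otimes>\<^bsub>loop_free\<^esub> series_exp loop_free
       (\<lambda>n. if n = 0 then \<zero>\<^bsub>loop_free\<^esub>
            else (q - inverse q) \<odot>\<^bsub>loop_free\<^esub> free_gen (Hloop (int n))) (nat k))"

definition phi_minus :: "complex \<Rightarrow> int \<Rightarrow> (loop_gen list \<Rightarrow>\<^sub>0 complex)" where
  "phi_minus q k = (if k > 0 then \<zero>\<^bsub>loop_free\<^esub> else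
     free_gen Kgen_inv \<otimes>\<^bsub>loop_free\<^esub> series_exp loop_free
       (\<lambda>n. if n = 0 then \<zero>\<^bsub>loop_free\<^esub>
            else (- (q - inverse q)) \<odot>\<^bsub>loop_free\<^esub> free_gen (Hloop (- int n))) (nat (- k)))"

definition loop_relators :: "complex \<Rightarrow> (loop_gen list \<Rightarrow>\<^sub>0 complex) set" where
  "loop_relators q = (
     let
       F = loop_free;
       xp = (\<lambda>k. free_gen (Xplus k));
       xm = (\<lambda>k. free_gen (Xminus k));
       h = (\<lambda>l. free_gen (Hloop l));
       K = free_gen Kgen;
       K' = free_gen Kgen_inv
     in
       {(K \<otimes>\<^bsub>F\<^esub> K') \<ominus>\<^bsub>F\<^esub> \<one>\<^bsub>F\<^esub>, (K' \<otimes>\<^bsub>F\<^esub> K) \<ominus>\<^bsub>F\<^esub> \<one>\<^bsub>F\<^esub>}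
     \<union> {twisted_comm F 1 (h k) (h l) | k l. k \<noteq> 0 \<and> l \<noteq> 0}
     \<union> {(K \<otimes>\<^bsub>F\<^esub> h k) \<ominus>\<^bsub>F\<^esub> (h k \<otimes>\<^bsub>F\<^esub> K) | k. k \<noteq> 0}
     \<union> (\<Union>(x, e) \<in> {(xp, 1), (xm, - 1)}.
          {(K \<otimes>\<^bsub>F\<^esub> x k) \<ominus>\<^bsub>F\<^esub> ((q powi (2 * e)) \<odot>\<^bsub>F\<^esub> (x k \<otimes>\<^bsub>F\<^esub> K)) | k. True}
        \<union> {twisted_comm F 1 (h k) (x l)
             \<ominus>\<^bsub>F\<^esub> ((of_int e * (qint q (2 * k) / of_int k)) \<odot>\<^bsub>F\<^esub> x (k + l)) | k l. k \<noteq> 0}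
        \<union> {((x (k + 1) \<otimes>\<^bsub>F\<^esub> x l) \<ominus>\<^bsub>F\<^esub> ((q powi (2 * e)) \<odot>\<^bsub>F\<^esub> (x l \<otimes>\<^bsub>F\<^esub> x (k + 1))))
             \<ominus>\<^bsub>F\<^esub> (((q powi (2 * e)) \<odot>\<^bsub>F\<^esub> (x k \<otimes>\<^bsub>F\<^esub> x (l + 1))) \<ominus>\<^bsub>F\<^esub> (x (l + 1) \<otimes>\<^bsub>F\<^esub> x k))
             | k l. True})
     \<union> {twisted_comm F 1 (xp k) (xm l)
          \<ominus>\<^bsub>F\<^esub> ((1 / (q - inverse q)) \<odot>\<^bsub>F\<^esub> (phi_plus q (k + l) \<ominus>\<^bsub>F\<^esub> phi_minus q (k + l)))
          | k l. True})"

definition loop_alg :: "complex \<Rightarrow> (complex, (loop_gen list \<Rightarrow>\<^sub>0 complex) set) module" where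
  "loop_alg q = quot_alg loop_free (loop_relators q)"

definition loop_elt :: "complex \<Rightarrow> loop_gen \<Rightarrow> (loop_gen list \<Rightarrow>\<^sub>0 complex) set" where
  "loop_elt q g = alg_class loop_free (loop_relators q) (free_gen g)"

fun loop_deg :: "loop_gen \<Rightarrow> int" where
  "loop_deg (Xplus k) = 1"
| "loop_deg (Xminus k) = - 1"
| "loop_deg (Hloop l) = 0"
| "loop_deg Kgen = 0"
| "loop_deg Kgen_inv = 0"

definition loop_homogeneous :: "complex \<Rightarrow> int \<Rightarrow> (loop_gen list \<Rightarrow>\<^sub>0 complex) set set" where
  "loop_homogeneous q d = {alg_class loop_free (loop_relators q) f | f.
     f \<in> carrier loop_free \<and> (\<forall>w\<in>Poly_Mapping.keys f. sum_list (map loop_deg w) = d)}"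

definition loop_positive :: "complex \<Rightarrow> (loop_gen list \<Rightarrow>\<^sub>0 complex) set set" where
  "loop_positive q = lin_span (loop_alg q) (\<Union>d\<in>{1..}. loop_homogeneous q d)"

text \<open>The Chevalley generators are indexed by \<open>0\<close> and \<open>1\<close>.\<close>

definition chev_E :: "complex \<Rightarrow> nat \<Rightarrow> (loop_gen list \<Rightarrow>\<^sub>0 complex) set" where
  "chev_E q i = (if i = 0
     then \<ominus>\<^bsub>loop_alg q\<^esub> (loop_elt q Kgen_inv \<otimes>\<^bsub>loop_alg q\<^esub> loop_elt q (Xminus 1))
     else loop_elt q (Xplus 0))"

definition chev_F :: "complex \<Rightarrow> nat \<Rightarrow> (loop_gen list \<Rightarrow>\<^sub>0 complex) set" where
  "chev_F q i = (if i = 0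
     then \<ominus>\<^bsub>loop_alg q\<^esub> (loop_elt q (Xplus (- 1)) \<otimes>\<^bsub>loop_alg q\<^esub> loop_elt q Kgen)
     else loop_elt q (Xminus 0))"

definition chev_K :: "complex \<Rightarrow> nat \<Rightarrow> (loop_gen list \<Rightarrow>\<^sub>0 complex) set" where
  "chev_K q i = (if i = 0 then loop_elt q Kgen_inv else loop_elt q Kgen)"

text \<open>
  The elements \<open>E\<^sub>i, F\<^sub>i, K\<^sub>i\<^sup>\<plusminus>\<^sup>1\<close> generate the algebra when \<open>q\<close> is not a root of unity, so
  the following predicates determine the coproduct and the counit on the carrier.
\<close>

definition is_coproduct :: "complex \<Rightarrow> ((loop_gen list \<Rightarrow>\<^sub>0 complex) set \<Rightarrow>
    ((loop_gen list \<Rightarrow>\<^sub>0 complex) set \<times> (loop_gen list \<Rightarrow>\<^sub>0 complex) set \<Rightarrow>\<^sub>0 complex) set) \<Rightarrow> bool"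
  where
  "is_coproduct q \<Delta> \<longleftrightarrow> (
     let U = loop_alg q; T = tensor_alg U U; t = tensor U U in
       \<Delta> \<in> alg_hom U T \<and>
       (\<forall>i\<in>{0, 1}.
          \<Delta> (chev_E q i) = t (chev_E q i) \<one>\<^bsub>U\<^esub> \<oplus>\<^bsub>T\<^esub> t (chev_K q i) (chev_E q i) \<and>
          \<Delta> (chev_F q i) = t (chev_F q i) (inv\<^bsub>U\<^esub> (chev_K q i)) \<oplus>\<^bsub>T\<^esub> t \<one>\<^bsub>U\<^esub> (chev_F q i) \<and>
          \<Delta> (chev_K q i) = t (chev_K q i) (chev_K q i)))"

definition is_counit :: "complex \<Rightarrow> ((loop_gen list \<Rightarrow>\<^sub>0 complex) set \<Rightarrow> complex) \<Rightarrow> bool" where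
  "is_counit q \<epsilon> \<longleftrightarrow>
     \<epsilon> \<in> alg_hom (loop_alg q) complex_alg \<and>
     (\<forall>i\<in>{0, 1}. \<epsilon> (chev_E q i) = 0 \<and> \<epsilon> (chev_F q i) = 0 \<and> \<epsilon> (chev_K q i) = 1)"


section \<open>The q-Onsager algebra\<close>

datatype onsager_gen = Hons nat | Aons int

definition onsager_gens :: "onsager_gen set" where
  "onsager_gens = Hons ` {1..} \<union> range Aons"

abbreviation onsager_free :: "(complex, onsager_gen list \<Rightarrow>\<^sub>0 complex) module" where
  "onsager_free \<equiv> free_alg onsager_gens"

definition onsager_C :: "complex \<Rightarrow> complex \<Rightarrow> complex \<Rightarrow> complex" where
  "onsager_C q c0 c1 = q ^ 4 * c0 * c1"

text \<open>
  The elements \<open>\<Theta>\<^sub>m\<close> built from a family \<open>H\<close> in an arbitrary algebra. They are needed both in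
  the free algebra, to state the relations, and in the q-Onsager algebra. For \<open>m = 0\<close> the formula
  gives \<open>(q - q\<^sup>-\<^sup>1)\<^sup>-\<^sup>1\<close>. The value \<open>H 0\<close> is not used.
\<close>

definition theta :: "(complex, 'a) module \<Rightarrow> complex \<Rightarrow> (nat \<Rightarrow> 'a) \<Rightarrow> int \<Rightarrow> 'a" where
  "theta A q H m = (if m < 0 then \<zero>\<^bsub>A\<^esub> else
     (1 / (q - inverse q)) \<odot>\<^bsub>A\<^esub> series_exp A
       (\<lambda>n. if n = 0 then \<zero>\<^bsub>A\<^esub> else (q - inverse q) \<odot>\<^bsub>A\<^esub> H n) (nat m))"

definition onsager_relators ::
  "complex \<Rightarrow> complex \<Rightarrow> complex \<Rightarrow> (onsager_gen list \<Rightarrow>\<^sub>0 complex) set" where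
  "onsager_relators q c0 c1 = (
     let
       F = onsager_free;
       C = onsager_C q c0 c1;
       H = (\<lambda>m. free_gen (Hons m));
       A = (\<lambda>r. free_gen (Aons r));
       \<Theta> = theta F q H
     in
       {twisted_comm F 1 (H m) (H n) | m n. m \<ge> 1 \<and> n \<ge> 1}
     \<union> {twisted_comm F 1 (H m) (A r)
          \<ominus>\<^bsub>F\<^esub> ((qint q (2 * int m) / of_nat m) \<odot>\<^bsub>F\<^esub>
               (A (r + int m) \<ominus>\<^bsub>F\<^esub> ((C ^ m) \<odot>\<^bsub>F\<^esub> A (r - int m)))) | m r. m \<ge> 1}
     \<union> {(twisted_comm F (q powi (- 2)) (A r) (A (s + 1))
            \<ominus>\<^bsub>F\<^esub> ((q powi (- 2)) \<odot>\<^bsub>F\<^esub> twisted_comm F (q\<^sup>2) (A (r + 1)) (A s)))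
          \<ominus>\<^bsub>F\<^esub> (((((c1 * C powi r) \<odot>\<^bsub>F\<^esub> \<Theta> (s - r + 1))
               \<ominus>\<^bsub>F\<^esub> ((q powi (- 2) * c1 * C powi (r + 1)) \<odot>\<^bsub>F\<^esub> \<Theta> (s - r - 1)))
               \<oplus>\<^bsub>F\<^esub> ((c1 * C powi s) \<odot>\<^bsub>F\<^esub> \<Theta> (r - s + 1)))
               \<ominus>\<^bsub>F\<^esub> ((q powi (- 2) * c1 * C powi (s + 1)) \<odot>\<^bsub>F\<^esub> \<Theta> (r - s - 1)))
          | r s. True})"

definition onsager_alg ::
  "complex \<Rightarrow> complex \<Rightarrow> complex \<Rightarrow> (complex, (onsager_gen list \<Rightarrow>\<^sub>0 complex) set) module" where
  "onsager_alg q c0 c1 = quot_alg onsager_free (onsager_relators q c0 c1)"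

definition onsager_elt ::
  "complex \<Rightarrow> complex \<Rightarrow> complex \<Rightarrow> onsager_gen \<Rightarrow> (onsager_gen list \<Rightarrow>\<^sub>0 complex) set" where
  "onsager_elt q c0 c1 g = alg_class onsager_free (onsager_relators q c0 c1) (free_gen g)"

definition onsager_theta ::
  "complex \<Rightarrow> complex \<Rightarrow> complex \<Rightarrow> int \<Rightarrow> (onsager_gen list \<Rightarrow>\<^sub>0 complex) set" where
  "onsager_theta q c0 c1 =
     theta (onsager_alg q c0 c1) q (\<lambda>m. onsager_elt q c0 c1 (Hons m))"

definition grave_factor :: "complex \<Rightarrow> complex \<Rightarrow> complex fps" where
  "grave_factor q C =
     (1 - fps_const (q powi (- 2) * C) * fps_X\<^sup>2) / (1 - fps_const C * fps_X\<^sup>2)"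

definition grave_theta ::
  "complex \<Rightarrow> complex \<Rightarrow> complex \<Rightarrow> nat \<Rightarrow> (onsager_gen list \<Rightarrow>\<^sub>0 complex) set" where
  "grave_theta q c0 c1 =
     cauchy_prod (onsager_alg q c0 c1) (smult (onsager_alg q c0 c1))
       (fps_nth (fps_const (q - inverse q) * grave_factor q (onsager_C q c0 c1)))
       (\<lambda>r. onsager_theta q c0 c1 (int r))"

text \<open>
  The elements \<open>A\<^sub>0, A\<^sub>-\<^sub>1\<close> generate the q-Onsager algebra, so this determines the homomorphism
  on the carrier.
\<close>

definition is_coideal_hom :: "complex \<Rightarrow> complex \<Rightarrow> complex \<Rightarrow> complex \<Rightarrow> complex \<Rightarrow>
    ((onsager_gen list \<Rightarrow>\<^sub>0 complex) set \<Rightarrow> (loop_gen list \<Rightarrow>\<^sub>0 complex) set) \<Rightarrow> bool" where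
  "is_coideal_hom q c0 c1 s0 s1 \<eta> \<longleftrightarrow> (
     let
       U = loop_alg q;
       xp = (\<lambda>k. loop_elt q (Xplus k));
       xm = (\<lambda>k. loop_elt q (Xminus k));
       K = loop_elt q Kgen;
       K' = loop_elt q Kgen_inv
     in
       \<eta> \<in> alg_hom (onsager_alg q c0 c1) U \<and>
       \<eta> (onsager_elt q c0 c1 (Aons 0)) =
         (xm 0 \<ominus>\<^bsub>U\<^esub> ((c1 * q\<^sup>2) \<odot>\<^bsub>U\<^esub> (K' \<otimes>\<^bsub>U\<^esub> xp 0))) \<oplus>\<^bsub>U\<^esub> (s1 \<odot>\<^bsub>U\<^esub> K') \<and>
       \<eta> (onsager_elt q c0 c1 (Aons (- 1))) =
         ((\<ominus>\<^bsub>U\<^esub> ((q powi (- 4) * inverse c0) \<odot>\<^bsub>U\<^esub> (K \<otimes>\<^bsub>U\<^esub> xp (- 1)))) \<oplus>\<^bsub>U\<^esub> xm 1)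
           \<oplus>\<^bsub>U\<^esub> ((q powi (- 2) * inverse c0 * s0) \<odot>\<^bsub>U\<^esub> K))"

end

theory Submission
  imports Defs
begin

text \<open>
  Both congruences are instances of one statement. Let \<open>R\<close> be an algebra that contains a family \<open>a\<^sub>r\<close> satisfying
  the q-Onsager relations and \<open>x\<^sup>\<plusminus>\<^sub>k, h\<^sub>l, K\<close> satisfying the loop relations and commuting with it,
  filtered by the degree in \<open>x\<^sup>\<plusminus>\<close>. If \<open>a'\<^sub>r\<close> is another family satisfying the q-Onsager relations with
  \<open>a'\<^sub>0 = x\<^sup>-\<^sub>0 + a\<^sub>0 K\<inverse> - c\<^sub>1 q\<^sup>2 K\<inverse> x\<^sup>+\<^sub>0\<close> and the analogous formula for \<open>a'\<^sub>-\<^sub>1\<close>, then its grave series is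
  congruent to that of \<open>a\<close> times \<open>\<phi>\<^sup>-(z\<inverse>) \<phi>\<^sup>+(C z)\<close> modulo positive degree. Taking \<open>a = 0\<close> identifies
  \<open>\<phi>\<^sup>-(z\<inverse>) \<phi>\<^sup>+(C z)\<close> with the series of \<open>\<eta>\<^sub>0\<close>; then \<open>a = \<epsilon> \<circ> \<eta>\<close> (scalars) gives the factorization
  and \<open>a = \<eta> \<otimes> 1\<close> the coproduct formula. No basis of \<open>U\<close> is needed.

  The statement itself is a computation. The commutator with \<open>H\<^sub>1\<close> produces all \<open>a'\<^sub>r\<close> from \<open>a'\<^sub>0\<close> and
  \<open>a'\<^sub>-\<^sub>1\<close>, which yields the parts of \<open>a'\<^sub>r\<close> of degree \<open>-1, 0, 1\<close> for \<open>r \<ge> 0\<close> in closed form. Inserted in the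
  relation between \<open>[a'\<^sub>-\<^sub>1, a'\<^sub>n\<^sub>-\<^sub>1]\<close>, \<open>[a'\<^sub>n\<^sub>-\<^sub>2, a'\<^sub>0]\<close> and \<open>\<Theta>'\<^sub>n\<close>, they leave a sum that telescopes by means of
  the q-Onsager relations of the family \<open>a\<close>.
\<close>

text \<open>The last step dictates the precision. \<open>\<Gamma>' n\<close> is read off from
  q-commutators with \<open>a' (-1)\<close> and \<open>a' 0\<close>, which start in degree -1, so
  \<open>a' r\<close> must be known modulo degree 2. The pair \<open>(r, s) = (-1, n - 2)\<close> is
  used because it relates \<open>\<Gamma>' n\<close> to members of index at least -1. The two
  factors of the answer have different origins. The series phi^- sits in the degree zero part of
  \<open>a' r\<close>, a convolution of \<open>a\<close> with phi^-, whereas the coefficients of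
  phi^+ of positive index arise when the degree one part meets x^-_0 and x^-_1. The degree one part
  is the obstacle: it is quadratic in \<open>a\<close>, and it satisfies the recursion only after
  summation over shifts. The numerator 1 - q^-2 C z^2 of the grave series is the reason to work with
  \<open>\<Gamma>\<close>: multiplying by it turns Theta into \<open>\<Gamma>\<close>, and the
  remaining (q - q^-1)/(1 - C z^2) is a scalar series that multiplies both sides. The words are
  normalised in a type class, free of carrier conditions; hence the later passage from records to
  types.\<close>

section \<open>The relations modulo positive degree\<close>

text \<open>An algebra is later embedded as one factor of a product, and such an embedding turns its
  unit into a mere idempotent. Hence a class without unit.\<close>

class typed_algebra = ring +
  fixes cs :: "complex \<Rightarrow> 'a \<Rightarrow> 'a"  (infixr "*c" 75)
  assumes cs_add_right: "c *c (x + y) = c *c x + c *c y"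
    and cs_add_left: "(c + d) *c x = c *c x + d *c x"
    and cs_cs: "c *c d *c x = (c * d) *c x"
    and cs_one: "1 *c x = x"
    and mult_cs_left: "(c *c x) * y = c *c (x * y)"
    and mult_cs_right: "x * (c *c y) = c *c (x * y)"

global_interpretation cs: vector_space "cs :: complex \<Rightarrow> 'a::typed_algebra \<Rightarrow> 'a"
  by standard (auto simp: cs_add_right cs_add_left cs_cs cs_one)

lemmas cs_simps = cs.scale_right_distrib cs.scale_right_diff_distrib cs.scale_minus_right
  mult_cs_left mult_cs_right cs_cs cs_one

text \<open>Diagonal instances of the quadratic relations contain each equation twice.\<close>

lemma cs_double: "x + x = y + y \<Longrightarrow> x = (y :: 'a::typed_algebra)"
proof -
  assume "x + x = y + y"
  then have "2 *c x = 2 *c y" using cs_add_left[of 1 1 x] cs_add_left[of 1 1 y] by (simp add: cs_one)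
  then show ?thesis by (subst (asm) cs.scale_cancel_left) auto
qed

lemma comm2:
  fixes z w v :: "'b::semigroup_mult"
  assumes "z * w = w * z" shows "z * (w * v) = w * (z * v)"
  using arg_cong[OF assms, of "\<lambda>y. y * v"] by (simp only: mult.assoc)

text \<open>
  The recursion \<open>G_rec\<close> below with its constituents replaced by letters: \<open>b0, b1, bm\<close> for \<open>a\<^sub>i, a\<^sub>i\<^sub>+\<^sub>1, C a\<^sub>i\<^sub>-\<^sub>1\<close>,
  similarly \<open>x0, x1, xm\<close> for \<open>x\<^sup>+\<close>, and \<open>Q, Z, R\<close> for three consecutive convolutions.
\<close>

lemma G_rec_aux:
  fixes b0 :: "'a::typed_algebra"
  assumes f: "f2 * x0 = u *c s2 + s2 - x0 * f2" "f0 * x0 = u *c s0 + s0 - x0 * f0"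
    "f1 * x0 = u *c s1 + s1 - x0 * f1" "f1 * x1 = u *c s11 + s11 - x1 * f1"
    "f1 * xm = u *c s1m + s1m - xm * f1"
    and e: "x0 * f2 = xm * f1 + u *c s2 - s1m" "x1 * f1 = x0 * f0 + u *c s11 - s0"
    and b: "b1 * b0 = u *c (b0 * b1) - \<gamma> *c t" "b0 * bm = u *c (bm * b0) - \<gamma> *c t"
    and c: "\<And>x y. x \<in> {x0, x1, xm, f0, f1, f2, s0, s1, s2, s11, s1m} \<Longrightarrow> y \<in> {b0, b1, bm, t} \<Longrightarrow> x * y = y * x"
  shows "- (\<kappa> *c (b0 * x0 * Q - Q * b0 * x0)) + \<kappa> *c (b0 * b0 * f2 * x0) - \<kappa> *c (b0 * b0 * s2) - \<gamma> *c s2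
    - (- (\<kappa> *c (b0 * x0 * R - R * b0 * x0)) + \<kappa> *c (b0 * b0 * f0 * x0) - \<kappa> *c (b0 * b0 * s0) - \<gamma> *c s0)
    - (- (\<kappa> *c (((b1 - bm) * x0 + b0 * (x1 - xm)) * Z + b0 * x0 * (Q - R - b1 * f1 - b0 * f0)
         - (((Q - R - b1 * f1 - b0 * f0) * b0 + Z * (b1 - bm)) * x0 + Z * b0 * (x1 - xm))))
       + \<kappa> *c (((b1 - bm) * b0 + b0 * (b1 - bm)) * f1 * x0 + b0 * b0 * f1 * (x1 - xm))
       - \<kappa> *c (((b1 - bm) * b0 + b0 * (b1 - bm)) * s1 + b0 * b0 * (s11 - s1m)) - \<gamma> *c (s11 - s1m))
    - (- (\<kappa> *c ((bm * x0 + b0 * xm) * (b0 * f1 + Z) - (b0 * f1 + Z) * (bm * x0 + b0 * xm)))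
       - \<gamma> *c (xm * f1 + f2 * x0))
    + (- (\<kappa> *c ((b0 * x1 + b1 * x0) * Z - Z * (b0 * x1 + b1 * x0))) - \<gamma> *c (x0 * f0 + f1 * x1)) = 0"
proof -
  have c1: "x * y = y * x" "x * (y * z) = y * (x * z)"
    if "x \<in> {x0, x1, xm, f0, f1, f2, s0, s1, s2, s11, s1m}" "y \<in> {b0, b1, bm, t}" for x y z
    using c[OF that] by (simp_all add: mult.assoc flip: mult.assoc)
  have b': "b1 * (b0 * z) = u *c (b0 * (b1 * z)) - \<gamma> *c (t * z)"
     "b0 * (bm * z) = u *c (bm * (b0 * z)) - \<gamma> *c (t * z)" for z
    using b[THEN arg_cong, of "\<lambda>y. y * z"] by (simp_all add: algebra_simps cs_simps)
  \<comment> \<open>The first pass moves the letters \<open>b\<close> and \<open>t\<close> to the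
    left; the second reduces words in \<open>f\<close>, \<open>x\<close> and words in
    \<open>b\<close> by the quadratic relations. \<open>Q\<close>, \<open>Z\<close>,
    \<open>R\<close> cancel as free letters.\<close>
  show ?thesis
    by (simp add: algebra_simps cs_simps c1) (simp add: f e b b' algebra_simps cs_simps c1)
qed

text \<open>A filtration suffices to state congruences; a grading would call for a proof that the
  sum of the homogeneous parts is direct.\<close>

locale filtration =
  fixes F :: "int \<Rightarrow> 'a::typed_algebra set"
  assumes F_add: "\<And>d x y. x \<in> F d \<Longrightarrow> y \<in> F d \<Longrightarrow> x + y \<in> F d"
    and F_zero: "\<And>d. 0 \<in> F d"
    and F_cs: "\<And>d c x. x \<in> F d \<Longrightarrow> c *c x \<in> F d"
    and F_mult: "\<And>d d' x y. x \<in> F d \<Longrightarrow> y \<in> F d' \<Longrightarrow> x * y \<in> F (d + d')"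
    and F_mono: "\<And>d d'. d \<le> d' \<Longrightarrow> F d' \<subseteq> F d"
begin

lemma F_sum: "(\<And>i. i \<in> I \<Longrightarrow> h i \<in> F d) \<Longrightarrow> sum h I \<in> F d"
  by (induction I rule: infinite_finite_induct) (auto intro: F_add F_zero)

end

text \<open>
  Indexing: \<open>g n\<close> is \<open>\<phi>\<^sup>+\<^sub>n\<close>, whereas \<open>f (Suc n)\<close> is \<open>\<phi>\<^sup>-\<^sub>-\<^sub>n\<close> and \<open>f 0 = 0\<close>, so that the exchange relations hold
  without exception. The element \<open>h\<close> stands for \<open>C h\<^sub>1 - h\<^sub>-\<^sub>1\<close>, and \<open>e\<close> is the unit of the subalgebra
  in question, which need not be a unit of the type.
\<close>

locale loop_sys = filtration F for F :: "int \<Rightarrow> 'a::typed_algebra set" +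
  fixes q C :: complex and e K K' h :: 'a and xp xm :: "int \<Rightarrow> 'a"
    and f g :: "nat \<Rightarrow> 'a"
  assumes q0: "q \<noteq> 0" and q4: "q ^ 4 \<noteq> 1" and C0: "C \<noteq> 0"
    and KK: "K * K' = e" "K' * K = e"
    and e_l: "\<And>k. e * xp k = xp k" "\<And>k. e * xm k = xm k" "\<And>n. e * f n = f n" "\<And>n. e * g n = g n"
    and xpK: "\<And>k. xp k * K = q powi (-2) *c (K * xp k)" "\<And>k. xp k * K' = q\<^sup>2 *c (K' * xp k)"
    and xmK: "\<And>k. xm k * K = q\<^sup>2 *c (K * xm k)" "\<And>k. xm k * K' = q powi (-2) *c (K' * xm k)"
    and h_xp: "\<And>k. h * xp k - xp k * h = (q + inverse q) *c (C *c xp (k + 1) - xp (k - 1))"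
    and h_xm: "\<And>k. h * xm k - xm k * h = (q + inverse q) *c (xm (k - 1) - C *c xm (k + 1))"
    and h_f: "\<And>n. f n * h = h * f n"
    and h_def: "(q - inverse q) *c h = C *c (K' * g 1) + f 2 * K"
    and f0: "f 0 = 0" and f1: "f 1 = K'" and g0: "g 0 = K"
    and gf: "\<And>m n. f n * g m = g m * f n" and ff: "\<And>m n. f n * f m = f m * f n"
    and f_xp: "\<And>n k. f (Suc n) * xp (k + 1) - q powi (-2) *c (f n * xp k) =
       q powi (-2) *c (xp (k + 1) * f (Suc n)) - xp k * f n"
    and f_xm: "\<And>n k. f (Suc n) * xm (k + 1) - q\<^sup>2 *c (f n * xm k) =
       q\<^sup>2 *c (xm (k + 1) * f (Suc n)) - xm k * f n"
    and xp_xm_pos: "\<And>k l. k + l > 0 \<Longrightarrow>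
       (q - inverse q) *c (xp k * xm l - xm l * xp k) = g (nat (k + l))"
    and xp_xm_0: "\<And>k l. k + l = 0 \<Longrightarrow>
       (q - inverse q) *c (xp k * xm l - xm l * xp k) = K - K'"
    and xp_xm_neg: "\<And>k l. k + l < 0 \<Longrightarrow>
       (q - inverse q) *c (xp k * xm l - xm l * xp k) = - f (Suc (nat (- (k + l))))"
    and xp_xp: "xp 0 * xp (-1) = q\<^sup>2 *c (xp (-1) * xp 0)"
    and xm_xm: "\<And>k l. xm (k + 1) * xm l - q powi (-2) *c (xm l * xm (k + 1)) =
       q powi (-2) *c (xm k * xm (l + 1)) - xm (l + 1) * xm k"
    and F_gen: "\<And>k. xp k \<in> F 1" "\<And>k. xm k \<in> F (-1)" "K \<in> F 0" "\<And>n. f n \<in> F 0"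
      "\<And>n. g n \<in> F 0" "h \<in> F 0"

text \<open>
  \<open>\<Gamma> n\<close> is \<open>\<Theta>\<^sub>n - q\<^sup>-\<^sup>2 C \<Theta>\<^sub>n\<^sub>-\<^sub>2\<close>, the combination that occurs in the q-Onsager relations; in particular
  \<open>\<Gamma> 1 = H\<^sub>1\<close>. The primed families are the images of the unprimed ones under the coaction.
\<close>

locale coideal_sys = loop_sys F q C e K K' h xp xm f g
  for F and q C :: complex and e K K' h :: "'a::typed_algebra" and xp xm f g +
  fixes c1 :: complex and a \<Gamma> a' \<Gamma>' :: "int \<Rightarrow> 'a"
  assumes c1: "c1 \<noteq> 0"
    and e_a: "\<And>r. a r * e = a r" "\<And>r. \<Gamma> r * e = \<Gamma> r"
    and a_comm:
      "\<And>r k. xp k * a r = a r * xp k" "\<And>r k. xm k * a r = a r * xm k" "\<And>r. K * a r = a r * K"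
      "\<And>r n. f n * a r = a r * f n" "\<And>r n. g n * a r = a r * g n" "\<And>r. h * a r = a r * h"
      "\<And>r k. xp k * \<Gamma> r = \<Gamma> r * xp k" "\<And>r k. xm k * \<Gamma> r = \<Gamma> r * xm k" "\<And>r. K * \<Gamma> r = \<Gamma> r * K"
      "\<And>r n. f n * \<Gamma> r = \<Gamma> r * f n" "\<And>r n. g n * \<Gamma> r = \<Gamma> r * g n"
    and \<Gamma>0: "(q - inverse q) *c \<Gamma> 0 = e" and \<Gamma>neg: "\<And>n. n < 0 \<Longrightarrow> \<Gamma> n = 0"
    and \<Gamma>_a: "\<And>r. \<Gamma> 1 * a r - a r * \<Gamma> 1 = (q + inverse q) *c (a (r + 1) - C *c a (r - 1))"
    and onsager: "\<And>r s. (a r * a (s + 1) - q powi (-2) *c (a (s + 1) * a r))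
        + (a s * a (r + 1) - q powi (-2) *c (a (r + 1) * a s)) =
        (c1 * C powi r) *c \<Gamma> (s - r + 1) + (c1 * C powi s) *c \<Gamma> (r - s + 1)"
    and a_F: "\<And>r. a r \<in> F 0" "\<And>r. \<Gamma> r \<in> F 0"
    and a'_0: "a' 0 = xm 0 + a 0 * K' - (c1 * q\<^sup>2) *c (K' * xp 0)"
    and a'_m1: "a' (-1) = xm 1 + a (-1) * K - (c1 / C) *c (K * xp (-1))"
    and \<Gamma>'0: "(q - inverse q) *c \<Gamma>' 0 = e" and \<Gamma>'neg: "\<And>n. n < 0 \<Longrightarrow> \<Gamma>' n = 0"
    and \<Gamma>'_a: "\<And>r. \<Gamma>' 1 * a' r - a' r * \<Gamma>' 1 = (q + inverse q) *c (a' (r + 1) - C *c a' (r - 1))"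
    and onsager': "\<And>r s. (a' r * a' (s + 1) - q powi (-2) *c (a' (s + 1) * a' r))
        + (a' s * a' (r + 1) - q powi (-2) *c (a' (r + 1) * a' s)) =
        (c1 * C powi r) *c \<Gamma>' (s - r + 1) + (c1 * C powi s) *c \<Gamma>' (r - s + 1)"

section \<open>Scalars and convolutions with phi^-\<close>

context loop_sys begin

definition p where "p = q powi (-2)"
definition u where "u = q\<^sup>2"
definition \<kappa> where "\<kappa> = q - inverse q"
definition b2 where "b2 = q + inverse q"

text \<open>The hypothesis q^4 \<noteq> 1 says that (q^2 - 1)(q^2 + 1) does not vanish; up to a
  factor q these are \<open>\<kappa>\<close> and \<open>b2\<close>, and the second one is
  \<open>u + 1\<close>.\<close>

lemma scal: "p * u = 1" "u * p = 1" "u \<noteq> 0" "p \<noteq> 0" "\<kappa> \<noteq> 0" "b2 \<noteq> 0" "u + 1 \<noteq> 0"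
  "b2 * \<kappa> = u - p" "\<kappa> * b2 = u - p"
proof -
  have a: "(q\<^sup>2 - 1) * (q\<^sup>2 + 1) \<noteq> 0" using q4 by (simp add: algebra_simps power_numeral_reduce)
  show "p * u = 1" "u * p = 1" "u \<noteq> 0" "p \<noteq> 0" unfolding p_def u_def using q0
    by (auto simp: power_int_minus field_simps power2_eq_square)
  have "q * \<kappa> = q\<^sup>2 - 1" "q * b2 = q\<^sup>2 + 1" using q0 by (auto simp: \<kappa>_def b2_def field_simps power2_eq_square)
  then show "\<kappa> \<noteq> 0" "b2 \<noteq> 0" using a by auto
  show "u + 1 \<noteq> 0" using a unfolding u_def by auto
  show "b2 * \<kappa> = u - p" "\<kappa> * b2 = u - p" unfolding b2_def \<kappa>_def u_def p_def using q0
    by (auto simp: power_int_minus field_simps power2_eq_square)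
qed

text \<open>Since \<open>f\<close> is indexed one higher than phi^-, this is the coefficient of
  z^(n-1) in the product of the series of b_(i+t) z^t with phi^-(1/z). Splitting off the first term
  keeps the start \<open>i\<close> free for inductions that shift it.\<close>

fun conv :: "(int \<Rightarrow> 'a) \<Rightarrow> int \<Rightarrow> nat \<Rightarrow> 'a" where
  "conv b i 0 = 0"
| "conv b i (Suc n) = b i * f (Suc n) + conv b (i + 1) n"


lemma F_minus: "x \<in> F d \<Longrightarrow> - x \<in> F d" using F_cs[of x d "-1"] by simp
lemma F_diff: "x \<in> F d \<Longrightarrow> y \<in> F d \<Longrightarrow> x - y \<in> F d"
  using F_add[of x d "- y"] F_minus by simp

end

section \<open>The degree preserving part of the commutator with H_1\<close>

context coideal_sys begin

text \<open>\<open>\<Gamma> 1 + h\<close> is the degree zero part of \<open>\<Gamma>' 1\<close>, see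
  \<open>\<Gamma>'_1\<close>. The factor removes the scalar [2] from the action on \<open>a\<close>,
  \<open>xp\<close> and \<open>xm\<close>.\<close>

definition L where "L z = (1 / b2) *c ((\<Gamma> 1 + h) * z - z * (\<Gamma> 1 + h))"

lemma L_mult: "L (x * y) = L x * y + x * L y"
  unfolding L_def by (simp add: algebra_simps cs_simps)
lemma L_add: "L (x + y) = L x + L y" and L_diff: "L (x - y) = L x - L y"
  and L_minus: "L (- x) = - L x" and L_cs: "L (c *c x) = c *c L x" and L_0: "L 0 = 0"
  unfolding L_def by (simp_all add: algebra_simps cs_simps)

lemma L_a: "L (a r) = a (r + 1) - C *c a (r - 1)"
proof -
  have "L (a r) = (1 / b2) *c (\<Gamma> 1 * a r - a r * \<Gamma> 1)"
    unfolding L_def by (simp add: algebra_simps a_comm)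
  then show ?thesis using \<Gamma>_a[of r] scal by (simp add: cs_simps b2_def)
qed

lemma L_xp: "L (xp r) = C *c xp (r + 1) - xp (r - 1)"
proof -
  have "L (xp r) = (1 / b2) *c (h * xp r - xp r * h)"
    unfolding L_def by (simp add: algebra_simps a_comm)
  then show ?thesis using h_xp[of r] scal by (simp add: cs_simps b2_def)
qed

lemma L_xm: "L (xm r) = xm (r - 1) - C *c xm (r + 1)"
proof -
  have "L (xm r) = (1 / b2) *c (h * xm r - xm r * h)"
    unfolding L_def by (simp add: algebra_simps a_comm)
  then show ?thesis using h_xm[of r] scal by (simp add: cs_simps b2_def)
qed

lemma L_f: "L (f n) = 0"
  unfolding L_def by (simp add: algebra_simps a_comm h_f)

lemmas L_simps = L_mult L_add L_diff L_minus L_cs L_0 L_a L_xp L_xm L_f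

lemma a_comm':
   "xp k * (a r * z) = a r * (xp k * z)" "xm k * (a r * z) = a r * (xm k * z)" "K * (a r * z) = a r * (K * z)"
   "f n * (a r * z) = a r * (f n * z)" "g n * (a r * z) = a r * (g n * z)"
   "xp k * (\<Gamma> r * z) = \<Gamma> r * (xp k * z)" "xm k * (\<Gamma> r * z) = \<Gamma> r * (xm k * z)" "K * (\<Gamma> r * z) = \<Gamma> r * (K * z)"
   "f n * (\<Gamma> r * z) = \<Gamma> r * (f n * z)" "g n * (\<Gamma> r * z) = \<Gamma> r * (g n * z)"
  by (rule comm2, rule a_comm)+

text \<open>\<open>L\<close> kills \<open>f\<close> and shifts the index of \<open>a\<close> up and
  down, so both sums are convolutions again; the two isolated terms correct the start of the
  range.\<close>

lemma conv_rec: "L (conv a i m) = conv a i (Suc m) - C *c conv a i (m - 1) - a i * f (Suc m) - C *c (a (i - 1) * f m)"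
proof (induction m arbitrary: i)
  case 0
  then show ?case by (simp add: L_0 f0)
next
  case (Suc m)
  show ?case
  proof (cases m)
    case 0
    then show ?thesis by (simp add: L_simps f0 cs_simps left_diff_distrib)
  next
    case (Suc k)
    have "L (conv a i (Suc m)) = (a (i + 1) - C *c a (i - 1)) * f (Suc m) + L (conv a (i + 1) m)"
      by (simp add: L_mult L_add L_f L_a)
    also have "\<dots> = conv a i (Suc (Suc m)) - C *c conv a i (Suc m - 1) - a i * f (Suc (Suc m)) - C *c (a (i - 1) * f (Suc m))"
      unfolding Suc.IH[of "i+1"] using Suc by (simp add: cs_simps left_diff_distrib)
    finally show ?thesis .
  qed
qed

section \<open>Closed form and recursion of the part of degree one\<close>

lemma onsager1: "a (i + 1) * a i = u *c (a i * a (i + 1)) - (u * c1 * C powi i) *c \<Gamma> 1"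
proof -
  have "a i * a (i + 1) - p *c (a (i + 1) * a i) = (c1 * C powi i) *c \<Gamma> 1"
    by (rule cs_double) (use onsager[of i i] in \<open>simp add: p_def\<close>)
  from arg_cong[OF this, of "\<lambda>z. u *c z"] show ?thesis
    using scal by (simp add: algebra_simps cs_simps)
qed

text \<open>The symmetrised product, normalised such that \<open>s 1 i = K' * xp i\<close> (lemma
  \<open>s1\<close>). As \<open>L\<close> kills \<open>f\<close>, it merely shifts \<open>i\<close>
  in \<open>s n i\<close>.\<close>

definition s where "s n i = (1 / (u + 1)) *c (xp i * f n + f n * xp i)"

lemma f_xp_s: "f n * xp i = u *c s n i + s n i - xp i * f n"
proof -
  have "u *c s n i + s n i = (u + 1) *c s n i" by (simp add: cs_add_left cs_one)
  also have "\<dots> = xp i * f n + f n * xp i" using scal by (simp add: s_def cs_cs cs_one)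
  finally show ?thesis by simp
qed

text \<open>Rewriting the products \<open>f * xp\<close> by \<open>f_xp_s\<close> turns the exchange
  relation into \<open>u + 1\<close> times this equation.\<close>

lemma s_exchange: "xp i * f (Suc n) = xp (i - 1) * f n + u *c s (Suc n) i - s n (i - 1)"
proof -
  have "f (Suc n) * xp i - p *c (f n * xp (i - 1)) = p *c (xp i * f (Suc n)) - xp (i - 1) * f n"
    using f_xp[of n "i - 1"] by (simp add: p_def)
  from arg_cong[OF this, of "\<lambda>z. u *c z"]
  have 1: "u *c (f (Suc n) * xp i) + u *c (xp (i - 1) * f n) = xp i * f (Suc n) + f n * xp (i - 1)"
    using scal by (simp add: algebra_simps cs_simps)
  have "(u + 1) *c (xp i * f (Suc n)) = (u + 1) *c (xp (i - 1) * f n + u *c s (Suc n) i - s n (i - 1))"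
    using 1 unfolding f_xp_s by (simp add: algebra_simps cs_simps cs_add_left)
  then show ?thesis using scal by (subst (asm) cs.scale_cancel_left) auto
qed

lemma a_s: "s n i * a r = a r * s n i" "s n i * \<Gamma> r = \<Gamma> r * s n i"
  unfolding s_def by (simp_all add: algebra_simps cs_simps a_comm a_comm')

lemma L_s: "L (s n i) = C *c s n (i + 1) - s n (i - 1)"
  unfolding s_def by (simp add: L_simps algebra_simps cs_simps)

lemma s0: "s 0 i = 0" by (simp add: s_def f0)

text \<open>
  \<open>P 0 (Suc r)\<close> is the part of degree one of \<open>a' r\<close>. The summand \<open>G i\<close> comes from conjugation by the
  rank one factor \<open>1 - \<kappa> a\<^sub>i x\<^sup>+\<^sub>i + \<dots>\<close> of the quasi K-matrix, which shifts the origin of the index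
  \<open>r\<close> from \<open>i\<close> to \<open>i + 1\<close>.
\<close>

definition G where "G i n = - (\<kappa> *c (a i * xp i * conv a (i + 1) (n - 1) - conv a (i + 1) (n - 1) * a i * xp i))
   + \<kappa> *c (a i * a i * f n * xp i) - \<kappa> *c (a i * a i * s n i) - (u * c1 * C powi i) *c s n i"

fun P where
  "P i 0 = 0"
| "P i (Suc n) = G i (Suc n) + P (i + 1) n"

text \<open>The source term of the recursion of \<open>P\<close>. At \<open>i = 0\<close> the first
  part is the action of the degree one part of \<open>\<Gamma>' 1\<close> on the convolution, the
  second part that of its degree two part on x^-; see \<open>approx_rec\<close>. The other
  \<open>i\<close> serve the telescoping.\<close>

definition S where "S i n = - (\<kappa> *c ((C *c (a (i-1) * xp i) + a i * xp (i-1)) * conv a i n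
    - conv a i n * (C *c (a (i-1) * xp i) + a i * xp (i-1))))
   - (c1 * C powi i * u) *c (xp (i-1) * f n + f (n+1) * xp i)"

lemma G0: "G i 0 = 0" by (simp add: G_def f0 s0)

lemma s1: "s 1 i = K' * xp i"
proof -
  have "xp i * f 1 = u *c (K' * xp i)" using xpK(2) f1 by (simp add: u_def)
  then have "s 1 i = (1 / (u + 1)) *c (u + 1) *c (K' * xp i)"
    using f1 by (simp add: s_def cs_add_left cs_one)
  then show ?thesis using scal by (simp add: cs_cs cs_one)
qed

lemma G1: "G i 1 = - ((c1 * C powi i * u) *c (K' * xp i))"
  using f1 s1[of i] by (simp add: G_def algebra_simps)

lemma S0: "S i 0 = - ((c1 * C powi i * u) *c (K' * xp i))"
  using f1 f0 by (simp add: S_def)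

text \<open>A single \<open>G i\<close> satisfies the recursion only up to a difference of source
  terms, which cancels in the sum over shifts. The relations of the unprimed family enter only
  through \<open>onsager1\<close> for the neighbours i-1, i and i, i+1.\<close>

lemma G_rec:
  assumes "m \<ge> 1"
  shows "G i (m + 1) - C *c G i (m - 1) - L (G i m) = S i m - S (i + 1) (m - 1)"
proof -
  obtain k where m: "m = Suc k" using assms by (cases m) auto
  define Z where "Z = conv a (i + 1) k"
  have Z: "L Z = conv a (i + 1) (Suc k) - C *c conv a (i + 1) (k - 1) - a (i + 1) * f (Suc k) - C *c (a i * f k)"
    using conv_rec[of "i+1" k] by (simp add: Z_def)
  have cvk: "conv a i (Suc k) = a i * f (Suc k) + Z" by (simp add: Z_def)
  note e1 = s_exchange[of i "Suc k"] s_exchange[of "i+1" k, simplified]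
  have on: "a (i + 1) * a i = u *c (a i * a (i + 1)) - (u * c1 * C powi i) *c \<Gamma> 1"
    by (rule onsager1)
  have Cp: "C * C powi (i - 1) = C powi i" "C powi (i + 1) = C * C powi i" using C0
    by (auto simp: power_int_diff power_int_add)
  have on': "C *c (a i * a (i - 1)) = (C * u) *c (a (i - 1) * a i) - (u * c1 * C powi i) *c \<Gamma> 1"
    using arg_cong[OF onsager1[of "i - 1"], of "\<lambda>z. C *c z"] Cp by (simp add: cs_simps mult_ac)
  define R where "R = conv a (i + 1) (k - 1)"
  define Q where "Q = conv a (i + 1) (Suc k)"
  have LZ: "L Z = Q - C *c R - a (i + 1) * f (Suc k) - C *c (a i * f k)"
    using Z by (simp add: R_def Q_def)
  have G1: "G i (Suc (Suc k)) = - (\<kappa> *c (a i * xp i * Q - Q * a i * xp i))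
   + \<kappa> *c (a i * a i * f (Suc (Suc k)) * xp i) - \<kappa> *c (a i * a i * s (Suc (Suc k)) i) - (u * c1 * C powi i) *c s (Suc (Suc k)) i"
    unfolding G_def Q_def by simp
  have G2: "G i k = - (\<kappa> *c (a i * xp i * R - R * a i * xp i))
   + \<kappa> *c (a i * a i * f k * xp i) - \<kappa> *c (a i * a i * s k i) - (u * c1 * C powi i) *c s k i"
    unfolding G_def R_def by simp
  have G3: "L (G i (Suc k)) = L (- (\<kappa> *c (a i * xp i * Z - Z * a i * xp i))
   + \<kappa> *c (a i * a i * f (Suc k) * xp i) - \<kappa> *c (a i * a i * s (Suc k) i) - (u * c1 * C powi i) *c s (Suc k) i)"
    unfolding G_def Z_def by simp
  have S1: "S i (Suc k) = - (\<kappa> *c ((C *c (a (i-1) * xp i) + a i * xp (i-1)) * (a i * f (Suc k) + Z)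
    - (a i * f (Suc k) + Z) * (C *c (a (i-1) * xp i) + a i * xp (i-1))))
   - (c1 * C powi i * u) *c (xp (i-1) * f (Suc k) + f (Suc (Suc k)) * xp i)"
    unfolding S_def cvk by simp
  have S2: "S (i + 1) k = - (\<kappa> *c ((C *c (a i * xp (i + 1)) + a (i + 1) * xp i) * Z
    - Z * (C *c (a i * xp (i + 1)) + a (i + 1) * xp i)))
   - (c1 * (C * C powi i) * u) *c (xp i * f k + f (Suc k) * xp (i + 1))"
    unfolding S_def Z_def using Cp by simp
  have lhs: "G i (Suc (Suc k)) - C *c G i k - L (G i (Suc k)) - S i (Suc k) + S (i + 1) k = 0"
  proof -
    let ?\<gamma> = "u * c1 * C powi i"
    \<comment> \<open>Every factor C is absorbed into a letter, as in C a_(i-1), C x^+_(i+1), C f_k,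
      which gives the form of \<open>G_rec_aux\<close>.\<close>
    have 1: "G i (Suc (Suc k)) - C *c G i k - L (G i (Suc k)) - S i (Suc k) + S (i + 1) k =
      - (\<kappa> *c (a i * xp i * Q - Q * a i * xp i)) + \<kappa> *c (a i * a i * f (Suc (Suc k)) * xp i) - \<kappa> *c (a i * a i * s (Suc (Suc k)) i) - ?\<gamma> *c s (Suc (Suc k)) i
    - (- (\<kappa> *c (a i * xp i * (C *c R) - (C *c R) * a i * xp i)) + \<kappa> *c (a i * a i * (C *c f k) * xp i) - \<kappa> *c (a i * a i * (C *c s k i)) - ?\<gamma> *c (C *c s k i))
    - (- (\<kappa> *c (((a (i + 1) - C *c a (i - 1)) * xp i + a i * (C *c xp (i + 1) - xp (i - 1))) * Z + a i * xp i * (Q - C *c R - a (i + 1) * f (Suc k) - a i * (C *c f k))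
         - (((Q - C *c R - a (i + 1) * f (Suc k) - a i * (C *c f k)) * a i + Z * (a (i + 1) - C *c a (i - 1))) * xp i + Z * a i * (C *c xp (i + 1) - xp (i - 1)))))
       + \<kappa> *c (((a (i + 1) - C *c a (i - 1)) * a i + a i * (a (i + 1) - C *c a (i - 1))) * f (Suc k) * xp i + a i * a i * f (Suc k) * (C *c xp (i + 1) - xp (i - 1)))
       - \<kappa> *c (((a (i + 1) - C *c a (i - 1)) * a i + a i * (a (i + 1) - C *c a (i - 1))) * s (Suc k) i + a i * a i * (C *c s (Suc k) (i + 1) - s (Suc k) (i - 1))) - ?\<gamma> *c (C *c s (Suc k) (i + 1) - s (Suc k) (i - 1)))
    - (- (\<kappa> *c ((C *c a (i - 1) * xp i + a i * xp (i - 1)) * (a i * f (Suc k) + Z) - (a i * f (Suc k) + Z) * (C *c a (i - 1) * xp i + a i * xp (i - 1))))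
       - ?\<gamma> *c (xp (i - 1) * f (Suc k) + f (Suc (Suc k)) * xp i))
    + (- (\<kappa> *c ((a i * C *c xp (i + 1) + a (i + 1) * xp i) * Z - Z * (a i * C *c xp (i + 1) + a (i + 1) * xp i))) - ?\<gamma> *c (xp i * (C *c f k) + f (Suc k) * (C *c xp (i + 1))))"
      unfolding G1 G2 G3 S1 S2
      by (simp add: L_simps L_s LZ cs_simps algebra_simps)
    have 2: "(C *c f n) * xp i = u *c (C *c s n i) + C *c s n i - xp i * (C *c f n)"
      "f n * (C *c xp i) = u *c (C *c s n i) + C *c s n i - (C *c xp i) * f n" for n i
      using arg_cong[OF f_xp_s[of n i], of "\<lambda>z. C *c z"] by (simp_all add: cs_simps mult.commute)
    have 3: "(C *c xp (i + 1)) * f (Suc k) = xp i * (C *c f k) + u *c (C *c s (Suc k) (i + 1)) - C *c s k i"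
      using arg_cong[OF e1(2), of "\<lambda>z. C *c z"] by (simp add: cs_simps mult.commute)
    have 4: "a i * (C *c a (i - 1)) = u *c ((C *c a (i - 1)) * a i) - ?\<gamma> *c \<Gamma> 1"
      using on' by (simp add: cs_simps mult.commute)
    show ?thesis unfolding 1
      by (rule G_rec_aux[OF f_xp_s 2(1) f_xp_s 2(2) f_xp_s e1(1) 3 on 4])
        (auto simp: cs_simps a_comm a_s)
  qed
  then show ?thesis by (simp add: algebra_simps m)
qed


text \<open>\<open>G_rec\<close> telescopes along the shift of \<open>i\<close>; the sum ends with
  the coincidence of \<open>G1\<close> and \<open>S0\<close>.\<close>

lemma P_rec: "P i (Suc m) - C *c P i (m - 1) - L (P i m) = S i m"
proof (induction m arbitrary: i)
  case 0
  then show ?case using G1[of i] by (simp add: L_0 S0)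
next
  case (Suc m)
  have "G i (Suc m + 1) - C *c G i (Suc m - 1) - L (G i (Suc m)) = S i (Suc m) - S (i + 1) m"
    using G_rec[of "Suc m" i] by simp
  then show ?case using Suc[of "i + 1"] by (cases m) (simp_all add: L_add L_0 cs_simps algebra_simps G0)
qed

lemma F_le: "x \<in> F d' \<Longrightarrow> d \<le> d' \<Longrightarrow> x \<in> F d"
  using F_mono by blast
lemma F_mult': "x \<in> F d \<Longrightarrow> y \<in> F d' \<Longrightarrow> d'' \<le> d + d' \<Longrightarrow> x * y \<in> F d''"
  using F_mult F_le by blast

lemma conv_F: "(\<And>r. b r \<in> F 0) \<Longrightarrow> conv b i n \<in> F 0"
  by (induction n arbitrary: i) (auto intro!: F_zero F_add F_mult'[of _ 0 _ 0] F_gen)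

lemma F_mult0: "x \<in> F 0 \<Longrightarrow> y \<in> F d \<Longrightarrow> x * y \<in> F d"
  and F_mult0': "x \<in> F d \<Longrightarrow> y \<in> F 0 \<Longrightarrow> x * y \<in> F d"
  using F_mult[of x 0 y d] F_mult[of x d y 0] by simp_all

lemma G_F: "G i n \<in> F 1"
proof -
  have conv: "conv a (i + 1) (n - 1) \<in> F 0" by (intro conv_F a_F)
  have s: "s n i \<in> F 1" unfolding s_def
    by (intro F_cs F_add) (auto intro: F_mult0 F_mult0' F_gen)
  show ?thesis unfolding G_def mult.assoc
    by (intro F_add F_diff F_minus F_cs F_mult0[OF a_F(1)] F_mult0[OF conv] F_mult0'[OF _ conv] F_mult0[OF F_gen(4)] F_gen s)
qed

lemma P_F: "P i n \<in> F 1"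
  by (induction n arbitrary: i) (auto intro!: F_zero F_add G_F)

end

text \<open>The computation behind \<open>\<Gamma>'_1\<close> in letters: \<open>y0\<close>,
  \<open>y1\<close> are x^-_0, x^-_1, while \<open>x0\<close> and \<open>xm\<close> are x^+_0 and
  x^+_(-1); \<open>a0\<close>, \<open>am\<close>, \<open>t\<close> are a_0, a_(-1), Gamma_1, and
  \<open>c\<close>, \<open>d\<close> are c1 q^2 and c1/C. The powers of q make all terms of negative
  degree cancel.\<close>

lemma onsager1_aux:
  fixes K :: "'a::typed_algebra"
  assumes KK: "K * K' = e" "K' * K = e"
    and a: "a0 * am = u *c (am * a0) - (u * d) *c t" "am * a0 * e = am * a0" "t * e = t"
    and x: "x0 * K = p *c (K * x0)" "x0 * K' = u *c (K' * x0)" "xm * K = p *c (K * xm)" "xm * K' = u *c (K' * xm)"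
    and y: "y0 * K = u *c (K * y0)" "y0 * K' = p *c (K' * y0)" "y1 * K = u *c (K * y1)" "y1 * K' = p *c (K' * y1)"
    and xx: "x0 * xm = u *c (xm * x0)" and yy: "y1 * y0 = p *c (y0 * y1)"
    and AB: "x0 * y1 = A + y1 * x0" "xm * y0 = B + y0 * xm"
    and ex: "e * x0 = x0" "e * xm = xm"
    and comm: "\<And>x y. x \<in> {x0, xm, y0, y1, K, K'} \<Longrightarrow> y \<in> {a0, am, t} \<Longrightarrow> x * y = y * x"
    and up: "p * u = 1" "u * p = 1"
  shows "(y1 + am * K - d *c (K * xm)) * (y0 + a0 * K' - c *c (K' * x0))
     - p *c ((y0 + a0 * K' - c *c (K' * x0)) * (y1 + am * K - d *c (K * xm)))
   = d *c t + (c * p) *c (K' * A) - d *c (K * B)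
     - (c * (1 - p * p)) *c (am * x0) - (d * (u - p)) *c (a0 * xm) + (c * d * (u - p)) *c (xm * x0)"
proof -
  note base = KK x y xx yy AB a(1) ex
  have b': "K * (K' * z) = e * z" "K' * (K * z) = e * z"
    "a0 * (am * z) = u *c (am * (a0 * z)) - (u * d) *c (t * z)"
    "x0 * (K * z) = p *c (K * (x0 * z))" "x0 * (K' * z) = u *c (K' * (x0 * z))" "xm * (K * z) = p *c (K * (xm * z))" "xm * (K' * z) = u *c (K' * (xm * z))"
    "y0 * (K * z) = u *c (K * (y0 * z))" "y0 * (K' * z) = p *c (K' * (y0 * z))" "y1 * (K * z) = u *c (K * (y1 * z))" "y1 * (K' * z) = p *c (K' * (y1 * z))"
    "e * (x0 * z) = x0 * z" "e * (xm * z) = xm * z"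
    for z
    using base[THEN arg_cong, of "\<lambda>y. y * z"]  by (simp_all add: mult.assoc mult_cs_left left_diff_distrib)
  have a2: "am * (a0 * e) = am * a0" using a(2) by (simp add: mult.assoc)
  have c1: "x * y = y * x" "x * (y * z) = y * (x * z)"
    if "x \<in> {x0, xm, y0, y1, K, K'}" "y \<in> {a0, am, t}" for x y z
    using comm[OF that] by (simp_all add: mult.assoc flip: mult.assoc)
  have up': "p * (u * z) = z" "u * (p * z) = z" for z using up by (simp_all flip: mult.assoc)
  have c2: "K * a0 = a0 * K" "K * (a0 * z) = a0 * (K * z)" "K * am = am * K" "K * (am * z) = am * (K * z)"
    "K' * a0 = a0 * K'" "K' * (a0 * z) = a0 * (K' * z)" "K' * am = am * K'" "K' * (am * z) = am * (K' * z)"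
    "x0 * a0 = a0 * x0" "x0 * (a0 * z) = a0 * (x0 * z)" "x0 * am = am * x0" "x0 * (am * z) = am * (x0 * z)"
    "xm * a0 = a0 * xm" "xm * (a0 * z) = a0 * (xm * z)" "xm * am = am * xm" "xm * (am * z) = am * (xm * z)"
    "y0 * a0 = a0 * y0" "y0 * (a0 * z) = a0 * (y0 * z)" "y0 * am = am * y0" "y0 * (am * z) = am * (y0 * z)"
    "y1 * a0 = a0 * y1" "y1 * (a0 * z) = a0 * (y1 * z)" "y1 * am = am * y1" "y1 * (am * z) = am * (y1 * z)" for z
    by (rule c1; simp)+
  show ?thesis
    by (simp add: algebra_simps cs_simps c2 base b' a2 a(3) cs_add_left cs.scale_left_diff_distrib up up')
qed

section \<open>The image of H_1\<close>

context coideal_sys begin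

lemma Kx: "xp k * K = p *c (K * xp k)" "xp k * K' = u *c (K' * xp k)"
     "xm k * K = u *c (K * xm k)" "xm k * K' = p *c (K' * xm k)" for k
  using xpK[of k] xmK[of k] by (simp_all add: p_def u_def)

text \<open>The diagonal relation \<open>r = s = -1\<close> expresses \<open>\<Gamma>' 1\<close> by
  the two given elements \<open>a' (-1)\<close> and \<open>a' 0\<close>, so it is known exactly and
  not only up to some degree.\<close>

lemma \<Gamma>'_1: "\<Gamma>' 1 = \<Gamma> 1 + h - (u - p) *c (C *c (a (-1) * xp 0) + a 0 * xp (-1))
    + (c1 * u * (u - p)) *c (xp (-1) * xp 0)"
proof -
  have "a' (-1) * a' 0 - p *c (a' 0 * a' (-1)) = (c1 / C) *c \<Gamma>' 1"
    by (rule cs_double) (use onsager'[of "-1" "-1"] in \<open>simp add: p_def power_int_minus field_simps\<close>)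
  then have 1: "\<Gamma>' 1 = (C / c1) *c (a' (-1) * a' 0 - p *c (a' 0 * a' (-1)))"
    using c1 C0 by (simp add: cs_cs cs_one)
  have on: "a 0 * a (-1) = u *c (a (-1) * a 0) - (u * (c1 / C)) *c \<Gamma> 1"
    using onsager1[of "-1"] by (simp add: power_int_minus field_simps)
  have xx: "xp 0 * xp (-1) = u *c (xp (-1) * xp 0)" using xp_xp by (simp add: u_def)
  have yy: "xm 1 * xm 0 = p *c (xm 0 * xm 1)"
  proof -
    have "xm 1 * xm 0 - p *c (xm 0 * xm 1) = p *c (xm 0 * xm 1) - xm 1 * xm 0"
      using xm_xm[of 0 0] by (simp add: p_def)
    then show ?thesis by - (rule cs_double, simp add: algebra_simps)
  qed
  \<comment> \<open>The mixed terms enter through these two brackets. Up to \<open>\<kappa>\<close>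
    and sign they are \<open>g 1\<close> and \<open>f 2\<close>, and \<open>h_def\<close>
    reassembles them to \<open>h\<close>.\<close>
  define A where "A = xp 0 * xm 1 - xm 1 * xp 0"
  define B where "B = xp (-1) * xm 0 - xm 0 * xp (-1)"
  have AB: "xp 0 * xm 1 = A + xm 1 * xp 0" "xp (-1) * xm 0 = B + xm 0 * xp (-1)"
    by (simp_all add: A_def B_def)
  have "\<kappa> *c h = C *c (K' * g 1) + f 2 * K" using h_def by (simp add: \<kappa>_def)
  moreover have "\<kappa> *c A = g 1" "- (\<kappa> *c B) = f 2" unfolding \<kappa>_def A_def B_def
     using xp_xm_pos[of 0 1] xp_xm_neg[of "-1" 0] by (simp_all add: numeral_2_eq_2)
  ultimately have "\<kappa> *c h = C *c (K' * (\<kappa> *c A)) + (- (\<kappa> *c B)) * K"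
    by simp
  then have "\<kappa> *c h = \<kappa> *c (C *c (K' * A) - B * K)"
    by (simp add: cs_simps mult.commute)
  then have h: "h = C *c (K' * A) - B * K" using scal by (subst (asm) cs.scale_cancel_left) auto
  have BK: "B * K = K * B"
  proof -
    have "xp (-1) * (xm 0 * K) = (u * p) *c (K * (xp (-1) * xm 0))"
      unfolding Kx mult_cs_right by (simp only: mult.assoc[symmetric] Kx mult_cs_left cs_cs)
    moreover have "xm 0 * (xp (-1) * K) = (p * u) *c (K * (xm 0 * xp (-1)))"
      unfolding Kx mult_cs_right by (simp only: mult.assoc[symmetric] Kx mult_cs_left cs_cs)
    ultimately show ?thesis unfolding B_def by (simp add: scal cs_one algebra_simps)
  qed
  have "a' (-1) * a' 0 - p *c (a' 0 * a' (-1)) =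
     (c1 / C) *c \<Gamma> 1 + ((c1 * u) * p) *c (K' * A) - (c1 / C) *c (K * B)
     - ((c1 * u) * (1 - p * p)) *c (a (-1) * xp 0) - ((c1 / C) * (u - p)) *c (a 0 * xp (-1))
     + ((c1 * u) * (c1 / C) * (u - p)) *c (xp (-1) * xp 0)"
    unfolding a'_0 a'_m1 u_def[symmetric]
    by (rule onsager1_aux[OF KK on _ _ Kx(1,2) Kx(1,2) Kx(3,4) Kx(3,4) xx yy AB])
      (use a_comm(4)[of 1] a_comm(10)[of 1] f1 in \<open>auto simp: a_comm e_l e_a mult.assoc scal\<close>)
  then have "\<Gamma>' 1 = (C / c1) *c ((c1 / C) *c \<Gamma> 1 + ((c1 * u) * p) *c (K' * A) - (c1 / C) *c (K * B)
     - ((c1 * u) * (1 - p * p)) *c (a (-1) * xp 0) - ((c1 / C) * (u - p)) *c (a 0 * xp (-1))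
     + ((c1 * u) * (c1 / C) * (u - p)) *c (xp (-1) * xp 0))" using 1 by simp
  moreover have "C / c1 * (c1 / C) = 1" "C / c1 * ((c1 * u) * p) = C" "C / c1 * ((c1 * u) * (1 - p * p)) = (u - p) * C"
    "C / c1 * ((c1 / C) * (u - p)) = u - p" "C / c1 * ((c1 * u) * (c1 / C) * (u - p)) = c1 * u * (u - p)"
    using scal(1) C0 c1 by (simp_all add: field_simps)
  ultimately show ?thesis unfolding h BK
    by (simp only: cs.scale_right_distrib cs.scale_right_diff_distrib cs_cs) (simp add: cs_one algebra_simps)
qed


text \<open>Up to scalars, \<open>V\<close> and \<open>W\<close> are the parts of degree 1 and 2 of
  \<open>\<Gamma>' 1\<close>.\<close>

definition V where "V = C *c (a (-1) * xp 0) + a 0 * xp (-1)"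
definition W where "W = xp (-1) * xp 0"
definition M where "M z = (1 / b2) *c (\<Gamma>' 1 * z - z * \<Gamma>' 1)"

lemma M_eq: "M z = L z - \<kappa> *c (V * z - z * V) + (c1 * u * \<kappa>) *c (W * z - z * W)"
proof -
  have 1: "(1 / b2) * (u - p) = \<kappa>" using scal(6) unfolding scal(8)[symmetric] by simp
  have "\<Gamma>' 1 = (\<Gamma> 1 + h) - (u - p) *c V + (c1 * u * (u - p)) *c W"
    unfolding V_def W_def by (rule \<Gamma>'_1)
  then have "\<Gamma>' 1 * z - z * \<Gamma>' 1 = ((\<Gamma> 1 + h) * z - z * (\<Gamma> 1 + h)) - (u - p) *c (V * z - z * V)
     + (c1 * u * (u - p)) *c (W * z - z * W)"
    by (simp only:) (simp add: algebra_simps cs_simps)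
  then have "M z = (1 / b2) *c ((\<Gamma> 1 + h) * z - z * (\<Gamma> 1 + h)) - (1 / b2 * (u - p)) *c (V * z - z * V)
     + (c1 * u * (1 / b2 * (u - p))) *c (W * z - z * W)"
    unfolding M_def by (simp only: cs.scale_right_distrib cs.scale_right_diff_distrib cs_cs mult_ac)
  then show ?thesis unfolding 1 L_def .
qed

section \<open>The primed family modulo degree two\<close>

lemma a'_rec: "a' (r + 1) = C *c a' (r - 1) + M (a' r)"
  using \<Gamma>'_a[of r] scal unfolding M_def by (simp add: cs_simps b2_def)

text \<open>The three summands are the parts of degree -1, 0, 1. Because of the shift in
  \<open>f\<close>, \<open>approx n\<close> belongs to \<open>a'\<close> at index n-1. At n = 0 it
  gives x^-_1 alone and misses the other terms of \<open>a' (-1)\<close>, which explains the case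
  distinction in \<open>approx_rec\<close>.\<close>

definition approx where "approx n = xm (1 - int n) + conv a 0 n + P 0 n"

lemma approx_1: "approx 1 = a' 0"
  using G1[of 0] f1 by (simp add: approx_def a'_0 u_def)

text \<open>For n = 1 the indices in the first bracket add up to zero; there phi^+_0 contributes
  \<open>K\<close>.\<close>

lemma brk:
  assumes "n \<ge> 1"
  shows "\<kappa> *c (xp 0 * xm (1 - int n) - xm (1 - int n) * xp 0) = (if n = 1 then K else 0) - f n"
   "\<kappa> *c (xp (-1) * xm (1 - int n) - xm (1 - int n) * xp (-1)) = - f (Suc n)"
proof -
  show "\<kappa> *c (xp 0 * xm (1 - int n) - xm (1 - int n) * xp 0) = (if n = 1 then K else 0) - f n"
  proof (cases "n = 1")
    case True then show ?thesis using xp_xm_0[of 0 0] f1 by (simp add: \<kappa>_def)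
  next
    case False
    then have "Suc (nat (int n - 1)) = n" using assms by simp
    then show ?thesis using False assms xp_xm_neg[of 0 "1 - int n"] by (simp add: \<kappa>_def)
  qed
  have "\<kappa> *c (xp (-1) * xm (1 - int n) - xm (1 - int n) * xp (-1)) = - f (Suc (nat (int n)))"
    using xp_xm_neg[of "-1" "1 - int n"] assms by (simp add: \<kappa>_def)
  then show "\<kappa> *c (xp (-1) * xm (1 - int n) - xm (1 - int n) * xp (-1)) = - f (Suc n)" by simp
qed

text \<open>This is \<open>a'_rec\<close> without the contributions of degree two or more:
  \<open>V\<close> acts on degrees -1 and 0 only, \<open>W\<close> on degree -1 only. Degree 0
  reduces to \<open>conv_rec\<close>, degree 1 to \<open>P_rec\<close>.\<close>

lemma approx_rec:
  assumes "n \<ge> 1"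
  shows "approx (Suc n) = C *c (if n = 1 then a' (-1) else approx (n - 1)) +
     (L (approx n) - \<kappa> *c (V * (xm (1 - int n) + conv a 0 n) - (xm (1 - int n) + conv a 0 n) * V)
      + (c1 * u * \<kappa>) *c (W * xm (1 - int n) - xm (1 - int n) * W))"
proof -
  define X where "X = xm (1 - int n)"
  have Xc: "X * a r = a r * X" "X * (a r * z) = a r * (X * z)" for r z unfolding X_def by (simp_all add: a_comm a_comm')
  have b: "\<kappa> *c (xp 0 * X) = (if n = 1 then K else 0) - f n + \<kappa> *c (X * xp 0)"
     "\<kappa> *c (xp (-1) * X) = - f (Suc n) + \<kappa> *c (X * xp (-1))"
    using brk[OF assms] by (simp_all add: X_def algebra_simps cs_simps)
  have V: "\<kappa> *c (V * X - X * V) = C *c (a (-1) * ((if n = 1 then K else 0) - f n)) - a 0 * f (Suc n)"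
  proof -
    have "\<kappa> *c (V * X - X * V) = C *c (a (-1) * (\<kappa> *c (xp 0 * X) - \<kappa> *c (X * xp 0)))
       + a 0 * (\<kappa> *c (xp (-1) * X) - \<kappa> *c (X * xp (-1)))"
      unfolding V_def by (simp add: algebra_simps cs_simps Xc)
    then show ?thesis unfolding b by (simp add: algebra_simps cs_simps)
  qed
  have W: "\<kappa> *c (W * X - X * W) = xp (-1) * ((if n = 1 then K else 0) - f n) - f (Suc n) * xp 0"
  proof -
    have "\<kappa> *c (W * X - X * W) = xp (-1) * (\<kappa> *c (xp 0 * X) - \<kappa> *c (X * xp 0))
       + (\<kappa> *c (xp (-1) * X) - \<kappa> *c (X * xp (-1))) * xp 0"
      unfolding W_def by (simp add: algebra_simps cs_simps)
    then show ?thesis unfolding b by (simp add: algebra_simps cs_simps)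
  qed
  have LX: "L X = xm (- int n) - C *c xm (2 - int n)" unfolding X_def L_xm by simp
  have c: "conv a 0 (Suc n) = C *c conv a 0 (n - 1) + L (conv a 0 n) + a 0 * f (Suc n) + C *c (a (-1) * f n)"
    using conv_rec[of 0 n] by simp
  have d: "P 0 (Suc n) = C *c P 0 (n - 1) + L (P 0 n) + S 0 n"
    using P_rec[of 0 n] by (simp add: algebra_simps)
  have S: "S 0 n = - (\<kappa> *c (V * conv a 0 n - conv a 0 n * V)) - (c1 * u) *c (xp (-1) * f n + f (Suc n) * xp 0)"
    unfolding S_def V_def by simp
  \<comment> \<open>For n = 1 the terms of \<open>a' (-1)\<close> that contain \<open>K\<close>
    cancel the summand \<open>K\<close> in \<open>brk\<close>.\<close>
  have pr: "C *c (if n = 1 then a' (-1) else approx (n - 1)) = C *c xm (2 - int n) + C *c conv a 0 (n - 1) + C *c P 0 (n - 1)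
      + C *c (a (-1) * (if n = 1 then K else 0)) - (c1 * u) *c (xp (-1) * (if n = 1 then K else 0))"
  proof (cases "n = 1")
    case True
    have "xp (-1) * K = p *c (K * xp (-1))" by (rule Kx)
    then show ?thesis using True C0 scal by (simp add: a'_m1 cs_simps mult.assoc)
  next
    case False
    then have "2 - int n = 1 - int (n - 1)" using assms by simp
    then show ?thesis using False by (simp add: approx_def cs_simps)
  qed
  have W': "(c1 * u * \<kappa>) *c (W * X - X * W) = (c1 * u) *c (\<kappa> *c (W * X - X * W))" by (simp add: cs_cs)
  have 1: "\<kappa> *c (V * (X + conv a 0 n) - (X + conv a 0 n) * V) = \<kappa> *c (V * X - X * V) + \<kappa> *c (V * conv a 0 n - conv a 0 n * V)"
    by (simp add: algebra_simps cs_simps)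
  have 2: "L (approx n) = L X + L (conv a 0 n) + L (P 0 n)" unfolding approx_def X_def by (simp add: L_add)
  have 3: "approx (Suc n) = xm (- int n) + conv a 0 (Suc n) + P 0 (Suc n)" by (simp add: approx_def)
  show ?thesis unfolding X_def[symmetric] 3 pr 1 2 W' V W c d S LX
    by (simp add: algebra_simps cs_simps)
qed

text \<open>\<open>M\<close> differs from \<open>L\<close> by commutators with elements of degree 1
  and 2, see \<open>M_eq\<close>.\<close>

lemma M_F: "z \<in> F d \<Longrightarrow> M z \<in> F d"
  and M_Fh: "x \<in> F 1 \<Longrightarrow> M x - L x \<in> F 2" and M_F0: "x \<in> F 0 \<Longrightarrow> M x - (L x - \<kappa> *c (V * x - x * V)) \<in> F 2"
proof -
  have V: "V \<in> F 1" unfolding V_def by (intro F_add F_cs F_mult0 a_F F_gen)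
  have W: "W \<in> F 2" unfolding W_def using F_mult[OF F_gen(1) F_gen(1)] by simp
  have L: "L z \<in> F d" if "z \<in> F d" for z d unfolding L_def
    by (intro F_cs F_diff F_mult0 F_mult0' F_add a_F F_gen that)
  have VF: "\<kappa> *c (V * z - z * V) \<in> F (d + 1)" and WF: "(c1 * u * \<kappa>) *c (W * z - z * W) \<in> F (d + 2)" if "z \<in> F d" for z d
    using F_mult[OF V that] F_mult[OF that V] F_mult[OF W that] F_mult[OF that W]
    by (auto intro!: F_cs F_diff simp: add.commute)
  show "z \<in> F d \<Longrightarrow> M z \<in> F d"
    unfolding M_eq by (intro F_add F_diff L) (auto intro: F_le[OF VF] F_le[OF WF])
  show "M x - L x \<in> F 2" if "x \<in> F 1"
  proof -
    have "M x - L x = (c1 * u * \<kappa>) *c (W * x - x * W) - \<kappa> *c (V * x - x * V)" unfolding M_eq by simp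
    then show ?thesis using VF[OF that] F_le[OF WF[OF that]] by (auto intro!: F_diff)
  qed
  show "M x - (L x - \<kappa> *c (V * x - x * V)) \<in> F 2" if "x \<in> F 0"
    unfolding M_eq using WF[OF that] by simp
qed

text \<open>The recursion has order two, hence strong induction. Everything that
  \<open>approx_rec\<close> leaves out is absorbed by \<open>M_F\<close>.\<close>

lemma a'_approx: "n \<ge> 1 \<Longrightarrow> a' (int n - 1) - approx n \<in> F 2"
proof (induction n rule: less_induct)
  case (less n)
  show ?case
  proof (cases "n = 1")
    case True then show ?thesis by (simp add: approx_1[unfolded One_nat_def] F_zero)
  next
    case False
    then obtain m where m: "n = Suc m" "m \<ge> 1" using less.prems by (cases n) auto
    have IH: "a' (int m - 1) - approx m \<in> F 2" using less.IH[of m] m by simp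
    define R where "R = (if m = 1 then a' (-1) else approx (m - 1))"
    have R: "a' (int m - 1 - 1) - R \<in> F 2"
    proof (cases "m = 1")
      case True then show ?thesis by (simp add: R_def F_zero)
    next
      case False
      then have "int m - 1 - 1 = int (m - 1) - 1" using m by simp
      then show ?thesis using less.IH[of "m - 1"] m False by (simp add: R_def)
    qed
    define X where "X = xm (1 - int m)"
    define D where "D = conv a 0 m"
    have D: "D \<in> F 0" unfolding D_def by (intro conv_F a_F)
    have approx: "approx m = X + D + P 0 m" by (simp add: approx_def X_def D_def)
    have rec: "approx (Suc m) = C *c R + (L (approx m) - \<kappa> *c (V * (X + D) - (X + D) * V) + (c1 * u * \<kappa>) *c (W * X - X * W))"
      using approx_rec[OF m(2)] by (simp add: R_def X_def D_def)
    have Madd: "M (x + y) = M x + M y" "M (x - y) = M x - M y" for x y by (simp_all add: M_def algebra_simps cs_simps)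
    have LAp: "L (approx m) = L X + L D + L (P 0 m)" unfolding approx by (simp add: L_add)
    have "a' (int n - 1) - approx n = C *c (a' (int m - 1 - 1) - R) + M (a' (int m - 1) - approx m)
       + (M D - (L D - \<kappa> *c (V * D - D * V))) + (M (P 0 m) - L (P 0 m))"
    proof -
      have "a' (int n - 1) = C *c a' (int m - 1 - 1) + M (a' (int m - 1))"
        using a'_rec[of "int m - 1"] m by simp
      moreover have "M (approx m) = M X + M D + M (P 0 m)" unfolding approx Madd ..
      moreover have "M X = L X - \<kappa> *c (V * X - X * V) + (c1 * u * \<kappa>) *c (W * X - X * W)" by (rule M_eq)
      moreover have "\<kappa> *c (V * (X + D) - (X + D) * V) = \<kappa> *c (V * X - X * V) + \<kappa> *c (V * D - D * V)"
        by (simp add: algebra_simps cs_simps)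
      ultimately show ?thesis unfolding m(1) rec LAp Madd by (simp add: cs.scale_right_diff_distrib)
    qed
    then show ?thesis by (simp only:) (intro F_add F_cs R M_F IH M_F0 D M_Fh P_F)
  qed
qed

end

section \<open>q-commutators with x^-_0 and x^-_1\<close>

context coideal_sys begin

definition qcomm where "qcomm x y = x * y - p *c (y * x)"
definition t0 where "t0 = 1 / \<kappa>"

lemma \<kappa>_cancel: "\<kappa> *c x = y \<Longrightarrow> x = t0 *c y"
  using scal by (auto simp: t0_def cs_cs cs_one)

lemma qcomm_add: "qcomm (x + y) z = qcomm x z + qcomm y z" "qcomm x (y + z) = qcomm x y + qcomm x z"
  and qcomm_diff: "qcomm (x - y) z = qcomm x z - qcomm y z" "qcomm x (y - z) = qcomm x y - qcomm x z"
  and qcomm_cs: "qcomm (k *c x) y = k *c qcomm x y" "qcomm x (k *c y) = k *c qcomm x y"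
  and qcomm_0: "qcomm 0 x = 0" "qcomm x 0 = 0"
  by (simp_all add: qcomm_def algebra_simps cs_simps)

lemma qcomm_mult:
  "y * b = b * y \<Longrightarrow> qcomm y (b * z) = b * qcomm y z" "y * b = b * y \<Longrightarrow> qcomm (b * z) y = b * qcomm z y"
  "y * b = b * y \<Longrightarrow> qcomm y (z * b) = qcomm y z * b" "y * b = b * y \<Longrightarrow> qcomm (z * b) y = qcomm z y * b"
proof -
  have *: "y * (b * z) = b * (y * z)" if "y * b = b * y" using that by (rule comm2)
  show "y * b = b * y \<Longrightarrow> qcomm y (b * z) = b * qcomm y z" "y * b = b * y \<Longrightarrow> qcomm (b * z) y = b * qcomm z y"
    using * by (simp_all add: qcomm_def algebra_simps cs_simps)
  show "y * b = b * y \<Longrightarrow> qcomm y (z * b) = qcomm y z * b" "y * b = b * y \<Longrightarrow> qcomm (z * b) y = qcomm z y * b"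
    by (simp_all add: qcomm_def algebra_simps cs_simps)
qed

text \<open>A twisted Leibniz rule: if the pair \<open>(Z1, Z0)\<close> is annihilated,
  multiplication by \<open>x\<close> leaves only brackets of \<open>x\<close> with
  \<open>y0\<close>, \<open>y1\<close>. It serves for the pairs of \<open>qcomm_f\<close> and of
  \<open>qcomm_cv\<close>; with x = x^+_k the brackets become phi^+.\<close>

lemma qcomm_pair:
  assumes "qcomm y1 Z1 + qcomm Z0 y0 = 0"
  shows "qcomm y1 (x * Z1) + qcomm (x * Z0) y0 = - ((x * y1 - y1 * x) * Z1) + p *c ((x * y0 - y0 * x) * Z0)"
    "qcomm y1 (Z1 * x) + qcomm (Z0 * x) y0 = - (p *c (Z1 * (x * y1 - y1 * x))) + Z0 * (x * y0 - y0 * x)"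
proof -
  have "qcomm y1 (x * Z1) + qcomm (x * Z0) y0 = - ((x * y1 - y1 * x) * Z1) + p *c ((x * y0 - y0 * x) * Z0)
    + x * (qcomm y1 Z1 + qcomm Z0 y0)"
    by (simp add: qcomm_def algebra_simps cs_simps)
  then show "qcomm y1 (x * Z1) + qcomm (x * Z0) y0 = - ((x * y1 - y1 * x) * Z1) + p *c ((x * y0 - y0 * x) * Z0)"
    unfolding assms by simp
  have "qcomm y1 (Z1 * x) + qcomm (Z0 * x) y0 = - (p *c (Z1 * (x * y1 - y1 * x))) + Z0 * (x * y0 - y0 * x)
    + (qcomm y1 Z1 + qcomm Z0 y0) * x"
    by (simp add: qcomm_def algebra_simps cs_simps)
  then show "qcomm y1 (Z1 * x) + qcomm (Z0 * x) y0 = - (p *c (Z1 * (x * y1 - y1 * x))) + Z0 * (x * y0 - y0 * x)"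
    unfolding assms by simp
qed

lemma qcomm_f: "qcomm (xm 1) (f (Suc m)) + qcomm (f m) (xm 0) = 0"
proof -
  have "f (Suc m) * xm 1 - u *c (f m * xm 0) = u *c (xm 1 * f (Suc m)) - xm 0 * f m"
    using f_xm[of m 0] by (simp add: u_def)
  from arg_cong[OF this, of "\<lambda>z. p *c z"] show ?thesis
    by (simp add: qcomm_def cs_simps scal algebra_simps)
qed

text \<open>x^- commutes with \<open>a\<close>, so the sum inherits the vanishing termwise from
  \<open>qcomm_f\<close>.\<close>

lemma qcomm_cv: "qcomm (xm 1) (conv a i m) + qcomm (conv a i (m - 1)) (xm 0) = 0"
proof (induction m arbitrary: i)
  case 0
  then show ?case by (simp add: qcomm_0)
next
  case (Suc m)
  have 1: "conv a i m = a i * f m + conv a (i + 1) (m - 1)"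
    by (cases m) (simp_all add: f0)
  have "qcomm (xm 1) (a i * f (Suc m)) + qcomm (a i * f m) (xm 0) = a i * (qcomm (xm 1) (f (Suc m)) + qcomm (f m) (xm 0))"
    by (simp add: qcomm_mult a_comm distrib_left)
  then have "qcomm (xm 1) (a i * f (Suc m)) + qcomm (a i * f m) (xm 0) = 0" by (simp only: qcomm_f mult_zero_right)
  then show ?case using Suc.IH[of "i+1"] 1 by (simp add: qcomm_add algebra_simps)
qed

lemma K'_comm: "K' * a r = a r * K'" "K' * \<Gamma> r = \<Gamma> r * K'"
  using a_comm(4)[of 1] a_comm(10)[of 1] f1 by simp_all

text \<open>\<open>\<kappa>\<close> times the bracket of x^+_k with x^-_0 for k \<ge> 0, see
  \<open>ps_brk\<close>; for k = 0 both phi^+_0 and phi^-_0 contribute.\<close>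

definition ps where "ps k = (if k = 0 then K - K' else g k)"

lemma ps_comm: "ps k * a r = a r * ps k" "ps k * \<Gamma> r = \<Gamma> r * ps k" "ps k * f n = f n * ps k"
  using gf[of n 0] gf[of n k] ff[of n 1] by (auto simp: ps_def algebra_simps a_comm K'_comm g0 f1[unfolded One_nat_def])

lemma conv_comm:
  assumes "\<And>r. x * b r = b r * x" "\<And>n. x * f n = f n * x"
  shows "x * conv b i n = conv b i n * x"
proof (induction n arbitrary: i)
  case (Suc n)
  have "x * (b i * f (Suc n)) = b i * f (Suc n) * x"
    using comm2[OF assms(1)[of i], of "f (Suc n)"] assms(2)[of "Suc n"] by (simp add: mult.assoc)
  then show ?case using Suc by (simp add: algebra_simps)
qed simp

lemma ps_brk: "\<kappa> *c (xp (int k) * xm 1 - xm 1 * xp (int k)) = g (Suc k)"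
   "\<kappa> *c (xp (int k) * xm 0 - xm 0 * xp (int k)) = ps k"
  using xp_xm_pos[of "int k" 1] xp_xm_pos[of "int k" 0] xp_xm_0[of 0 0]
  by (auto simp: \<kappa>_def ps_def nat_add_distrib)


definition e_term where "e_term k m = qcomm (a (int k)) (conv a (int k + 1) m) * g (Suc k)
   + qcomm (conv a (int k) m) (a (int k)) * ps k
   + (c1 * C ^ k * t0) *c (f (Suc m) * g (Suc k) - f m * ps k)"

text \<open>Each summand of \<open>G\<close> is x^+_k multiplied on one side by a convolution or by
  \<open>f\<close>, up to factors \<open>a\<close>. By \<open>qcomm_pair\<close> the generator x^+_k
  disappears into the brackets \<open>g (Suc k)\<close> and \<open>ps k\<close>.\<close>

lemma G_tc: "qcomm (xm 1) (G (int k) (Suc m)) + qcomm (G (int k) m) (xm 0) = e_term k m"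
proof -
  define i where "i = int k"
  define x where "x = xp i"
  define A where "A = a i"
  define y0 where "y0 = xm 0"
  define y1 where "y1 = xm 1"
  define Z where "Z = conv a (i + 1) m"
  define Z' where "Z' = conv a (i + 1) (m - 1)"
  define g1 where "g1 = g (Suc k)"
  define g0' where "g0' = ps k"
  define \<gamma> where "\<gamma> = u * c1 * C ^ k"
  have Ay: "y1 * A = A * y1" "y0 * A = A * y0" by (simp_all add: A_def y0_def y1_def a_comm)
  have b: "\<kappa> *c (x * y1 - y1 * x) = g1" "\<kappa> *c (x * y0 - y0 * x) = g0'"
    using ps_brk[of k] by (simp_all add: x_def y1_def y0_def g1_def g0'_def i_def)
  have b': "x * y1 - y1 * x = t0 *c g1" "x * y0 - y0 * x = t0 *c g0'"
    using b[symmetric] scal by (simp_all add: cs_cs cs_one t0_def)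
  have gc: "g1 * A = A * g1" "g0' * A = A * g0'" "g1 * f (Suc m) = f (Suc m) * g1" "g0' * f m = f m * g0'"
    by (simp_all add: g1_def g0'_def A_def a_comm ps_comm gf)
  have gZ: "g1 * Z = Z * g1" "g0' * Z' = Z' * g0'"
    unfolding g1_def g0'_def Z_def Z'_def by (rule conv_comm; simp add: a_comm ps_comm gf)+
  have Zr: "qcomm y1 Z + qcomm Z' y0 = 0" unfolding Z_def Z'_def y0_def y1_def by (rule qcomm_cv)
  have fr: "qcomm y1 (f (Suc m)) + qcomm (f m) y0 = 0" unfolding y0_def y1_def by (rule qcomm_f)
  have GG: "G i (Suc m) = - (\<kappa> *c (A * (x * Z) - (Z * x) * A)) + \<kappa> *c (A * (A * (f (Suc m) * x))) - \<kappa> *c (A * (A * s (Suc m) i)) - \<gamma> *c s (Suc m) i"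
    "G i m = - (\<kappa> *c (A * (x * Z') - (Z' * x) * A)) + \<kappa> *c (A * (A * (f m * x))) - \<kappa> *c (A * (A * s m i)) - \<gamma> *c s m i"
    unfolding G_def A_def x_def Z_def Z'_def \<gamma>_def by (simp_all add: i_def mult.assoc a_comm)
  have tcA: "qcomm y1 (A * z) = A * qcomm y1 z" "qcomm (A * z) y0 = A * qcomm z y0" "qcomm y1 (z * A) = qcomm y1 z * A" "qcomm (z * A) y0 = qcomm z y0 * A" for z
    by (rule qcomm_mult; rule Ay)+
  define s1 where "s1 = qcomm y1 (s (Suc m) i)"
  define s0 where "s0 = qcomm (s m i) y0"
  \<comment> \<open>The normalisation of \<open>s\<close> enters here through (1 + p)/(u + 1) =
    p.\<close>
  have ss: "s1 + s0 = (p * t0) *c (f m * g0' - f (Suc m) * g1)"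
  proof -
    have w: "1 / (u + 1) * (1 + p) = p" using scal by (simp add: field_simps)
    have "s1 + s0 = (1 / (u + 1)) *c ((qcomm y1 (x * f (Suc m)) + qcomm (x * f m) y0) + (qcomm y1 (f (Suc m) * x) + qcomm (f m * x) y0))"
      unfolding s1_def s0_def s_def x_def by (simp add: qcomm_cs qcomm_add cs_simps algebra_simps)
    also have "\<dots> = (1 / (u + 1)) *c (t0 *c ((1 + p) *c (f m * g0' - f (Suc m) * g1)))"
      unfolding qcomm_pair[OF fr] b' by (simp add: cs_simps gc cs_add_left algebra_simps)
    also have "\<dots> = ((1 / (u + 1) * (1 + p)) * t0) *c (f m * g0' - f (Suc m) * g1)"
      by (simp add: cs_cs mult_ac)
    finally show ?thesis unfolding w .
  qed
  have "qcomm y1 (G i (Suc m)) + qcomm (G i m) y0 = - (\<kappa> *c (A * (qcomm y1 (x * Z) + qcomm (x * Z') y0) - (qcomm y1 (Z * x) + qcomm (Z' * x) y0) * A))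
     + \<kappa> *c (A * (A * (qcomm y1 (f (Suc m) * x) + qcomm (f m * x) y0))) - \<kappa> *c (A * (A * (s1 + s0))) - \<gamma> *c (s1 + s0)"
    unfolding GG s1_def s0_def by (simp add: qcomm_add qcomm_diff qcomm_cs tcA qcomm_mult algebra_simps cs_simps)
       (simp add: qcomm_def algebra_simps cs_simps Ay)
  also have "\<dots> = (\<kappa> * t0) *c (A * (g1 * Z - p *c (g0' * Z')) + (Z' * g0' - p *c (Z * g1)) * A)
      + (\<kappa> * t0) *c (A * (A * (f m * g0' - p *c (f (Suc m) * g1))))
      - (\<kappa> * t0) *c (A * (A * (p *c (f m * g0' - f (Suc m) * g1)))) - (\<gamma> * p * t0) *c (f m * g0' - f (Suc m) * g1)"
    unfolding ss qcomm_pair[OF fr] qcomm_pair[OF Zr] b' by (simp add: algebra_simps cs_simps)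
  also have "\<kappa> * t0 = 1" using scal by (simp add: t0_def)
  also have "\<gamma> * p * t0 = c1 * C ^ k * t0" using scal by (simp add: \<gamma>_def)
  finally have 1: "qcomm y1 (G i (Suc m)) + qcomm (G i m) y0 = (A * (g1 * Z - p *c (g0' * Z')) + (Z' * g0' - p *c (Z * g1)) * A)
      + (A * (A * (f m * g0' - p *c (f (Suc m) * g1))))
      - (A * (A * (p *c (f m * g0' - f (Suc m) * g1)))) - (c1 * C ^ k * t0) *c (f m * g0' - f (Suc m) * g1)"
    by (simp add: cs_one)
  \<comment> \<open>The terms quadratic in \<open>A\<close> that survive supply the first summand of
    this convolution.\<close>
  have cvA: "conv a i m = A * f m + Z'"
    by (cases m) (simp_all add: f0 A_def Z'_def)
  have gA2: "f m * A = A * f m" by (simp add: A_def a_comm)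
  have "e_term k m = qcomm A Z * g1 + qcomm (A * f m + Z') A * g0' + (c1 * C ^ k * t0) *c (f (Suc m) * g1 - f m * g0')"
    unfolding e_term_def i_def[symmetric] cvA by (simp add: A_def Z_def g1_def g0'_def)
  also have "\<dots> = qcomm y1 (G i (Suc m)) + qcomm (G i m) y0"
    unfolding 1 by (simp add: qcomm_def algebra_simps cs_simps gc gZ gA2 comm2[OF gA2])
  finally show ?thesis unfolding i_def y0_def y1_def by simp
qed

section \<open>The q-Onsager relations of the unprimed family\<close>

lemma qcomm_onsager: "qcomm (a i) (a l) + qcomm (a (l - 1)) (a (i + 1)) = (c1 * C powi i) *c \<Gamma> (l - i) + (c1 * C powi (l - 1)) *c \<Gamma> (i - l + 2)"
  using onsager[of i "l - 1"] by (simp add: qcomm_def p_def algebra_simps)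

lemma e_f: "\<Gamma> 0 * f n = t0 *c f n"
proof -
  have "\<Gamma> 0 = t0 *c (\<kappa> *c \<Gamma> 0)" using scal by (simp add: t0_def cs_cs cs_one)
  also have "\<kappa> *c \<Gamma> 0 = e" using \<Gamma>0 by (simp add: \<kappa>_def)
  finally show ?thesis by (simp add: cs_simps e_l)
qed

lemma qcomm_af: "qcomm (a i) (a l * f n) = qcomm (a i) (a l) * f n" "qcomm (a l * f n) (a i) = qcomm (a l) (a i) * f n"
  by (rule qcomm_mult; simp add: a_comm)+

text \<open>Termwise \<open>qcomm_onsager\<close>. The second Gamma has index i - l + 2 \<le> 0, so
  it survives only in the first term and only for l = i + 2.\<close>

lemma qcomm_cv_far: "l \<ge> i + 2 \<Longrightarrow> qcomm (a i) (conv a l m) + qcomm (conv a (l - 1) m) (a (i + 1)) =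
   (c1 * C powi i) *c conv \<Gamma> (l - i) m + (if l = i + 2 then (c1 * C powi (i + 1) * t0) *c f m else 0)"
proof (induction m arbitrary: l)
  case 0
  then show ?case by (simp add: qcomm_0 f0)
next
  case (Suc m)
  have IH: "qcomm (a i) (conv a (l + 1) m) + qcomm (conv a l m) (a (i + 1)) = (c1 * C powi i) *c conv \<Gamma> (l + 1 - i) m"
    using Suc.IH[of "l+1"] Suc.prems by simp
  have "qcomm (a i) (conv a l (Suc m)) + qcomm (conv a (l - 1) (Suc m)) (a (i + 1)) =
    (qcomm (a i) (a l) + qcomm (a (l - 1)) (a (i + 1))) * f (Suc m) + (qcomm (a i) (conv a (l + 1) m) + qcomm (conv a l m) (a (i + 1)))"
    by (simp add: qcomm_add qcomm_af algebra_simps)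
  also have "\<dots> = (c1 * C powi i) *c conv \<Gamma> (l - i) (Suc m) + (c1 * C powi (l - 1)) *c (\<Gamma> (i - l + 2) * f (Suc m))"
    unfolding IH qcomm_onsager by (simp add: algebra_simps cs_simps)
  also have "(c1 * C powi (l - 1)) *c (\<Gamma> (i - l + 2) * f (Suc m)) = (if l = i + 2 then (c1 * C powi (i + 1) * t0) *c f (Suc m) else 0)"
    using Suc.prems by (auto simp: e_f cs_cs \<Gamma>neg add.commute)
  finally show ?case .
qed

text \<open>The first pair is now diagonal and yields \<open>\<Gamma> 1\<close> once; the rest is
  \<open>qcomm_cv_far\<close> from i + 2 on. Subtracting \<open>t0 *c f (Suc m)\<close> removes the
  term of \<open>\<Gamma> 0\<close>, so that the convolution can be written with start 0, as in
  \<open>\<Omega>\<close>.\<close>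

lemma qcomm_cv_near: "qcomm (a i) (conv a (i + 1) m) + qcomm (conv a (i + 1) (m - 1)) (a (i + 1)) =
   (c1 * C powi i) *c (conv \<Gamma> 0 (Suc m) - t0 *c f (Suc m)) + (c1 * C powi (i + 1) * t0) *c f (m - 1)"
proof (cases m)
  case 0
  then show ?thesis by (simp add: qcomm_0 f0 e_f[unfolded One_nat_def])
next
  case (Suc k)
  have 1: "qcomm (a i) (a (i + 1)) = (c1 * C powi i) *c \<Gamma> 1"
    by (rule cs_double) (use qcomm_onsager[of i "i + 1"] in simp)
  have "qcomm (a i) (conv a (i + 1) m) + qcomm (conv a (i + 1) (m - 1)) (a (i + 1)) =
    qcomm (a i) (a (i + 1)) * f m + (qcomm (a i) (conv a (i + 2) k) + qcomm (conv a (i + 1) k) (a (i + 1)))"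
    unfolding Suc by (simp add: qcomm_add qcomm_af algebra_simps)
  also have "qcomm (a i) (conv a (i + 2) k) + qcomm (conv a (i + 1) k) (a (i + 1)) = (c1 * C powi i) *c conv \<Gamma> 2 k + (c1 * C powi (i + 1) * t0) *c f k"
    using qcomm_cv_far[of i "i + 2" k] by (simp add: add.commute)
  finally show ?thesis unfolding 1 Suc by (simp add: algebra_simps cs_simps e_f)
qed

text \<open>The recursion follows that of \<open>P\<close>; the explicit sum is
  \<open>T_sum\<close>.\<close>

fun T where
  "T k 0 = 0"
| "T k (Suc m) = (c1 * C ^ k) *c (conv \<Gamma> 0 (Suc m) * g (Suc k)) + T (Suc k) m"

text \<open>The q-commutator left over by the shift k + 1 and the first one in
  \<open>e_term k\<close> both carry the factor \<open>g (Suc k)\<close>. Together they are the left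
  side of \<open>qcomm_cv_near\<close>, and what remains is a summand of \<open>T\<close>.\<close>

lemma P_tc: "qcomm (xm 1) (P (int k) (Suc m)) + qcomm (P (int k) m) (xm 0) =
  (qcomm (conv a (int k) m) (a (int k)) - (c1 * C ^ k * t0) *c f m) * ps k + T k (Suc m)"
proof (induction m arbitrary: k)
  case 0
  have "qcomm (xm 1) (P (int k) (Suc 0)) + qcomm (P (int k) 0) (xm 0) = e_term k 0"
    unfolding G_tc[symmetric] by (simp add: G0 qcomm_0)
  then show ?case by (simp add: e_term_def qcomm_0 f0 e_f[unfolded One_nat_def] cs_simps)
next
  case (Suc m)
  have "qcomm (xm 1) (P (int k) (Suc (Suc m))) + qcomm (P (int k) (Suc m)) (xm 0) =
     e_term k (Suc m) + (qcomm (xm 1) (P (int (Suc k)) (Suc m)) + qcomm (P (int (Suc k)) m) (xm 0))"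
    unfolding G_tc[symmetric] by (simp add: qcomm_add algebra_simps)
  also have "\<dots> = e_term k (Suc m) + ((qcomm (conv a (int k + 1) m) (a (int k + 1)) - (c1 * C ^ Suc k * t0) *c f m) * g (Suc k) + T (Suc k) (Suc m))"
    using Suc.IH[of "Suc k"] by (simp add: ps_def algebra_simps)
  also have "\<dots> = (qcomm (a (int k)) (conv a (int k + 1) (Suc m)) + qcomm (conv a (int k + 1) m) (a (int k + 1))
        + (c1 * C ^ k * t0) *c f (Suc (Suc m)) - (c1 * C ^ Suc k * t0) *c f m) * g (Suc k)
     + (qcomm (conv a (int k) (Suc m)) (a (int k)) - (c1 * C ^ k * t0) *c f (Suc m)) * ps k + T (Suc k) (Suc m)"
    unfolding e_term_def by (simp add: algebra_simps cs_simps)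
  also have "qcomm (a (int k)) (conv a (int k + 1) (Suc m)) + qcomm (conv a (int k + 1) m) (a (int k + 1)) =
     (c1 * C ^ k) *c (conv \<Gamma> 0 (Suc (Suc m)) - t0 *c f (Suc (Suc m))) + (c1 * C ^ Suc k * t0) *c f m"
    using qcomm_cv_near[of "int k" "Suc m"] by (simp add: power_int_add C0)
  finally show ?case by (simp add: algebra_simps cs_simps del: conv.simps)
qed

lemma T_sum: "T k n = (\<Sum>j<n. (c1 * C ^ (k + j)) *c (conv \<Gamma> 0 (n - j) * g (Suc (k + j))))"
proof (induction n arbitrary: k)
  case (Suc n)
  show ?case unfolding T.simps Suc.IH sum.lessThan_Suc_shift by simp
qed simp


text \<open>The coefficient of z^n in b(z) phi^-(1/z) phi^+(C z); see
  \<open>\<Omega>_sum\<close>.\<close>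

definition \<Omega> where "\<Omega> b n = (\<Sum>j\<le>n. C ^ j *c (conv b 0 (Suc n - j) * g j))"

lemma \<Omega>_T: "(c1 / C) *c \<Omega> \<Gamma> n = (c1 / C) *c (conv \<Gamma> 0 (Suc n) * K) + T 0 n"
proof -
  have "(c1 / C) *c \<Omega> \<Gamma> n = (\<Sum>j\<le>n. (c1 / C * C ^ j) *c (conv \<Gamma> 0 (Suc n - j) * g j))"
    unfolding \<Omega>_def by (simp only: cs.scale_sum_right cs_cs)
  also have "\<dots> = (c1 / C) *c (conv \<Gamma> 0 (Suc n) * g 0) + (\<Sum>j<n. (c1 / C * C ^ Suc j) *c (conv \<Gamma> 0 (n - j) * g (Suc j)))"
    by (subst sum.atMost_shift) (simp del: conv.simps)
  also have "(\<Sum>j<n. (c1 / C * C ^ Suc j) *c (conv \<Gamma> 0 (n - j) * g (Suc j))) = T 0 n"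
    unfolding T_sum using C0 by (intro sum.cong) auto
  finally show ?thesis by (simp only: g0)
qed

lemma qcomm_F: "x \<in> F d \<Longrightarrow> y \<in> F d' \<Longrightarrow> d'' \<le> d + d' \<Longrightarrow> qcomm x y \<in> F d''"
  unfolding qcomm_def by (intro F_diff F_cs) (auto intro: F_mult')

theorem \<Gamma>'_approx: "\<Gamma>' (int n) - \<Omega> \<Gamma> n \<in> F 1"
proof -
  have gK: "g m * K' = K' * g m" "f m * K = K * f m" for m using gf[of 1 m] gf[of m 0] f1 g0 by simp_all
  have eg: "t0 *c e = \<Gamma> 0" "t0 *c e = \<Gamma>' 0" using \<Gamma>0[symmetric] \<Gamma>'0[symmetric] scal by (simp_all add: t0_def \<kappa>_def cs_cs cs_one)
  show ?thesis
  proof -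
    \<comment> \<open>From n = 2 on, the relation involves \<open>a' (n - 2)\<close> with an index
      for which \<open>a'_approx\<close> holds. The case n = 1 is
      \<open>\<Gamma>'_1\<close>.\<close>
    consider "n = 0" | "n = 1" | m where "n = Suc m" "m \<ge> 1" by (cases n) (auto, fastforce)
    then show ?thesis
    proof cases
      case 1
      have "\<Gamma> 0 * f 1 * K = t0 *c e" by (simp only: e_f) (simp only: f1 mult_cs_left KK)
      then have "\<Omega> \<Gamma> 0 = \<Gamma>' 0" using eg by (simp add: \<Omega>_def cs_one g0)
      then show ?thesis using 1 by (simp add: F_zero)
    next
      case 2
      have e1: "\<Gamma> 1 * K' * K = \<Gamma> 1" by (simp add: mult.assoc KK e_a)
      have "\<kappa> *c h = C *c (K' * g 1) + f 2 * K" using h_def by (simp add: \<kappa>_def)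
      from arg_cong[OF this, of "\<lambda>z. t0 *c z"] have h: "h = t0 *c (C *c (K' * g 1) + f 2 * K)"
        using scal by (simp add: cs_cs cs_one t0_def del: cs.scale_right_distrib)
      have "conv \<Gamma> 0 2 = t0 *c f 2 + \<Gamma> 1 * K'" "conv \<Gamma> 0 1 = t0 *c K'"
        using e_f[of 1] by (simp_all add: numeral_2_eq_2 e_f f1[unfolded One_nat_def])
      then have "\<Omega> \<Gamma> 1 = (t0 *c f 2 + \<Gamma> 1 * K') * K + C *c ((t0 *c K') * g 1)"
        unfolding \<Omega>_def by (simp add: g0 cs_one numeral_2_eq_2 del: conv.simps)
      also have "\<dots> = \<Gamma> 1 + h" unfolding h by (simp add: algebra_simps cs_simps e1[unfolded mult.assoc])
      finally have "\<Gamma>' 1 - \<Omega> \<Gamma> 1 = (c1 * u * (u - p)) *c (xp (-1) * xp 0) - (u - p) *c (C *c (a (-1) * xp 0) + a 0 * xp (-1))"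
        using \<Gamma>'_1 by simp
      also have "\<dots> \<in> F 1"
        by (intro F_diff F_cs F_add F_mult0 F_mult'[OF F_gen(1) F_gen(1)] a_F F_gen) simp
      finally show ?thesis using 2 by simp
    next
      case 3
      have n1: "n \<ge> 1" using 3 by simp
      have apn: "a' (int n - 1) - approx n \<in> F 2" "a' (int n - 2) - approx m \<in> F 2"
        using a'_approx[of n] a'_approx[of m] 3 by auto
      have a'F: "a' 0 \<in> F (-1)" "a' (-1) \<in> F (-1)"
        unfolding a'_0 a'_m1
        by (intro F_add F_diff F_cs F_mult0 F_mult0' F_le[OF F_gen(1)] F_gen F_le[OF a_F(1)];
            use f1 F_gen(4)[of 1] in \<open>auto intro: F_le[OF F_gen(3)] F_le[OF F_gen(1)] F_le[of K' 0]\<close>)+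
      \<comment> \<open>For n = 2 the second Gamma of the relation is \<open>\<Gamma>' 0\<close>, a
        multiple of \<open>e\<close>. The same term comes out of \<open>z6\<close> for m =
        1.\<close>
      have on: "(c1 / C) *c \<Gamma>' (int n) = qcomm (a' (-1)) (a' (int n - 1)) + qcomm (a' (int n - 2)) (a' 0)
           - (if n = 2 then c1 *c t0 *c e else 0)"
      proof -
        have "qcomm (a' (-1)) (a' (int n - 1)) + qcomm (a' (int n - 2)) (a' 0) = (c1 / C) *c \<Gamma>' (int n) + (c1 * C powi (int n - 2)) *c \<Gamma>' (2 - int n)"
          using onsager'[of "-1" "int n - 2"] by (simp add: qcomm_def p_def power_int_minus field_simps)
        also have "(c1 * C powi (int n - 2)) *c \<Gamma>' (2 - int n) = (if n = 2 then c1 *c t0 *c e else 0)"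
          using \<Gamma>'neg[of "2 - int n"] 3 eg by auto
        finally show ?thesis by simp
      qed
      define X where "X = xm (1 - int n)"
      define Y where "Y = xm (2 - int n)"
      define D where "D = conv a 0 n"
      define D' where "D' = conv a 0 m"
      define Q where "Q = P 0 n"
      define Q' where "Q' = P 0 m"
      have approx: "approx n = X + D + Q" "approx m = Y + D' + Q'" using 3 by (auto simp: approx_def X_def Y_def D_def D'_def Q_def Q'_def)
      have DF: "D \<in> F 0" "D' \<in> F 0" unfolding D_def D'_def by (intro conv_F a_F)+
      have QF: "Q \<in> F 1" "Q' \<in> F 1" unfolding Q_def Q'_def by (rule P_F)+
      have K'F: "K' \<in> F 0" using f1 F_gen(4)[of 1] by simp
      \<comment> \<open>All products of positive total degree.\<close>
      define R where "R = qcomm (a (-1) * K) Q - (c1 / C) *c qcomm (K * xp (-1)) (D + Q) - (c1 * u) *c qcomm (D' + Q') (K' * xp 0) + qcomm Q' (a 0 * K')"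
      have RF: "R \<in> F 1"
        unfolding R_def by (intro F_add F_diff F_cs qcomm_F[of _ 0 _ 1] qcomm_F[of _ 1 _ 0] QF F_mult0 a_F F_gen K'F DF F_le[OF QF(1)] F_le[OF QF(2)]) auto
      have z1: "qcomm (xm 1) X + qcomm Y (xm 0) = 0"
        using xm_xm[of 0 "1 - int n"] by (simp add: qcomm_def X_def Y_def p_def algebra_simps)
      have z2: "qcomm (xm 1) D + qcomm D' (xm 0) = 0"
        using qcomm_cv[of 0 n] 3 by (simp add: D_def D'_def)
      have KX: "X * K = u *c (K * X)" "Y * K' = p *c (K' * Y)" unfolding X_def Y_def by (rule Kx)+
      have "X * (a (-1) * K) = u *c (a (-1) * (K * X))"
        using comm2[of X "a (-1)" K] KX(1) by (simp add: X_def a_comm mult_cs_right)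
      then have z3: "qcomm (a (-1) * K) X = 0"
        by (simp add: qcomm_def cs_cs cs_one scal mult.assoc)
      have "Y * (a 0 * K') = p *c (a 0 * (K' * Y))"
        using comm2[of Y "a 0" K'] KX(2) by (simp add: Y_def a_comm mult_cs_right)
      then have z4: "qcomm Y (a 0 * K') = 0"
        by (simp add: qcomm_def mult.assoc)
      have z5: "qcomm (K * xp (-1)) X = t0 *c (- (K * f (Suc n)))"
      proof -
        have "qcomm (K * xp (-1)) X = K * (xp (-1) * X - X * xp (-1))"
          unfolding qcomm_def mult.assoc[symmetric] KX by (simp add: cs_simps scal algebra_simps)
        also have "xp (-1) * X - X * xp (-1) = t0 *c (- f (Suc n))"
          using \<kappa>_cancel[OF brk(2)[OF n1]] by (simp add: X_def)
        finally show ?thesis by (simp add: cs_simps)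
      qed
      have z6: "u *c qcomm Y (K' * xp 0) = - (t0 *c (K' * ((if m = 1 then K else 0) - f m)))"
      proof -
        have "u *c qcomm Y (K' * xp 0) = - (K' * (xp 0 * Y - Y * xp 0))"
          unfolding qcomm_def mult.assoc[symmetric] KX by (simp add: cs_simps scal algebra_simps)
        also have "xp 0 * Y - Y * xp 0 = t0 *c ((if m = 1 then K else 0) - f m)"
        proof -
          have "Y = xm (1 - int m)" using 3 by (simp add: Y_def)
          then show ?thesis using \<kappa>_cancel[OF brk(1)[OF 3(2)]] by simp
        qed
        finally show ?thesis by (simp only: mult_cs_right)
      qed
      \<comment> \<open>The half with \<open>K'\<close> cancels against \<open>z9\<close> and
        \<open>z6\<close>. The half with \<open>K\<close> joins \<open>z8\<close> to the left side
        of \<open>z10\<close>, whose isolated terms in \<open>f\<close> cancel against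
        \<open>z5\<close> and the term \<open>f m * K\<close>.\<close>
      have z7: "qcomm (xm 1) Q + qcomm Q' (xm 0) = (qcomm D' (a 0) - (c1 * t0) *c f m) * (K - K') + T 0 n"
        using P_tc[of 0 m] 3 by (simp add: Q_def Q'_def D'_def ps_def del: P.simps)
      have DK: "K * D = D * K" "D' * K' = K' * D'" unfolding D_def D'_def using gf[of _ 0] gK ff[of _ 1]
        by (intro conv_comm conv_comm[symmetric]; simp add: a_comm K'_comm g0 f1[symmetric])+
      have z8: "qcomm (a (-1) * K) D = qcomm (a (-1)) D * K"
        unfolding qcomm_def using DK by (simp add: algebra_simps cs_simps)
      have z9: "qcomm D' (a 0 * K') = qcomm D' (a 0) * K'"
        unfolding qcomm_def using DK by (simp add: algebra_simps cs_simps)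
      have z10: "qcomm (a (-1)) D + qcomm D' (a 0) = (c1 / C) *c (conv \<Gamma> 0 (Suc n) - t0 *c f (Suc n)) + (c1 * t0) *c f m"
        using qcomm_cv_near[of "-1" n] 3 by (simp add: D_def D'_def power_int_minus field_simps del: conv.simps)
      have main: "qcomm (a' (-1)) (approx n) + qcomm (approx m) (a' 0) = (c1 / C) *c \<Omega> \<Gamma> n + (if n = 2 then c1 *c t0 *c e else 0) + R"
      proof -
        have "qcomm (a' (-1)) (approx n) + qcomm (approx m) (a' 0) = (qcomm (xm 1) X + qcomm Y (xm 0)) + (qcomm (xm 1) D + qcomm D' (xm 0))
           + qcomm (a (-1) * K) X + qcomm Y (a 0 * K') + (qcomm (xm 1) Q + qcomm Q' (xm 0)) - (c1 / C) *c qcomm (K * xp (-1)) X - c1 *c (u *c qcomm Y (K' * xp 0))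
           + qcomm (a (-1) * K) D + qcomm D' (a 0 * K') + R"
          unfolding approx a'_0 a'_m1 R_def u_def[symmetric] by (simp add: qcomm_add qcomm_diff qcomm_cs algebra_simps cs_simps)
        also have "\<dots> = (qcomm (a (-1)) D + qcomm D' (a 0)) * K + T 0 n + (c1 / C * t0) *c (K * f (Suc n)) - (c1 * t0) *c (f m * K)
            + (c1 * t0) *c (if m = 1 then e else 0) + R"
          unfolding z1 z2 z3 z4 z5 z6 z7 z8 z9 using KK gf[of m 1] ff[of m 1]
          by (simp add: algebra_simps cs_simps f1[symmetric])
        also have "\<dots> = (c1 / C) *c (conv \<Gamma> 0 (Suc n) * K) + T 0 n + (c1 * t0) *c (if m = 1 then e else 0) + R"
          unfolding z10 using gK(2)[of "Suc n"] by (simp add: algebra_simps cs_simps del: conv.simps)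
        finally show ?thesis unfolding \<Omega>_T using 3 by (simp add: cs_cs del: conv.simps)
      qed
      have "(c1 / C) *c (\<Gamma>' (int n) - \<Omega> \<Gamma> n) = qcomm (a' (-1)) (a' (int n - 1) - approx n) + qcomm (a' (int n - 2) - approx m) (a' 0) + R"
        unfolding cs.scale_right_diff_distrib on qcomm_diff using main by (simp add: algebra_simps)
      also have "\<dots> \<in> F 1"
        by (intro F_add RF qcomm_F[OF a'F(2) apn(1)] qcomm_F[OF apn(2) a'F(1)]) simp_all
      finally have "(C / c1) *c (c1 / C) *c (\<Gamma>' (int n) - \<Omega> \<Gamma> n) \<in> F 1" by (rule F_cs)
      then show ?thesis using C0 c1 by (simp add: cs_cs cs_one del: cs.scale_right_diff_distrib)
    qed
  qed
qed

end

section \<open>Complex algebras as records and as types\<close>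

locale complex_algebra = ring A for A :: "(complex, 'a) module" (structure) +
  assumes smult_closed [simp, intro]: "x \<in> carrier A \<Longrightarrow> c \<odot> x \<in> carrier A"
    and smult_add_right: "x \<in> carrier A \<Longrightarrow> y \<in> carrier A \<Longrightarrow> c \<odot> (x \<oplus> y) = c \<odot> x \<oplus> c \<odot> y"
    and smult_add_left: "x \<in> carrier A \<Longrightarrow> (c + d) \<odot> x = c \<odot> x \<oplus> d \<odot> x"
    and smult_assoc: "x \<in> carrier A \<Longrightarrow> c \<odot> (d \<odot> x) = (c * d) \<odot> x"
    and smult_one: "x \<in> carrier A \<Longrightarrow> 1 \<odot> x = x"
    and smult_mult_left: "x \<in> carrier A \<Longrightarrow> y \<in> carrier A \<Longrightarrow> (c \<odot> x) \<otimes> y = c \<odot> (x \<otimes> y)"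
    and smult_mult_right: "x \<in> carrier A \<Longrightarrow> y \<in> carrier A \<Longrightarrow> x \<otimes> (c \<odot> y) = c \<odot> (x \<otimes> y)"


section \<open>Monoid algebras\<close>

lemma poly_mapping_eq_sum:
  fixes f :: "'a \<Rightarrow>\<^sub>0 complex"
  assumes "finite S" "Poly_Mapping.keys f \<subseteq> S"
  shows "f = (\<Sum>a\<in>S. Poly_Mapping.single a (Poly_Mapping.lookup f a))"
proof (rule poly_mapping_eqI)
  fix k
  have "(\<Sum>a\<in>S. Poly_Mapping.lookup (Poly_Mapping.single a (Poly_Mapping.lookup f a)) k) = (\<Sum>a\<in>S. if a = k then Poly_Mapping.lookup f a else 0)"
    by (intro sum.cong) (auto simp: lookup_single)
  also have "\<dots> = Poly_Mapping.lookup f k" using assms by (auto simp: in_keys_iff)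
  finally show "Poly_Mapping.lookup f k = Poly_Mapping.lookup (\<Sum>a\<in>S. Poly_Mapping.single a (Poly_Mapping.lookup f a)) k"
    by (simp add: lookup_sum)
qed

lemma monoid_alg_simps:
  "carrier (monoid_alg M) = {f. Poly_Mapping.keys f \<subseteq> carrier M}"
  "\<one>\<^bsub>monoid_alg M\<^esub> = Poly_Mapping.single \<one>\<^bsub>M\<^esub> 1"
  "\<zero>\<^bsub>monoid_alg M\<^esub> = 0"
  "x \<oplus>\<^bsub>monoid_alg M\<^esub> y = x + y"
  by (simp_all add: monoid_alg_def)

text \<open>The supports of \<open>f\<close>, \<open>f'\<close> and \<open>f + f'\<close> differ.
  Summation over a common finite superset makes additivity a termwise matter.\<close>

lemma monoid_alg_mult_eq:
  assumes "finite S" "Poly_Mapping.keys f \<subseteq> S" "finite T" "Poly_Mapping.keys g \<subseteq> T"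
  shows "f \<otimes>\<^bsub>monoid_alg M\<^esub> g = (\<Sum>a\<in>S. \<Sum>b\<in>T.
     Poly_Mapping.single (a \<otimes>\<^bsub>M\<^esub> b) (Poly_Mapping.lookup f a * Poly_Mapping.lookup g b))"
proof -
  have "f \<otimes>\<^bsub>monoid_alg M\<^esub> g = (\<Sum>a\<in>Poly_Mapping.keys f. \<Sum>b\<in>Poly_Mapping.keys g.
     Poly_Mapping.single (a \<otimes>\<^bsub>M\<^esub> b) (Poly_Mapping.lookup f a * Poly_Mapping.lookup g b))"
    by (simp add: monoid_alg_def)
  also have "\<dots> = (\<Sum>a\<in>Poly_Mapping.keys f. \<Sum>b\<in>T.
     Poly_Mapping.single (a \<otimes>\<^bsub>M\<^esub> b) (Poly_Mapping.lookup f a * Poly_Mapping.lookup g b))"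
    using assms by (intro sum.cong sum.mono_neutral_left refl) (auto simp: in_keys_iff)
  also have "\<dots> = (\<Sum>a\<in>S. \<Sum>b\<in>T.
     Poly_Mapping.single (a \<otimes>\<^bsub>M\<^esub> b) (Poly_Mapping.lookup f a * Poly_Mapping.lookup g b))"
    using assms by (intro sum.mono_neutral_left) (auto simp: in_keys_iff)
  finally show ?thesis .
qed

lemma monoid_alg_mult_add:
  "(f + f') \<otimes>\<^bsub>monoid_alg M\<^esub> g = f \<otimes>\<^bsub>monoid_alg M\<^esub> g + f' \<otimes>\<^bsub>monoid_alg M\<^esub> g"
  "g \<otimes>\<^bsub>monoid_alg M\<^esub> (f + f') = g \<otimes>\<^bsub>monoid_alg M\<^esub> f + g \<otimes>\<^bsub>monoid_alg M\<^esub> f'"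
proof -
  let ?S = "Poly_Mapping.keys f \<union> Poly_Mapping.keys f'" and ?T = "Poly_Mapping.keys g"
  have S: "finite ?S" "Poly_Mapping.keys f \<subseteq> ?S" "Poly_Mapping.keys f' \<subseteq> ?S" "Poly_Mapping.keys (f + f') \<subseteq> ?S" "finite ?T" "?T \<subseteq> ?T"
    using keys_add[of f f'] by auto
  show "(f + f') \<otimes>\<^bsub>monoid_alg M\<^esub> g = f \<otimes>\<^bsub>monoid_alg M\<^esub> g + f' \<otimes>\<^bsub>monoid_alg M\<^esub> g"
    unfolding monoid_alg_mult_eq[OF S(1,2,5,6)] monoid_alg_mult_eq[OF S(1,3,5,6)] monoid_alg_mult_eq[OF S(1,4,5,6)]
    by (simp add: lookup_add ring_distribs single_add sum.distrib)
  show "g \<otimes>\<^bsub>monoid_alg M\<^esub> (f + f') = g \<otimes>\<^bsub>monoid_alg M\<^esub> f + g \<otimes>\<^bsub>monoid_alg M\<^esub> f'"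
    unfolding monoid_alg_mult_eq[OF S(5,6,1,2)] monoid_alg_mult_eq[OF S(5,6,1,3)] monoid_alg_mult_eq[OF S(5,6,1,4)]
    by (simp add: lookup_add ring_distribs single_add sum.distrib)
qed

lemma monoid_alg_mult_single:
  "Poly_Mapping.single a c \<otimes>\<^bsub>monoid_alg M\<^esub> Poly_Mapping.single b d = Poly_Mapping.single (a \<otimes>\<^bsub>M\<^esub> b) (c * d)"
  by (subst monoid_alg_mult_eq[of "{a}" _ "{b}"]) (auto simp: lookup_single)

lemma monoid_alg_mult_0: "0 \<otimes>\<^bsub>monoid_alg M\<^esub> g = 0" "g \<otimes>\<^bsub>monoid_alg M\<^esub> 0 = 0"
  by (simp_all add: monoid_alg_def)

lemma monoid_alg_smult:
  "Poly_Mapping.lookup (c \<odot>\<^bsub>monoid_alg M\<^esub> f) k = c * Poly_Mapping.lookup f k"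
  by (simp add: monoid_alg_def Poly_Mapping.map.rep_eq when_def)

lemma monoid_alg_smult_single: "c \<odot>\<^bsub>monoid_alg M\<^esub> Poly_Mapping.single a d = Poly_Mapping.single a (c * d)"
  by (rule poly_mapping_eqI) (simp add: monoid_alg_smult lookup_single when_def)

lemma monoid_alg_smult_add: "c \<odot>\<^bsub>monoid_alg M\<^esub> (f + g) = c \<odot>\<^bsub>monoid_alg M\<^esub> f + c \<odot>\<^bsub>monoid_alg M\<^esub> g"
  by (rule poly_mapping_eqI) (simp add: monoid_alg_smult lookup_add ring_distribs)

text \<open>Reduces additive statements to monomials; associativity uses it once for each
  factor.\<close>

lemma monoid_alg_induct:
  assumes "f \<in> carrier (monoid_alg M)"
    and "\<And>a c. a \<in> carrier M \<Longrightarrow> P (Poly_Mapping.single a c)"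
    and "P 0" "\<And>f g. P f \<Longrightarrow> P g \<Longrightarrow> P (f + g)"
  shows "P f"
proof -
  have *: "P (\<Sum>a\<in>S. Poly_Mapping.single a (Poly_Mapping.lookup f a))" if "finite S" "S \<subseteq> carrier M" for S
    using that by (induction S) (auto intro: assms)
  have "f = (\<Sum>a\<in>Poly_Mapping.keys f. Poly_Mapping.single a (Poly_Mapping.lookup f a))"
    by (rule poly_mapping_eq_sum) auto
  then show ?thesis using *[of "Poly_Mapping.keys f"] assms(1) by (simp add: monoid_alg_simps)
qed

lemma monoid_alg_complex_algebra:
  assumes "monoid M"
  shows "complex_algebra (monoid_alg M)"
proof -
  interpret M: monoid M by fact
  let ?A = "monoid_alg M"
  note simps = monoid_alg_simps monoid_alg_mult_add monoid_alg_mult_0 monoid_alg_smult_add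
  have add_closed: "x + y \<in> carrier ?A" if "x \<in> carrier ?A" "y \<in> carrier ?A" for x y
    using that keys_add[of x y] by (auto simp: monoid_alg_simps)
  have zero_closed: "0 \<in> carrier ?A" by (simp add: monoid_alg_simps)
  have single_closed: "Poly_Mapping.single a c \<in> carrier ?A" if "a \<in> carrier M" for a c
    using that by (auto simp: monoid_alg_simps)
  have smult0: "c \<odot>\<^bsub>?A\<^esub> 0 = 0" for c by (rule poly_mapping_eqI) (simp add: monoid_alg_smult)
  have smult_closed: "c \<odot>\<^bsub>?A\<^esub> x \<in> carrier ?A" if "x \<in> carrier ?A" for c x
    using that by (rule monoid_alg_induct) (auto simp: simps(4-) smult0 monoid_alg_smult_single add_closed zero_closed single_closed)
  have mult_closed: "x \<otimes>\<^bsub>?A\<^esub> y \<in> carrier ?A" if "x \<in> carrier ?A" "y \<in> carrier ?A" for x y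
    using that(1)
  proof (rule monoid_alg_induct)
    fix a c assume a: "a \<in> carrier M"
    show "Poly_Mapping.single a c \<otimes>\<^bsub>?A\<^esub> y \<in> carrier ?A" using that(2)
      by (rule monoid_alg_induct) (auto simp: simps(4-) monoid_alg_mult_single a add_closed zero_closed single_closed)
  qed (auto simp: simps(4-) add_closed zero_closed)
  have assoc: "x \<otimes>\<^bsub>?A\<^esub> y \<otimes>\<^bsub>?A\<^esub> z = x \<otimes>\<^bsub>?A\<^esub> (y \<otimes>\<^bsub>?A\<^esub> z)" if "x \<in> carrier ?A" "y \<in> carrier ?A" "z \<in> carrier ?A" for x y z
    using that(1)
  proof (rule monoid_alg_induct)
    fix a c assume a: "a \<in> carrier M"
    show "Poly_Mapping.single a c \<otimes>\<^bsub>?A\<^esub> y \<otimes>\<^bsub>?A\<^esub> z = Poly_Mapping.single a c \<otimes>\<^bsub>?A\<^esub> (y \<otimes>\<^bsub>?A\<^esub> z)" using that(2)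
    proof (rule monoid_alg_induct)
      fix b d assume b: "b \<in> carrier M"
      show "Poly_Mapping.single a c \<otimes>\<^bsub>?A\<^esub> Poly_Mapping.single b d \<otimes>\<^bsub>?A\<^esub> z = Poly_Mapping.single a c \<otimes>\<^bsub>?A\<^esub> (Poly_Mapping.single b d \<otimes>\<^bsub>?A\<^esub> z)" using that(3)
        by (rule monoid_alg_induct) (auto simp: simps(4-) monoid_alg_mult_single M.m_assoc a b mult.assoc)
    qed (auto simp: simps(4-))
  qed (auto simp: simps(4-))
  have one: "\<one>\<^bsub>?A\<^esub> \<otimes>\<^bsub>?A\<^esub> x = x" "x \<otimes>\<^bsub>?A\<^esub> \<one>\<^bsub>?A\<^esub> = x" if "x \<in> carrier ?A" for x
    by (rule monoid_alg_induct[OF that]; simp add: simps(2,4-) monoid_alg_mult_single)+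
  have sl: "(c \<odot>\<^bsub>?A\<^esub> x) \<otimes>\<^bsub>?A\<^esub> y = c \<odot>\<^bsub>?A\<^esub> (x \<otimes>\<^bsub>?A\<^esub> y)" "x \<otimes>\<^bsub>?A\<^esub> (c \<odot>\<^bsub>?A\<^esub> y) = c \<odot>\<^bsub>?A\<^esub> (x \<otimes>\<^bsub>?A\<^esub> y)"
    if xy: "x \<in> carrier ?A" "y \<in> carrier ?A" for c x y
  proof -
    have "(c \<odot>\<^bsub>?A\<^esub> x) \<otimes>\<^bsub>?A\<^esub> y = c \<odot>\<^bsub>?A\<^esub> (x \<otimes>\<^bsub>?A\<^esub> y) \<and> x \<otimes>\<^bsub>?A\<^esub> (c \<odot>\<^bsub>?A\<^esub> y) = c \<odot>\<^bsub>?A\<^esub> (x \<otimes>\<^bsub>?A\<^esub> y)"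
      using xy(1)
    proof (rule monoid_alg_induct)
      fix a d assume a: "a \<in> carrier M"
      show "(c \<odot>\<^bsub>?A\<^esub> Poly_Mapping.single a d) \<otimes>\<^bsub>?A\<^esub> y = c \<odot>\<^bsub>?A\<^esub> (Poly_Mapping.single a d \<otimes>\<^bsub>?A\<^esub> y) \<and>
         Poly_Mapping.single a d \<otimes>\<^bsub>?A\<^esub> (c \<odot>\<^bsub>?A\<^esub> y) = c \<odot>\<^bsub>?A\<^esub> (Poly_Mapping.single a d \<otimes>\<^bsub>?A\<^esub> y)"
        using xy(2)
        by (rule monoid_alg_induct) (auto simp: simps(4-) smult0 monoid_alg_smult_single monoid_alg_mult_single mult_ac)
    qed (auto simp: simps(4-) smult0)
    then show "(c \<odot>\<^bsub>?A\<^esub> x) \<otimes>\<^bsub>?A\<^esub> y = c \<odot>\<^bsub>?A\<^esub> (x \<otimes>\<^bsub>?A\<^esub> y)" "x \<otimes>\<^bsub>?A\<^esub> (c \<odot>\<^bsub>?A\<^esub> y) = c \<odot>\<^bsub>?A\<^esub> (x \<otimes>\<^bsub>?A\<^esub> y)" by auto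
  qed
  have "ring ?A"
  proof (rule ringI)
    show "abelian_group ?A"
    proof (rule abelian_groupI)
      fix x assume "x \<in> carrier ?A"
      then show "\<exists>y\<in>carrier ?A. y \<oplus>\<^bsub>?A\<^esub> x = \<zero>\<^bsub>?A\<^esub>"
        by (intro bexI[of _ "- x"]) (auto simp: monoid_alg_simps keys_minus)
    qed (auto simp: simps(3,4) add_closed zero_closed)
    show "monoid ?A"
      by (rule monoidI) (auto simp: mult_closed assoc one[unfolded simps(2)] single_closed simps(2))
  qed (auto simp: simps(4-))
  then show ?thesis
  proof (intro complex_algebra.intro complex_algebra_axioms.intro)
    show "(c + d) \<odot>\<^bsub>?A\<^esub> x = c \<odot>\<^bsub>?A\<^esub> x \<oplus>\<^bsub>?A\<^esub> d \<odot>\<^bsub>?A\<^esub> x" for c d x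
      by (rule poly_mapping_eqI) (simp add: monoid_alg_smult lookup_add simps(4) ring_distribs)
    show "c \<odot>\<^bsub>?A\<^esub> (d \<odot>\<^bsub>?A\<^esub> x) = (c * d) \<odot>\<^bsub>?A\<^esub> x" for c d x
      by (rule poly_mapping_eqI) (simp add: monoid_alg_smult)
    show "1 \<odot>\<^bsub>?A\<^esub> x = x" for x
      by (rule poly_mapping_eqI) (simp add: monoid_alg_smult)
  qed (auto simp: smult_closed sl simps(4-))
qed

lemma free_alg_complex_algebra: "complex_algebra (free_alg G)"
  unfolding free_alg_def
  by (rule monoid_alg_complex_algebra) (auto intro!: monoidI)

lemma free_gen_closed: "g \<in> G \<Longrightarrow> free_gen g \<in> carrier (free_alg G)"
  by (simp add: free_alg_def free_gen_def monoid_alg_simps)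

section \<open>Homomorphisms and quotients\<close>

lemma alg_homD:
  assumes "f \<in> alg_hom A B"
  shows "x \<in> carrier A \<Longrightarrow> f x \<in> carrier B"
    "x \<in> carrier A \<Longrightarrow> y \<in> carrier A \<Longrightarrow> f (x \<otimes>\<^bsub>A\<^esub> y) = f x \<otimes>\<^bsub>B\<^esub> f y"
    "x \<in> carrier A \<Longrightarrow> y \<in> carrier A \<Longrightarrow> f (x \<oplus>\<^bsub>A\<^esub> y) = f x \<oplus>\<^bsub>B\<^esub> f y"
    "f \<one>\<^bsub>A\<^esub> = \<one>\<^bsub>B\<^esub>" "x \<in> carrier A \<Longrightarrow> f (c \<odot>\<^bsub>A\<^esub> x) = c \<odot>\<^bsub>B\<^esub> f x"
  using assms by (auto simp: alg_hom_def ring_hom_def)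

lemma quot_alg_simps:
  "carrier (quot_alg A S) = carrier (A Quot (Idl\<^bsub>A\<^esub> S))"
  "monoid.mult (quot_alg A S) = monoid.mult (A Quot (Idl\<^bsub>A\<^esub> S))"
  "\<one>\<^bsub>quot_alg A S\<^esub> = \<one>\<^bsub>A Quot (Idl\<^bsub>A\<^esub> S)\<^esub>"
  "\<zero>\<^bsub>quot_alg A S\<^esub> = \<zero>\<^bsub>A Quot (Idl\<^bsub>A\<^esub> S)\<^esub>"
  "add (quot_alg A S) = add (A Quot (Idl\<^bsub>A\<^esub> S))"
  "c \<odot>\<^bsub>quot_alg A S\<^esub> X = alg_class A S (c \<odot>\<^bsub>A\<^esub> \<one>\<^bsub>A\<^esub>) \<otimes>\<^bsub>quot_alg A S\<^esub> X"
  by (simp_all add: quot_alg_def ring.defs module.defs)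

context complex_algebra begin

text \<open>\<open>alg_class\<close> is surjective and compatible with all operations, so each law
  descends from representatives.\<close>

lemma quot:
  assumes S: "S \<subseteq> carrier A"
  shows quot_alg_complex_algebra: "complex_algebra (quot_alg A S)"
    and alg_class_hom: "alg_class A S \<in> alg_hom A (quot_alg A S)"
    and alg_class_zero: "x \<in> S \<Longrightarrow> alg_class A S x = \<zero>\<^bsub>quot_alg A S\<^esub>"
proof -
  interpret I: ideal "Idl S" A by (rule genideal_ideal[OF S])
  let ?Q = "quot_alg A S"
  interpret Q: ring "A Quot (Idl S)" by (rule I.quotient_is_ring)
  have rQ: "ring ?Q"
  proof (rule ringI)
    show "abelian_group ?Q"
      by (rule abelian_groupI)
        (simp_all add: quot_alg_simps Q.a_ac Q.add.l_inv_ex)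
    show "monoid ?Q"
      by (rule monoidI) (auto simp: quot_alg_simps Q.m_assoc)
  qed (auto simp: quot_alg_simps Q.l_distr Q.r_distr)
  have rh: "alg_class A S \<in> ring_hom A (A Quot (Idl S))"
    using I.rcos_ring_hom by (simp add: alg_class_def[abs_def])
  then have rh': "alg_class A S \<in> ring_hom A ?Q"
    by (simp add: ring_hom_def quot_alg_simps)
  have cl: "alg_class A S x \<in> carrier ?Q" if "x \<in> carrier A" for x
    using ring_hom_closed[OF rh' that] .
  \<comment> \<open>The scalar action on the quotient multiplies by the class of c times 1; moving c
    out of the product of that element with x gives the class of c x.\<close>
  have sm: "alg_class A S (c \<odot> x) = c \<odot>\<^bsub>?Q\<^esub> alg_class A S x" if "x \<in> carrier A" for c x
    unfolding quot_alg_simps(6) using that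
    by (simp add: ring_hom_mult[OF rh', symmetric] smult_mult_left)
  show hom: "alg_class A S \<in> alg_hom A ?Q"
    unfolding alg_hom_def using rh' sm by auto
  have surj: "\<exists>x\<in>carrier A. X = alg_class A S x" if "X \<in> carrier ?Q" for X
    using that by (auto simp: quot_alg_simps FactRing_def A_RCOSETS_def' alg_class_def a_r_coset_def')
  show "alg_class A S x = \<zero>\<^bsub>?Q\<^esub>" if "x \<in> S" for x
    using genideal_self[OF S] that I.a_rcos_const by (auto simp: quot_alg_simps FactRing_def alg_class_def)
  interpret rQ: ring ?Q by (rule rQ)
  note H = alg_homD[OF hom]
  show "complex_algebra ?Q"
  proof (intro complex_algebra.intro complex_algebra_axioms.intro rQ)
    fix X c d Y assume "X \<in> carrier ?Q" and Y: "Y \<in> carrier ?Q"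
    then obtain x y where x: "x \<in> carrier A" "X = alg_class A S x" and y: "y \<in> carrier A" "Y = alg_class A S y"
      using surj by meson
    show "c \<odot>\<^bsub>?Q\<^esub> X \<in> carrier ?Q" using x cl by (simp flip: sm)
    show "c \<odot>\<^bsub>?Q\<^esub> (X \<oplus>\<^bsub>?Q\<^esub> Y) = c \<odot>\<^bsub>?Q\<^esub> X \<oplus>\<^bsub>?Q\<^esub> c \<odot>\<^bsub>?Q\<^esub> Y"
      using x y by (simp add: smult_add_right flip: sm H(3))
    show "(c + d) \<odot>\<^bsub>?Q\<^esub> X = c \<odot>\<^bsub>?Q\<^esub> X \<oplus>\<^bsub>?Q\<^esub> d \<odot>\<^bsub>?Q\<^esub> X"
      using x by (simp add: smult_add_left flip: sm H(3))
    show "c \<odot>\<^bsub>?Q\<^esub> (d \<odot>\<^bsub>?Q\<^esub> X) = (c * d) \<odot>\<^bsub>?Q\<^esub> X"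
      using x by (simp add: smult_assoc flip: sm)
    show "1 \<odot>\<^bsub>?Q\<^esub> X = X"
      using x by (simp add: smult_one flip: sm)
    show "(c \<odot>\<^bsub>?Q\<^esub> X) \<otimes>\<^bsub>?Q\<^esub> Y = c \<odot>\<^bsub>?Q\<^esub> (X \<otimes>\<^bsub>?Q\<^esub> Y)"
      using x y by (simp add: smult_mult_left flip: sm H(2))
    show "X \<otimes>\<^bsub>?Q\<^esub> (c \<odot>\<^bsub>?Q\<^esub> Y) = c \<odot>\<^bsub>?Q\<^esub> (X \<otimes>\<^bsub>?Q\<^esub> Y)"
      using x y by (simp add: smult_mult_right flip: sm H(2))
  qed
qed

end

text \<open>
  The product of all complex algebras with carrier in a given type is a ring on a whole type. Every such
  algebra embeds in it as a factor, which transfers equations between records and type classes.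
\<close>

typedef 'a alg_prod = "{f :: (complex, 'a) module \<Rightarrow> 'a. \<forall>A. if complex_algebra A then f A \<in> carrier A else f A = undefined}"
  by (rule exI[of _ "\<lambda>A. if complex_algebra A then \<zero>\<^bsub>A\<^esub> else undefined"])
    (auto intro: ring.ring_simprules(2) complex_algebra.axioms(1))

setup_lifting type_definition_alg_prod

instantiation alg_prod :: (type) typed_algebra
begin

lift_definition zero_alg_prod :: "'a alg_prod" is "\<lambda>A. if complex_algebra A then \<zero>\<^bsub>A\<^esub> else undefined"
  by (auto intro: ring.ring_simprules(2) complex_algebra.axioms(1))
lift_definition plus_alg_prod :: "'a alg_prod \<Rightarrow> 'a alg_prod \<Rightarrow> 'a alg_prod" is
  "\<lambda>f g A. if complex_algebra A then f A \<oplus>\<^bsub>A\<^esub> g A else undefined"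
  by (auto intro: ring.ring_simprules(1) complex_algebra.axioms(1))
lift_definition uminus_alg_prod :: "'a alg_prod \<Rightarrow> 'a alg_prod" is
  "\<lambda>f A. if complex_algebra A then \<ominus>\<^bsub>A\<^esub> f A else undefined"
  by (auto intro: ring.ring_simprules(3) complex_algebra.axioms(1))
lift_definition minus_alg_prod :: "'a alg_prod \<Rightarrow> 'a alg_prod \<Rightarrow> 'a alg_prod" is
  "\<lambda>f g A. if complex_algebra A then f A \<ominus>\<^bsub>A\<^esub> g A else undefined"
  by (auto intro: ring.ring_simprules(4) complex_algebra.axioms(1))
lift_definition times_alg_prod :: "'a alg_prod \<Rightarrow> 'a alg_prod \<Rightarrow> 'a alg_prod" is
  "\<lambda>f g A. if complex_algebra A then f A \<otimes>\<^bsub>A\<^esub> g A else undefined"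
  by (auto intro: ring.ring_simprules(5) complex_algebra.axioms(1))
lift_definition cs_alg_prod :: "complex \<Rightarrow> 'a alg_prod \<Rightarrow> 'a alg_prod" is
  "\<lambda>c f A. if complex_algebra A then c \<odot>\<^bsub>A\<^esub> f A else undefined"
  by (auto intro: complex_algebra.smult_closed)

instance
proof
  fix a b c :: "'a alg_prod" and k l :: complex
  have [simp]: "complex_algebra A \<Longrightarrow> ring A" for A :: "(complex, 'a) module" by (rule complex_algebra.axioms(1))
  note [simp] = complex_algebra.smult_add_right complex_algebra.smult_add_left complex_algebra.smult_assoc complex_algebra.smult_one
    complex_algebra.smult_mult_left complex_algebra.smult_mult_right
  show "a + b + c = a + (b + c)" by transfer (auto simp: fun_eq_iff ring.ring_simprules)
  show "a + b = b + a" by transfer (auto simp: fun_eq_iff ring.ring_simprules)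
  show "0 + a = a" by transfer (auto simp: fun_eq_iff ring.ring_simprules)
  show "- a + a = 0" by transfer (auto simp: fun_eq_iff ring.ring_simprules)
  show "a - b = a + - b" by transfer (auto simp: fun_eq_iff a_minus_def)
  show "a * b * c = a * (b * c)" by transfer (auto simp: fun_eq_iff ring.ring_simprules)
  show "(a + b) * c = a * c + b * c" by transfer (auto simp: fun_eq_iff ring.ring_simprules)
  show "a * (b + c) = a * b + a * c" by transfer (auto simp: fun_eq_iff ring.ring_simprules)
  show "k *c (a + b) = k *c a + k *c b" by transfer (auto simp: fun_eq_iff)
  show "(k + l) *c a = k *c a + l *c a" by transfer (auto simp: fun_eq_iff)
  show "k *c l *c a = (k * l) *c a" by transfer (auto simp: fun_eq_iff)
  show "1 *c a = a" by transfer (auto simp: fun_eq_iff)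
  show "(k *c a) * b = k *c (a * b)" by transfer (auto simp: fun_eq_iff)
  show "a * (k *c b) = k *c (a * b)" by transfer (auto simp: fun_eq_iff)
qed

end

text \<open>No clause for the unit: \<open>emb\<close> maps it to an idempotent. Locales that need
  the units of two maps to agree assume it separately.\<close>

definition typed_hom :: "(complex, 'b) module \<Rightarrow> ('b \<Rightarrow> 'a::typed_algebra) \<Rightarrow> bool" where
  "typed_hom A \<rho> \<longleftrightarrow> (\<forall>x\<in>carrier A. \<forall>y\<in>carrier A. \<rho> (x \<oplus>\<^bsub>A\<^esub> y) = \<rho> x + \<rho> y \<and> \<rho> (x \<otimes>\<^bsub>A\<^esub> y) = \<rho> x * \<rho> y) \<and>
     (\<forall>c. \<forall>x\<in>carrier A. \<rho> (c \<odot>\<^bsub>A\<^esub> x) = c *c \<rho> x)"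

text \<open>Zero in every other factor, so sums and products are preserved but the unit is not.
  Elements outside the carrier go to zero because the map must be total.\<close>

lift_definition emb :: "(complex, 'a) module \<Rightarrow> 'a \<Rightarrow> 'a alg_prod" is
  "\<lambda>R x A. if complex_algebra A then (if A = R \<and> x \<in> carrier A then x else \<zero>\<^bsub>A\<^esub>) else undefined"
  by (auto intro: ring.ring_simprules(2) complex_algebra.axioms(1))

lemma (in complex_algebra) smult_zero: "c \<odot> \<zero> = \<zero>"
proof -
  have "c \<odot> \<zero> \<oplus> c \<odot> \<zero> = c \<odot> \<zero>" using smult_add_right[of \<zero> \<zero> c] by simp
  then show "c \<odot> \<zero> = \<zero>" by (metis add.l_cancel_one' smult_closed zero_closed)
qed

lemma typed_hom_emb: "complex_algebra R \<Longrightarrow> typed_hom R (emb R)"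
  unfolding typed_hom_def
proof (intro conjI ballI allI)
  fix x y c assume R: "complex_algebra R" and x: "x \<in> carrier R" and y: "y \<in> carrier R"
  have [simp]: "complex_algebra A \<Longrightarrow> ring A" for A :: "(complex, 'a) module" by (rule complex_algebra.axioms(1))
  show "emb R (x \<oplus>\<^bsub>R\<^esub> y) = emb R x + emb R y" using x y R
    by transfer (auto simp: fun_eq_iff ring.ring_simprules)
  show "emb R (x \<otimes>\<^bsub>R\<^esub> y) = emb R x * emb R y" using x y R
    by transfer (auto simp: fun_eq_iff ring.ring_simprules)
next
  fix x c assume R: "complex_algebra R" and x: "x \<in> carrier R"
  show "emb R (c \<odot>\<^bsub>R\<^esub> x) = c *c emb R x" using x R
    by transfer (auto simp: fun_eq_iff ring.ring_simprules complex_algebra.smult_zero complex_algebra.smult_closed)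
qed

lemma emb_inj:
  assumes "complex_algebra R" "x \<in> carrier R" "y \<in> carrier R" "emb R x = emb R y"
  shows "x = y"
  using arg_cong[OF assms(4), of "\<lambda>z. Rep_alg_prod z R"] assms(1-3) by (simp add: emb.rep_eq)

section \<open>Exponentials of power series\<close>

text \<open>The counterpart of powers in \<open>series_monoid\<close>, with \<open>e\<close> in the
  place of the unit; see \<open>hom_series_pow\<close>.\<close>

fun pow_coeff :: "'a::typed_algebra \<Rightarrow> (nat \<Rightarrow> 'a) \<Rightarrow> nat \<Rightarrow> nat \<Rightarrow> 'a" where
  "pow_coeff e f 0 n = (if n = 0 then e else 0)"
| "pow_coeff e f (Suc k) n = (\<Sum>i\<le>n. pow_coeff e f k i * f (n - i))"

definition exp_coeff :: "'a::typed_algebra \<Rightarrow> (nat \<Rightarrow> 'a) \<Rightarrow> nat \<Rightarrow> 'a" where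
  "exp_coeff e f n = (\<Sum>k\<le>n. (1 / fact k) *c pow_coeff e f k n)"

lemma pow_coeff_comm:
  assumes "x * e = e * x" "\<And>i. x * f i = f i * x"
  shows "x * pow_coeff e f k n = pow_coeff e f k n * x"
proof (induction k arbitrary: n)
  case (Suc k)
  have "x * (pow_coeff e f k i * f j) = pow_coeff e f k i * f j * x" for i j
    using Suc[of i] assms(2)[of j] by (metis mult.assoc)
  then show ?case by (simp add: sum_distrib_left sum_distrib_right)
qed (use assms in auto)

lemma exp_coeff_comm:
  assumes "x * e = e * x" "\<And>i. x * f i = f i * x"
  shows "x * exp_coeff e f n = exp_coeff e f n * x"
  unfolding exp_coeff_def by (simp add: sum_distrib_left sum_distrib_right mult_cs_left mult_cs_right pow_coeff_comm[OF assms])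

lemma pow_coeff_zero: "f 0 = 0 \<Longrightarrow> k > n \<Longrightarrow> pow_coeff e f k n = 0"
proof (induction k arbitrary: n)
  case (Suc k)
  have "pow_coeff e f k i * f (n - i) = 0" if "i \<le> n" for i
    using Suc that by (cases "i = n") auto
  then show ?case by simp
qed auto

lemma sum_swap_conv:
  fixes G :: "nat \<Rightarrow> nat \<Rightarrow> nat \<Rightarrow> 'a::comm_monoid_add"
  shows "(\<Sum>i\<le>n. \<Sum>j\<le>n - i. G i j (n - i - j)) = (\<Sum>j\<le>n. \<Sum>i\<le>n - j. G i j (n - j - i))"
proof -
  have "(\<Sum>i\<le>n. \<Sum>j\<le>n - i. G i j (n - i - j)) = (\<Sum>(i,j)\<in>{(i,j). i + j \<le> n}. G i j (n - i - j))"
    unfolding sum.Sigma[OF finite_atMost ballI[OF finite_atMost]]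
    by (intro sum.cong) auto
  also have "\<dots> = (\<Sum>(j,i)\<in>{(j,i). j + i \<le> n}. G i j (n - j - i))"
    by (rule sum.reindex_bij_witness[of _ "\<lambda>(a,b). (b,a)" "\<lambda>(a,b). (b,a)"]) (auto simp: add.commute)
  also have "\<dots> = (\<Sum>j\<le>n. \<Sum>i\<le>n - j. G i j (n - j - i))"
    unfolding sum.Sigma[OF finite_atMost ballI[OF finite_atMost]]
    by (intro sum.cong) auto
  finally show ?thesis .
qed

lemma pow_coeff_Suc': "pow_coeff e f (Suc k) n = (\<Sum>i\<le>n. pow_coeff e f k (n - i) * f i)"
  unfolding pow_coeff.simps by (rule sum.reindex_bij_witness[of _ "\<lambda>i. n - i" "\<lambda>i. n - i"]) auto

text \<open>The rule z (f^(k+1))' = (k+1) f^k z f' for commuting coefficients; multiplication by n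
  is the operator z d/dz.\<close>

lemma pow_coeff_deriv:
  assumes "\<And>i j. f i * f j = f j * f i" "\<And>i. e * f i = f i * e"
  shows "of_nat n *c pow_coeff e f (Suc k) n = of_nat (Suc k) *c (\<Sum>i\<le>n. of_nat i *c (pow_coeff e f k (n - i) * f i))"
proof (induction k arbitrary: n)
  case 0
  have "of_nat n *c (pow_coeff e f 0 (n - i) * f i) = of_nat i *c (pow_coeff e f 0 (n - i) * f i)" if "i \<le> n" for i
    using that by auto
  then have "(\<Sum>i\<le>n. of_nat n *c (pow_coeff e f 0 (n - i) * f i)) = (\<Sum>i\<le>n. of_nat i *c (pow_coeff e f 0 (n - i) * f i))"
    by (intro sum.cong refl) simp
  then show ?case unfolding pow_coeff_Suc' by (simp add: cs.scale_sum_right cs_one del: pow_coeff.simps)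
next
  case (Suc k)
  have c: "f i * pow_coeff e f k m = pow_coeff e f k m * f i" for i k m
    by (rule pow_coeff_comm[OF assms(2)[symmetric] assms(1)])
  have "of_nat n *c pow_coeff e f (Suc (Suc k)) n = (\<Sum>i\<le>n. of_nat i *c (pow_coeff e f (Suc k) (n - i) * f i))
     + (\<Sum>i\<le>n. (of_nat (n - i) *c pow_coeff e f (Suc k) (n - i)) * f i)"
    unfolding pow_coeff_Suc'[of e f "Suc k"] cs.scale_sum_right sum.distrib[symmetric]
    by (intro sum.cong refl) (simp add: mult_cs_left of_nat_diff flip: cs_add_left)
  also have "(\<Sum>i\<le>n. (of_nat (n - i) *c pow_coeff e f (Suc k) (n - i)) * f i) =
     of_nat (Suc k) *c (\<Sum>i\<le>n. \<Sum>j\<le>n - i. of_nat j *c (pow_coeff e f k (n - i - j) * f j * f i))"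
    unfolding Suc.IH by (simp add: cs.scale_sum_right sum_distrib_right mult_cs_left)
  also have "(\<Sum>i\<le>n. \<Sum>j\<le>n - i. of_nat j *c (pow_coeff e f k (n - i - j) * f j * f i)) =
     (\<Sum>j\<le>n. \<Sum>i\<le>n - j. of_nat j *c (pow_coeff e f k (n - j - i) * f j * f i))"
    by (rule sum_swap_conv[of "\<lambda>i j m. of_nat j *c (pow_coeff e f k m * f j * f i)"])
  also have "\<dots> = (\<Sum>j\<le>n. of_nat j *c (pow_coeff e f (Suc k) (n - j) * f j))"
    unfolding pow_coeff_Suc' by (simp add: cs.scale_sum_right sum_distrib_right mult.assoc assms(1))
  also have "R + of_nat (Suc k) *c R = of_nat (Suc (Suc k)) *c R" for R :: 'a
    by (simp only: of_nat_Suc[of "Suc k"] cs_add_left cs_one)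
  finally show ?case .
qed

lemma exp_coeff_0: "exp_coeff e f 0 = e"
  by (simp add: exp_coeff_def cs_one)

lemma exp_coeff_extend:
  assumes "f 0 = 0" "n \<le> N"
  shows "exp_coeff e f n = (\<Sum>k\<le>N. (1 / fact k) *c pow_coeff e f k n)"
  unfolding exp_coeff_def by (rule sum.mono_neutral_left) (use assms in \<open>auto simp: pow_coeff_zero\<close>)

text \<open>The differential equation z E' = z f' E. In characteristic zero it determines E from its
  constant term, which later replaces work with the powers of \<open>f\<close>.\<close>

lemma exp_coeff_deriv:
  assumes "\<And>i j. f i * f j = f j * f i" "\<And>i. e * f i = f i * e" "f 0 = 0"
  shows "of_nat n *c exp_coeff e f n = (\<Sum>i\<le>n. of_nat i *c (f i * exp_coeff e f (n - i)))"
proof (cases n)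
  case (Suc m)
  have c: "f i * pow_coeff e f k m = pow_coeff e f k m * f i" for i k m
    by (rule pow_coeff_comm[OF assms(2)[symmetric] assms(1)])
  have "of_nat n *c exp_coeff e f n = (\<Sum>k\<le>m. (1 / fact (Suc k)) *c (of_nat n *c pow_coeff e f (Suc k) n))"
    unfolding exp_coeff_def Suc by (subst sum.atMost_Suc_shift) (simp add: cs.scale_sum_right cs_cs mult_ac del: pow_coeff.simps(2))
  also have "\<dots> = (\<Sum>k\<le>m. \<Sum>i\<le>n. of_nat i *c (1 / fact k) *c (f i * pow_coeff e f k (n - i)))"
  proof (intro sum.cong refl)
    fix k
    have 1: "1 / fact (Suc k) * complex_of_nat (Suc k) = 1 / fact k" by (simp add: fact_Suc del: of_nat_Suc)
    show "(1 / fact (Suc k)) *c (of_nat n *c pow_coeff e f (Suc k) n) = (\<Sum>i\<le>n. of_nat i *c (1 / fact k) *c (f i * pow_coeff e f k (n - i)))"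
      unfolding pow_coeff_deriv[of f e, OF assms(1,2)] c cs_cs 1
      by (simp add: cs.scale_sum_right cs_cs mult_ac)
  qed
  also have "\<dots> = (\<Sum>i\<le>n. \<Sum>k\<le>m. of_nat i *c (1 / fact k) *c (f i * pow_coeff e f k (n - i)))"
    by (rule sum.swap)
  also have "\<dots> = (\<Sum>i\<le>n. of_nat i *c (f i * exp_coeff e f (n - i)))"
  proof (intro sum.cong refl)
    fix i assume "i \<in> {..n}"
    show "(\<Sum>k\<le>m. of_nat i *c (1 / fact k) *c (f i * pow_coeff e f k (n - i))) = of_nat i *c (f i * exp_coeff e f (n - i))"
    proof (cases "i = 0")
      case False
      \<comment> \<open>Each coefficient truncates its sum over k at its own index. For i > 0 all of
        them extend to the common bound m because \<open>f 0 = 0\<close>; i = 0 has weight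
        zero.\<close>
      then show ?thesis using Suc by (subst exp_coeff_extend[of f, OF assms(3), of _ m]) (auto simp: cs.scale_sum_right sum_distrib_left mult_cs_right)
    qed simp
  qed
  finally show ?thesis .
qed simp

lemma exp_coeff_1:
  assumes "f 0 = 0" "e * f 1 = f 1" shows "exp_coeff e f 1 = f 1"
  using assms by (simp add: exp_coeff_def cs_one)

lemma exp_coeff_in:
  assumes "\<And>x y. x \<in> F \<Longrightarrow> y \<in> F \<Longrightarrow> x + y \<in> F" "\<And>x y. x \<in> F \<Longrightarrow> y \<in> F \<Longrightarrow> x * y \<in> F" "0 \<in> F"
    "\<And>c x. x \<in> F \<Longrightarrow> c *c x \<in> F" "e \<in> F" "\<And>i. f i \<in> F"
  shows "exp_coeff e f n \<in> F"
proof -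
  have sum: "(\<And>i. i \<in> I \<Longrightarrow> h i \<in> F) \<Longrightarrow> sum h I \<in> F" for h and I :: "nat set"
    by (induction I rule: infinite_finite_induct) (auto intro: assms)
  have "pow_coeff e f k n \<in> F" for k n
    by (induction k arbitrary: n) (auto intro!: sum assms)
  then show ?thesis unfolding exp_coeff_def by (auto intro!: sum assms)
qed

text \<open>Both sides satisfy the recursion that \<open>exp_coeff_deriv\<close> gives for the exponential.\<close>

lemma exp_coeff_exchange:
  fixes x :: "int \<Rightarrow> 'a::typed_algebra"
  assumes "\<And>i j. f i * f j = f j * f i" "\<And>i. e * f i = f i * e" "f 0 = 0"
    and ex: "\<And>l. e * x l = x l" "\<And>l. x l * e = x l"
    and fx: "\<And>i l. of_nat i *c (f i * x l - x l * f i) = (s ^ i - t ^ i) *c x (l - int i)"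
  defines "E \<equiv> \<lambda>n. case n of 0 \<Rightarrow> 0 | Suc m \<Rightarrow> exp_coeff e f m"
  shows "E (Suc j) * x (l + 1) - s *c (E j * x l) = x (l + 1) * E (Suc j) - t *c (x l * E j)"
proof -
  define Y where "Y j l = E (Suc j) * x (l + 1) - s *c (E j * x l)" for j l
  define Y' where "Y' j l = x (l + 1) * E (Suc j) - t *c (x l * E j)" for j l
  have dE: "of_nat j *c E (Suc j) = (\<Sum>i\<le>j. of_nat i *c (f i * E (Suc j - i)))" for j
    unfolding E_def by (simp add: exp_coeff_deriv[of f e, OF assms(1-3)] Suc_diff_le)
  \<comment> \<open>\<open>E j\<close> is the exponential coefficient of index j - 1, so
    multiplication by j gives one extra summand.\<close>
  have dE': "of_nat j *c E j = E j + (\<Sum>i\<le>j. of_nat i *c (f i * E (j - i)))" for j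
  proof (cases j)
    case (Suc k)
    have "of_nat j *c E j = E j + of_nat k *c E (Suc k)" unfolding Suc by (simp add: cs_add_left cs_one)
    also have "of_nat k *c E (Suc k) = (\<Sum>i\<le>j. of_nat i *c (f i * E (j - i)))"
      unfolding dE Suc by (simp add: E_def)
    finally show ?thesis .
  qed (simp add: E_def)
  have "Y j l = Y' j l"
  proof (induction j arbitrary: l rule: less_induct)
    case (less j)
    show ?case
    proof (cases "j = 0")
      case True
      then show ?thesis by (simp add: Y_def Y'_def E_def exp_coeff_0 ex)
    next
      case False
      have 1: "of_nat j *c Y j l = (\<Sum>i\<le>j. of_nat i *c (f i * Y (j - i) l)) - s *c (E j * x l)"
      proof -
        have "of_nat j *c Y j l = (of_nat j *c E (Suc j)) * x (l + 1) - s *c ((of_nat j *c E j) * x l)"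
          by (simp add: Y_def cs_simps mult_ac)
        then show ?thesis unfolding dE dE' Y_def
          by (simp add: sum_distrib_right cs.scale_sum_right cs_simps algebra_simps sum_subtractf Suc_diff_le)
      qed
      have fx': "of_nat i *c (x l * (f i * z)) = of_nat i *c (f i * (x l * z)) - (s ^ i - t ^ i) *c (x (l - int i) * z)" for i l z
        using arg_cong[OF fx[of i l], of "\<lambda>y. y * z"] by (simp add: algebra_simps cs_simps)
      have 2: "of_nat j *c Y' j l = (\<Sum>i\<le>j. of_nat i *c (f i * Y' (j - i) l)) - (\<Sum>i\<le>j. (s ^ i - t ^ i) *c Y' (j - i) (l - int i)) - t *c (x l * E j)"
      proof -
        have "of_nat j *c Y' j l = x (l + 1) * (of_nat j *c E (Suc j)) - t *c (x l * (of_nat j *c E j))"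
          by (simp add: Y'_def cs_simps mult_ac)
        also have "\<dots> = (\<Sum>i\<le>j. of_nat i *c (x (l + 1) * (f i * E (Suc j - i)))) - t *c (\<Sum>i\<le>j. of_nat i *c (x l * (f i * E (j - i)))) - t *c (x l * E j)"
          unfolding dE dE' by (simp add: sum_distrib_left cs.scale_sum_right cs_simps algebra_simps)
        also have "\<dots> = (\<Sum>i\<le>j. of_nat i *c (f i * Y' (j - i) l) - (s ^ i - t ^ i) *c Y' (j - i) (l - int i)) - t *c (x l * E j)"
          unfolding fx' Y'_def by (simp add: cs.scale_sum_right cs_simps algebra_simps sum_subtractf Suc_diff_le sum.distrib)
        finally show ?thesis by (simp add: sum_subtractf)
      qed
      have tele: "(\<Sum>i=1..j. c ^ i *c (Q i - c *c Q (Suc i))) = c *c Q 1" if "Q (Suc j) = 0" for c :: complex and Q :: "nat \<Rightarrow> 'a"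
      proof -
        have "(\<Sum>i=1..m. c ^ i *c (Q i - c *c Q (Suc i))) = c *c Q 1 - c ^ Suc m *c Q (Suc m)" for m
          by (induction m) (simp_all add: cs_simps mult_ac)
        then show ?thesis using that by simp
      qed
      \<comment> \<open>Commuting f_i past x costs a sum of (s^i - t^i) Y'. The induction hypothesis
        replaces Y' by Y at the powers of s. Then the part in s telescopes by the form of Y and the
        part in t by that of Y'.\<close>
      have IH: "Y' (j - i) (l - int i) = Y (j - i) (l - int i)" if "i \<in> {1..j}" for i
        using less.IH[of "j - i"] that False by auto
      have "(\<Sum>i\<le>j. (s ^ i - t ^ i) *c Y' (j - i) (l - int i)) = (\<Sum>i=1..j. (s ^ i - t ^ i) *c Y' (j - i) (l - int i))"
        by (rule sum.mono_neutral_right) (auto simp: not_less_eq_eq)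
      also have "\<dots> = (\<Sum>i=1..j. s ^ i *c Y (j - i) (l - int i)) - (\<Sum>i=1..j. t ^ i *c Y' (j - i) (l - int i))"
        using IH by (simp add: cs.scale_left_diff_distrib sum_subtractf)
      also have "(\<Sum>i=1..j. s ^ i *c Y (j - i) (l - int i)) = s *c (E j * x l)"
      proof -
        have "(\<Sum>i=1..j. s ^ i *c Y (j - i) (l - int i)) = (\<Sum>i=1..j. s ^ i *c (E (Suc j - i) * x (l + 1 - int i) - s *c (E (Suc j - Suc i) * x (l + 1 - int (Suc i)))))"
          by (intro sum.cong refl) (auto simp: Y_def Suc_diff_le algebra_simps)
        then show ?thesis by (subst (asm) tele) (auto simp: E_def)
      qed
      also have "(\<Sum>i=1..j. t ^ i *c Y' (j - i) (l - int i)) = t *c (x l * E j)"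
      proof -
        have "(\<Sum>i=1..j. t ^ i *c Y' (j - i) (l - int i)) = (\<Sum>i=1..j. t ^ i *c (x (l + 1 - int i) * E (Suc j - i) - t *c (x (l + 1 - int (Suc i)) * E (Suc j - Suc i))))"
          by (intro sum.cong refl) (auto simp: Y'_def Suc_diff_le algebra_simps)
        then show ?thesis by (subst (asm) tele) (auto simp: E_def)
      qed
      finally have 3: "(\<Sum>i\<le>j. (s ^ i - t ^ i) *c Y' (j - i) (l - int i)) = s *c (E j * x l) - t *c (x l * E j)" .
      have "of_nat i *c (f i * Y (j - i) l) = of_nat i *c (f i * Y' (j - i) l)" if "i \<le> j" for i
        using less.IH[of "j - i" l] False by (cases "i = 0") auto
      then have "(\<Sum>i\<le>j. of_nat i *c (f i * Y (j - i) l)) = (\<Sum>i\<le>j. of_nat i *c (f i * Y' (j - i) l))"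
        by (intro sum.cong refl) simp
      then have "of_nat j *c Y j l = of_nat j *c Y' j l"
        unfolding 1 2 3 by simp
      then show ?thesis using False by (subst (asm) cs.scale_cancel_left) auto
    qed
  qed
  then show ?thesis unfolding Y_def Y'_def .
qed

section \<open>The quantum loop algebra\<close>

context complex_algebra begin

lemma twisted_comm_closed [simp, intro]: "a \<in> carrier A \<Longrightarrow> b \<in> carrier A \<Longrightarrow> twisted_comm A p a b \<in> carrier A"
  by (simp add: twisted_comm_def)

lemma series_pow_closed:
  assumes "\<And>n. f n \<in> carrier A"
  shows "(f [^]\<^bsub>series_monoid A\<^esub> (k::nat)) n \<in> carrier A"
proof (induction k arbitrary: n)
  case (Suc k)
  then show ?case using assms by (auto simp: series_monoid_def cauchy_prod_def intro!: finsum_closed)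
qed (simp add: series_monoid_def)

lemma series_exp_closed [intro]:
  assumes "\<And>n. f n \<in> carrier A"
  shows "series_exp A f n \<in> carrier A"
  unfolding series_exp_def using series_pow_closed[of f] assms by (auto intro!: finsum_closed)

end

locale typed_hom_on = complex_algebra A for A :: "(complex, 'a) module" (structure) +
  fixes \<rho> :: "'a \<Rightarrow> 'b::typed_algebra"
  assumes typed_hom: "typed_hom A \<rho>"
begin

lemma hom_add: "x \<in> carrier A \<Longrightarrow> y \<in> carrier A \<Longrightarrow> \<rho> (x \<oplus> y) = \<rho> x + \<rho> y"
  and hom_mult: "x \<in> carrier A \<Longrightarrow> y \<in> carrier A \<Longrightarrow> \<rho> (x \<otimes> y) = \<rho> x * \<rho> y"
  and hom_smult: "x \<in> carrier A \<Longrightarrow> \<rho> (c \<odot> x) = c *c \<rho> x"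
  using typed_hom by (auto simp: typed_hom_def)

lemma hom_zero: "\<rho> \<zero> = 0"
  using hom_add[of \<zero> \<zero>] by simp

lemma hom_minus: "x \<in> carrier A \<Longrightarrow> y \<in> carrier A \<Longrightarrow> \<rho> (x \<ominus> y) = \<rho> x - \<rho> y"
  and hom_uminus: "x \<in> carrier A \<Longrightarrow> \<rho> (\<ominus> x) = - \<rho> x"
proof -
  show *: "\<rho> (\<ominus> x) = - \<rho> x" if "x \<in> carrier A" for x
    using hom_add[of "\<ominus> x" x] that by (simp add: l_neg hom_zero eq_neg_iff_add_eq_0)
  show "x \<in> carrier A \<Longrightarrow> y \<in> carrier A \<Longrightarrow> \<rho> (x \<ominus> y) = \<rho> x - \<rho> y"
    by (simp add: a_minus_def hom_add *)
qed

lemma hom_finsum: "finite I \<Longrightarrow> (\<And>i. i \<in> I \<Longrightarrow> f i \<in> carrier A) \<Longrightarrow> \<rho> (\<Oplus>i\<in>I. f i) = (\<Sum>i\<in>I. \<rho> (f i))"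
  by (induction I rule: finite_induct) (auto simp: hom_zero finsum_insert hom_add Pi_def)

lemma hom_twisted_comm: "a \<in> carrier A \<Longrightarrow> b \<in> carrier A \<Longrightarrow>
   \<rho> (twisted_comm A p a b) = \<rho> a * \<rho> b - p *c (\<rho> b * \<rho> a)"
  by (simp add: twisted_comm_def hom_minus hom_mult hom_smult)

lemma hom_one: "x \<in> carrier A \<Longrightarrow> \<rho> \<one> * \<rho> x = \<rho> x" "x \<in> carrier A \<Longrightarrow> \<rho> x * \<rho> \<one> = \<rho> x"
  by (simp_all flip: hom_mult)

lemma hom_series_pow:
  assumes "\<And>n. f n \<in> carrier A"
  shows "\<rho> ((f [^]\<^bsub>series_monoid A\<^esub> (k::nat)) n) = pow_coeff (\<rho> \<one>) (\<lambda>i. \<rho> (f i)) k n"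
proof (induction k arbitrary: n)
  case (Suc k)
  have "\<rho> ((f [^]\<^bsub>series_monoid A\<^esub> Suc k) n) = (\<Sum>i\<le>n. \<rho> ((f [^]\<^bsub>series_monoid A\<^esub> k) i) * \<rho> (f (n - i)))"
    using assms series_pow_closed[of f k] by (simp add: series_monoid_def cauchy_prod_def hom_finsum hom_mult)
  then show ?case using Suc by simp
qed (simp add: series_monoid_def hom_zero)

lemma hom_series_exp:
  assumes "\<And>n. f n \<in> carrier A"
  shows "\<rho> (series_exp A f n) = exp_coeff (\<rho> \<one>) (\<lambda>i. \<rho> (f i)) n"
  unfolding series_exp_def exp_coeff_def using series_pow_closed[of f] assms
  by (simp add: hom_finsum hom_smult hom_series_pow)

end

section \<open>Images of the loop relations in a typed algebra\<close>

lemma loop_gens [simp]: "Xplus k \<in> loop_gens" "Xminus k \<in> loop_gens" "l \<noteq> 0 \<Longrightarrow> Hloop l \<in> loop_gens"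
  "Kgen \<in> loop_gens" "Kgen_inv \<in> loop_gens"
  by (auto simp: loop_gens_def)

interpretation LF: complex_algebra loop_free
  by (rule free_alg_complex_algebra)

lemma phi_closed: "phi_plus q k \<in> carrier loop_free" "phi_minus q k \<in> carrier loop_free"
  unfolding phi_plus_def phi_minus_def
  by (auto intro!: LF.series_exp_closed LF.m_closed LF.smult_closed free_gen_closed)

lemma loop_relators_closed: "loop_relators q \<subseteq> carrier loop_free"
  unfolding loop_relators_def Let_def
  by (auto intro!: LF.minus_closed LF.m_closed LF.smult_closed LF.twisted_comm_closed LF.one_closed free_gen_closed phi_closed)

text \<open>Formulated on the free algebra, because the relators and the elements
  \<open>phi_plus\<close>, \<open>phi_minus\<close> live there. The same locale applies to U and to
  either tensor factor.\<close>

locale loop_hom = typed_hom_on loop_free \<rho> for \<rho> :: "(loop_gen list \<Rightarrow>\<^sub>0 complex) \<Rightarrow> 'b::typed_algebra" +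
  fixes q :: complex
  assumes rel: "x \<in> loop_relators q \<Longrightarrow> \<rho> x = 0"
    and q0: "q \<noteq> 0" and qn: "\<And>n::nat. n \<ge> 1 \<Longrightarrow> q ^ n \<noteq> 1"
begin

definition "e = \<rho> \<one>\<^bsub>loop_free\<^esub>"
definition "K = \<rho> (free_gen Kgen)"
definition "K' = \<rho> (free_gen Kgen_inv)"
definition "xp k = \<rho> (free_gen (Xplus k))"
definition "xm k = \<rho> (free_gen (Xminus k))"
definition "hh k = \<rho> (free_gen (Hloop k))"
definition "g n = \<rho> (phi_plus q (int n))"
definition "f n = (case n of 0 \<Rightarrow> 0 | Suc m \<Rightarrow> \<rho> (phi_minus q (- int m)))"
definition "\<kappa> = q - inverse q"

lemma \<kappa>0: "\<kappa> \<noteq> 0"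
proof
  assume "\<kappa> = 0"
  then have "q ^ 2 = 1" using q0 by (simp add: \<kappa>_def field_simps power2_eq_square)
  then show False using qn[of 2] by simp
qed

lemma gen: "x \<in> loop_gens \<Longrightarrow> e * \<rho> (free_gen x) = \<rho> (free_gen x)" "x \<in> loop_gens \<Longrightarrow> \<rho> (free_gen x) * e = \<rho> (free_gen x)"
  unfolding e_def by (rule hom_one; rule free_gen_closed; simp)+

lemma e_gen: "e * K = K" "K * e = K" "e * K' = K'" "K' * e = K'" "e * xp k = xp k" "xp k * e = xp k" "e * xm k = xm k" "xm k * e = xm k"
   "l \<noteq> 0 \<Longrightarrow> e * hh l = hh l" "l \<noteq> 0 \<Longrightarrow> hh l * e = hh l" "e * e = e"
  unfolding K_def K'_def xp_def xm_def hh_def by (simp_all add: gen) (simp add: e_def hom_one)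

lemmas gen_closed = free_gen_closed[of _ loop_gens]
lemmas homs = hom_add hom_mult hom_smult hom_minus hom_twisted_comm gen_closed

lemma KK: "K * K' = e" "K' * K = e"
  using rel[of "free_gen Kgen \<otimes>\<^bsub>loop_free\<^esub> free_gen Kgen_inv \<ominus>\<^bsub>loop_free\<^esub> \<one>\<^bsub>loop_free\<^esub>"]
    rel[of "free_gen Kgen_inv \<otimes>\<^bsub>loop_free\<^esub> free_gen Kgen \<ominus>\<^bsub>loop_free\<^esub> \<one>\<^bsub>loop_free\<^esub>"]
  by (simp_all add: loop_relators_def Let_def homs K_def K'_def e_def)

lemma hh_comm:
  assumes "k \<noteq> 0" "l \<noteq> 0" shows "hh k * hh l = hh l * hh k"
proof -
  have "twisted_comm loop_free 1 (free_gen (Hloop k)) (free_gen (Hloop l)) \<in> loop_relators q"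
    unfolding loop_relators_def Let_def using assms by blast
  from rel[OF this] show ?thesis using assms by (simp add: homs hh_def cs_one)
qed

lemma K_hh:
  assumes "k \<noteq> 0" shows "K * hh k = hh k * K"
proof -
  have "free_gen Kgen \<otimes>\<^bsub>loop_free\<^esub> free_gen (Hloop k) \<ominus>\<^bsub>loop_free\<^esub> free_gen (Hloop k) \<otimes>\<^bsub>loop_free\<^esub> free_gen Kgen \<in> loop_relators q"
    unfolding loop_relators_def Let_def using assms by blast
  from rel[OF this] show ?thesis using assms by (simp add: homs hh_def K_def)
qed

lemma x_in_relators:
  assumes "(x = (\<lambda>k. free_gen (Xplus k)) \<and> d = 1) \<or> (x = (\<lambda>k. free_gen (Xminus k)) \<and> d = -1)"
  shows "free_gen Kgen \<otimes>\<^bsub>loop_free\<^esub> x k \<ominus>\<^bsub>loop_free\<^esub> (q powi (2 * d)) \<odot>\<^bsub>loop_free\<^esub> (x k \<otimes>\<^bsub>loop_free\<^esub> free_gen Kgen) \<in> loop_relators q" (is ?A)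
    and "k \<noteq> 0 \<Longrightarrow> twisted_comm loop_free 1 (free_gen (Hloop k)) (x l)
             \<ominus>\<^bsub>loop_free\<^esub> ((of_int d * (qint q (2 * k) / of_int k)) \<odot>\<^bsub>loop_free\<^esub> x (k + l)) \<in> loop_relators q" (is "PROP ?B")
    and "((x (k + 1) \<otimes>\<^bsub>loop_free\<^esub> x l) \<ominus>\<^bsub>loop_free\<^esub> ((q powi (2 * d)) \<odot>\<^bsub>loop_free\<^esub> (x l \<otimes>\<^bsub>loop_free\<^esub> x (k + 1))))
             \<ominus>\<^bsub>loop_free\<^esub> (((q powi (2 * d)) \<odot>\<^bsub>loop_free\<^esub> (x k \<otimes>\<^bsub>loop_free\<^esub> x (l + 1))) \<ominus>\<^bsub>loop_free\<^esub> (x (l + 1) \<otimes>\<^bsub>loop_free\<^esub> x k)) \<in> loop_relators q" (is ?C)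
proof -
  have p: "(x, d) \<in> {(\<lambda>k. free_gen (Xplus k), 1), (\<lambda>k. free_gen (Xminus k), - 1)}" using assms by auto
  show ?A "PROP ?B" ?C
    unfolding loop_relators_def Let_def
    by (rule UnI1, rule UnI2, rule UN_I[OF p], unfold prod.case, blast)+
qed

lemma xpm_in_relators:
   "twisted_comm loop_free 1 (free_gen (Xplus k)) (free_gen (Xminus l))
          \<ominus>\<^bsub>loop_free\<^esub> ((1 / (q - inverse q)) \<odot>\<^bsub>loop_free\<^esub> (phi_plus q (k + l) \<ominus>\<^bsub>loop_free\<^esub> phi_minus q (k + l))) \<in> loop_relators q"
  unfolding loop_relators_def Let_def by blast

lemma K_x: "K * xp k = q powi 2 *c (xp k * K)" "K * xm k = q powi (-2) *c (xm k * K)"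
  using rel[OF x_in_relators(1)[of "\<lambda>k. free_gen (Xplus k)" 1 k]] rel[OF x_in_relators(1)[of "\<lambda>k. free_gen (Xminus k)" "-1" k]]
  by (simp_all add: homs xp_def xm_def K_def)

lemma hh_x: assumes "k \<noteq> 0"
  shows "hh k * xp l - xp l * hh k = (qint q (2 * k) / of_int k) *c xp (k + l)"
   "hh k * xm l - xm l * hh k = - ((qint q (2 * k) / of_int k) *c xm (k + l))"
  using rel[OF x_in_relators(2)[of "\<lambda>k. free_gen (Xplus k)" 1 k l]] rel[OF x_in_relators(2)[of "\<lambda>k. free_gen (Xminus k)" "-1" k l]] assms
  by (simp_all add: homs xp_def xm_def hh_def cs_one eq_neg_iff_add_eq_0)

lemma xx: "xp (k + 1) * xp l - q powi 2 *c (xp l * xp (k + 1)) = q powi 2 *c (xp k * xp (l + 1)) - xp (l + 1) * xp k"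
  "xm (k + 1) * xm l - q powi (-2) *c (xm l * xm (k + 1)) = q powi (-2) *c (xm k * xm (l + 1)) - xm (l + 1) * xm k"
  using rel[OF x_in_relators(3)[of "\<lambda>k. free_gen (Xplus k)" 1 k l]] rel[OF x_in_relators(3)[of "\<lambda>k. free_gen (Xminus k)" "-1" k l]]
  by (simp_all add: homs xp_def xm_def)

lemma xpm: "\<kappa> *c (xp k * xm l - xm l * xp k) = \<rho> (phi_plus q (k + l)) - \<rho> (phi_minus q (k + l))"
proof -
  have "xp k * xm l - xm l * xp k = (1 / \<kappa>) *c (\<rho> (phi_plus q (k + l)) - \<rho> (phi_minus q (k + l)))"
    using rel[OF xpm_in_relators[of k l]]
    by (simp add: homs xp_def xm_def phi_closed cs_one \<kappa>_def)
  then show ?thesis using \<kappa>0 by (simp add: cs_cs cs_one)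
qed



section \<open>The exponential series phi^+ and phi^-\<close>

definition fp where "fp n = (if n = 0 then 0 else \<kappa> *c hh (int n))"
definition fm where "fm n = (if n = 0 then 0 else (- \<kappa>) *c hh (- int n))"

lemma phi_plus: "\<rho> (phi_plus q (int n)) = K * exp_coeff e fp n"
proof -
  have "\<rho> (phi_plus q (int n)) = K * exp_coeff e (\<lambda>i. \<rho> (if i = 0 then \<zero>\<^bsub>loop_free\<^esub>
            else (q - inverse q) \<odot>\<^bsub>loop_free\<^esub> free_gen (Hloop (int i)))) n"
    unfolding phi_plus_def K_def e_def
    by (simp, subst hom_mult) (auto simp: hom_series_exp gen_closed intro!: LF.series_exp_closed)
  also have "(\<lambda>i. \<rho> (if i = 0 then \<zero>\<^bsub>loop_free\<^esub> else (q - inverse q) \<odot>\<^bsub>loop_free\<^esub> free_gen (Hloop (int i)))) = fp"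
    by (auto simp: fp_def hom_zero homs hh_def \<kappa>_def)
  finally show ?thesis .
qed

lemma phi_minus: "\<rho> (phi_minus q (- int n)) = K' * exp_coeff e fm n"
proof -
  have "\<rho> (phi_minus q (- int n)) = K' * exp_coeff e (\<lambda>i. \<rho> (if i = 0 then \<zero>\<^bsub>loop_free\<^esub>
            else (- (q - inverse q)) \<odot>\<^bsub>loop_free\<^esub> free_gen (Hloop (- int i)))) n"
    unfolding phi_minus_def K'_def e_def
    by (simp, subst hom_mult) (auto simp: hom_series_exp gen_closed intro!: LF.series_exp_closed)
  also have "(\<lambda>i. \<rho> (if i = 0 then \<zero>\<^bsub>loop_free\<^esub> else (- (q - inverse q)) \<odot>\<^bsub>loop_free\<^esub> free_gen (Hloop (- int i)))) = fm"
    by (auto simp: fm_def hom_zero homs hh_def \<kappa>_def)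
  finally show ?thesis .
qed

lemma phi_zero: "k < 0 \<Longrightarrow> \<rho> (phi_plus q k) = 0" "k > 0 \<Longrightarrow> \<rho> (phi_minus q k) = 0"
  by (simp_all add: phi_plus_def phi_minus_def hom_zero)

lemma K'_hh: assumes "k \<noteq> 0" shows "K' * hh k = hh k * K'"
proof -
  have "K' * hh k = K' * (hh k * (K * K'))" using assms by (simp add: KK e_gen)
  also have "\<dots> = K' * (hh k * K) * K'" by (simp only: mult.assoc)
  also have "\<dots> = K' * (K * hh k) * K'" by (simp only: K_hh[OF assms])
  also have "\<dots> = hh k * K'" using assms by (simp add: e_gen KK flip: mult.assoc)
  finally show ?thesis .
qed

lemma f_comms: "K * fp i = fp i * K" "K' * fp i = fp i * K'" "K * fm i = fm i * K" "K' * fm i = fm i * K'"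
  "fp i * fp j = fp j * fp i" "fm i * fm j = fm j * fm i" "fp i * fm j = fm j * fp i"
  "e * fp i = fp i" "fp i * e = fp i" "e * fm i = fm i" "fm i * e = fm i"
  by (simp_all add: fp_def fm_def cs_simps K_hh K'_hh hh_comm e_gen mult.commute)

definition "Ep n = exp_coeff e fp n"
definition "Em n = exp_coeff e fm n"

lemma Ep_comm: "x * e = e * x \<Longrightarrow> (\<And>i. x * fp i = fp i * x) \<Longrightarrow> x * Ep n = Ep n * x"
  unfolding Ep_def by (rule exp_coeff_comm)
lemma Em_comm: "x * e = e * x \<Longrightarrow> (\<And>i. x * fm i = fm i * x) \<Longrightarrow> x * Em n = Em n * x"
  unfolding Em_def by (rule exp_coeff_comm)

lemma E_comms: "K * Ep n = Ep n * K" "K' * Ep n = Ep n * K'" "K * Em n = Em n * K" "K' * Em n = Em n * K'"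
  by (rule Ep_comm Em_comm; simp add: e_gen f_comms)+

lemma EE_comm: "Ep n * Em m = Em m * Ep n" "Em n * Em m = Em m * Em n"
proof -
  have 1: "fm i * Ep n = Ep n * fm i" for i n by (rule Ep_comm) (simp_all add: f_comms)
  have e: "Ep n * e = e * Ep n" "Em n * e = e * Em n" for n by (rule Ep_comm[symmetric] Em_comm[symmetric]; simp add: f_comms)+
  show "Ep n * Em m = Em m * Ep n" by (rule Em_comm) (simp_all add: e 1)
  have 2: "fm i * Em n = Em n * fm i" for i n by (rule Em_comm) (simp_all add: f_comms)
  show "Em n * Em m = Em m * Em n" by (rule Em_comm) (simp_all add: e 2)
qed

lemma g_eq: "g n = K * Ep n"
  by (simp add: g_def phi_plus Ep_def)
lemma f_eq: "f n = K' * (case n of 0 \<Rightarrow> 0 | Suc m \<Rightarrow> Em m)"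
  by (auto simp: f_def phi_minus Em_def split: nat.split)

lemma qint_eq: "\<kappa> * qint q k = q powi k - q powi (- k)"
  using \<kappa>0 by (simp add: qint_def \<kappa>_def)

lemma powi_2: "q powi (2 * int i) = (q\<^sup>2) ^ i" "q powi (- (2 * int i)) = (q powi (-2)) ^ i"
proof -
  have "(2 * int i) = int (2 * i)" by simp
  then show "q powi (2 * int i) = (q\<^sup>2) ^ i" by (simp only: power_int_of_nat power_mult)
  then show "q powi (- (2 * int i)) = (q powi (-2)) ^ i" by (simp add: power_int_minus power_inverse)
qed

text \<open>The hypothesis of \<open>exp_coeff_exchange\<close>: the denominator i in the bracket
  with h_(-i) and the denominator of the q-integer cancel, leaving a difference of two i-th powers.
  For x^- their roles are exchanged.\<close>

lemma fm_x: "of_nat i *c (fm i * xp l - xp l * fm i) = ((q powi (-2)) ^ i - (q\<^sup>2) ^ i) *c xp (l - int i)"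
  "of_nat i *c (fm i * xm l - xm l * fm i) = ((q\<^sup>2) ^ i - (q powi (-2)) ^ i) *c xm (l - int i)"
proof -
  have 1: "of_nat i * (- \<kappa> * (qint q (2 * - int i) / of_int (- int i))) = (q powi (-2)) ^ i - (q\<^sup>2) ^ i" if "i \<noteq> 0"
  proof -
    have "of_nat i * (- \<kappa> * (qint q (2 * - int i) / of_int (- int i))) = \<kappa> * qint q (- (2 * int i))"
      using that by simp
    then show ?thesis unfolding qint_eq by (simp add: powi_2)
  qed
  have "of_nat i *c (fm i * xp l - xp l * fm i) = (of_nat i * - \<kappa>) *c (hh (- int i) * xp l - xp l * hh (- int i))" if "i \<noteq> 0"
    using that by (simp add: fm_def cs_simps)
  then show "of_nat i *c (fm i * xp l - xp l * fm i) = ((q powi (-2)) ^ i - (q\<^sup>2) ^ i) *c xp (l - int i)"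
    using hh_x(1)[of "- int i" l] 1[symmetric] by (cases "i = 0") (simp_all add: cs_cs mult_ac)
  have "of_nat i *c (fm i * xm l - xm l * fm i) = (of_nat i * - \<kappa>) *c (hh (- int i) * xm l - xm l * hh (- int i))" if "i \<noteq> 0"
    using that by (simp add: fm_def cs_simps)
  moreover have "((q\<^sup>2) ^ i - (q powi (-2)) ^ i) *c z = - (((q powi (-2)) ^ i - (q\<^sup>2) ^ i) *c z)" for z :: 'b
    by (simp flip: cs.scale_minus_left)
  ultimately show "of_nat i *c (fm i * xm l - xm l * fm i) = ((q\<^sup>2) ^ i - (q powi (-2)) ^ i) *c xm (l - int i)"
    using hh_x(2)[of "- int i" l] 1[symmetric] by (cases "i = 0") (simp_all add: cs_cs mult_ac)
qed

lemma xK: "xp k * K = q powi (-2) *c (K * xp k)" "xp k * K' = q\<^sup>2 *c (K' * xp k)"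
  "xm k * K = q\<^sup>2 *c (K * xm k)" "xm k * K' = q powi (-2) *c (K' * xm k)"
proof -
  have s: "q powi (-2) * q\<^sup>2 = 1" using q0 by (simp add: power_int_minus)
  show 1: "xp k * K = q powi (-2) *c (K * xp k)" and 2: "xm k * K = q\<^sup>2 *c (K * xm k)"
    using K_x[of k] s by (simp_all add: cs_cs cs_one mult.commute)
  have "K' * xp k = K' * (xp k * K) * K'" by (simp add: mult.assoc KK e_gen)
  also have "\<dots> = q powi (-2) *c ((K' * K) * xp k * K')" unfolding 1 by (simp add: mult_cs_left mult_cs_right mult.assoc)
  finally show "xp k * K' = q\<^sup>2 *c (K' * xp k)" using s by (simp add: KK e_gen cs_cs cs_one mult.commute)
  have "K' * xm k = K' * (xm k * K) * K'" by (simp add: mult.assoc KK e_gen)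
  also have "\<dots> = q\<^sup>2 *c ((K' * K) * xm k * K')" unfolding 2 by (simp add: mult_cs_left mult_cs_right mult.assoc)
  finally show "xm k * K' = q powi (-2) *c (K' * xm k)" using s by (simp add: KK e_gen cs_cs cs_one)
qed

text \<open>The exponential alone has coefficient 1 at the first term of both sides; moving x past
  \<open>K'\<close> rescales the right side by q^2 or q^-2.\<close>

lemma f_x: "f (Suc n) * xp (k + 1) - q powi (-2) *c (f n * xp k) = q powi (-2) *c (xp (k + 1) * f (Suc n)) - xp k * f n"
  "f (Suc n) * xm (k + 1) - q\<^sup>2 *c (f n * xm k) = q\<^sup>2 *c (xm (k + 1) * f (Suc n)) - xm k * f n"
proof -
  have s: "q powi (-2) * q\<^sup>2 = 1" "q\<^sup>2 * q powi (-2) = 1" using q0 by (simp_all add: power_int_minus)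
  define E where "E n = (case n of 0 \<Rightarrow> 0 | Suc m \<Rightarrow> exp_coeff e fm m)" for n
  have f: "f n = K' * E n" for n by (auto simp: f_eq E_def Em_def split: nat.split)
  have xK': "xp k * (K' * z) = q\<^sup>2 *c (K' * (xp k * z))" "xm k * (K' * z) = q powi (-2) *c (K' * (xm k * z))" for k z
    using arg_cong[OF xK(2)[of k], of "\<lambda>y. y * z"] arg_cong[OF xK(4)[of k], of "\<lambda>y. y * z"] by (simp_all add: mult.assoc mult_cs_left)
  have 1: "E (Suc n) * xp (k + 1) - q powi (-2) *c (E n * xp k) = xp (k + 1) * E (Suc n) - q\<^sup>2 *c (xp k * E n)"
    unfolding E_def by (rule exp_coeff_exchange) (simp_all add: f_comms e_gen fm_x, simp add: fm_def)
  have 2: "E (Suc n) * xm (k + 1) - q\<^sup>2 *c (E n * xm k) = xm (k + 1) * E (Suc n) - q powi (-2) *c (xm k * E n)"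
    unfolding E_def by (rule exp_coeff_exchange) (simp_all add: f_comms e_gen fm_x, simp add: fm_def)
  have "f (Suc n) * xp (k + 1) - q powi (-2) *c (f n * xp k) = K' * (E (Suc n) * xp (k + 1) - q powi (-2) *c (E n * xp k))"
    by (simp add: f mult.assoc right_diff_distrib mult_cs_right)
  also have "\<dots> = q powi (-2) *c (xp (k + 1) * f (Suc n)) - xp k * f n"
    unfolding 1 by (simp add: f xK' right_diff_distrib mult_cs_right cs_cs s cs_one)
  finally show "f (Suc n) * xp (k + 1) - q powi (-2) *c (f n * xp k) = q powi (-2) *c (xp (k + 1) * f (Suc n)) - xp k * f n" .
  have "f (Suc n) * xm (k + 1) - q\<^sup>2 *c (f n * xm k) = K' * (E (Suc n) * xm (k + 1) - q\<^sup>2 *c (E n * xm k))"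
    by (simp add: f mult.assoc right_diff_distrib mult_cs_right)
  also have "\<dots> = q\<^sup>2 *c (xm (k + 1) * f (Suc n)) - xm k * f n"
    unfolding 2 by (simp add: f xK' right_diff_distrib mult_cs_right cs_cs s cs_one)
  finally show "f (Suc n) * xm (k + 1) - q\<^sup>2 *c (f n * xm k) = q\<^sup>2 *c (xm (k + 1) * f (Suc n)) - xm k * f n" .
qed

text \<open>The combination of h_1 and h_(-1) is forced by \<open>h_def\<close>:
  \<open>K' * g 1\<close> is \<open>\<kappa>\<close> times h_1 and \<open>f 2 * K\<close> is
  -\<open>\<kappa>\<close> times h_(-1).\<close>

theorem loop_sys:
  fixes C :: complex
  assumes "C \<noteq> 0" and "filtration F" and F_gens: "\<And>w. w \<in> loop_gens \<Longrightarrow> \<rho> (free_gen w) \<in> F (loop_deg w)"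
  shows "loop_sys F q C e K K' (C *c hh 1 - hh (-1)) xp xm f g"
proof -
  interpret filtration F by fact
  show ?thesis
proof
  have b2: "qint q 2 = q + inverse q"
  proof -
    have "\<kappa> * qint q 2 = \<kappa> * (q + inverse q)" unfolding qint_eq using q0
      by (simp add: \<kappa>_def power_int_minus field_simps power2_eq_square)
    then show ?thesis using \<kappa>0 by simp
  qed
  have "\<kappa> * qint q (-2) = - (\<kappa> * qint q 2)" unfolding qint_eq by simp
  then have b2': "qint q (-2) = - (q + inverse q)" using \<kappa>0 b2 by (metis mult_cancel_left mult_minus_right)
  show "q ^ 4 \<noteq> 1" "q \<noteq> 0" "C \<noteq> 0" using qn[of 4] q0 assms(1) by auto
  show "K * K' = e" "K' * K = e" by (rule KK)+
  show "xp k * K = q powi (-2) *c (K * xp k)" "xp k * K' = q\<^sup>2 *c (K' * xp k)"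
  "xm k * K = q\<^sup>2 *c (K * xm k)" "xm k * K' = q powi (-2) *c (K' * xm k)" for k by (rule xK)+
  show "e * xp k = xp k" "e * xm k = xm k" for k by (rule e_gen)+
  show "e * f n = f n" "e * g n = g n" for n by (simp_all add: f_eq g_eq e_gen flip: mult.assoc)
  show "(C *c hh 1 - hh (-1)) * xp k - xp k * (C *c hh 1 - hh (-1)) = (q + inverse q) *c (C *c xp (k + 1) - xp (k - 1))" for k
  proof -
    have "(C *c hh 1 - hh (-1)) * xp k - xp k * (C *c hh 1 - hh (-1)) = C *c (hh 1 * xp k - xp k * hh 1) - (hh (-1) * xp k - xp k * hh (-1))"
      by (simp add: algebra_simps cs_simps)
    then show ?thesis using hh_x(1)[of 1 k] hh_x(1)[of "-1" k] by (simp add: b2 b2' cs_simps add.commute mult.commute)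
  qed
  show "(C *c hh 1 - hh (-1)) * xm k - xm k * (C *c hh 1 - hh (-1)) = (q + inverse q) *c (xm (k - 1) - C *c xm (k + 1))" for k
  proof -
    have "(C *c hh 1 - hh (-1)) * xm k - xm k * (C *c hh 1 - hh (-1)) = C *c (hh 1 * xm k - xm k * hh 1) - (hh (-1) * xm k - xm k * hh (-1))"
      by (simp add: algebra_simps cs_simps)
    then show ?thesis using hh_x(2)[of 1 k] hh_x(2)[of "-1" k] by (simp add: b2 b2' cs_simps add.commute mult.commute)
  qed
  show "f n * (C *c hh 1 - hh (-1)) = (C *c hh 1 - hh (-1)) * f n" for n
  proof -
    have "hh k * Em m = Em m * hh k" if "k \<noteq> 0" for k m
      by (rule Em_comm) (use that in \<open>simp_all add: e_gen fm_def cs_simps hh_comm\<close>)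
    then have "f n * hh k = hh k * f n" if "k \<noteq> 0" for k using that comm2[of "hh k" K']
      by (simp add: f_eq mult.assoc K'_hh split: nat.split)
    then show ?thesis by (simp add: algebra_simps cs_simps)
  qed
  show f0: "f 0 = 0" by (simp add: f_def)
  show f1: "f 1 = K'" by (simp add: f_eq Em_def exp_coeff_0 e_gen)
  show "g 0 = K" by (simp add: g_eq Ep_def exp_coeff_0 e_gen)
  have E1: "Ep 1 = \<kappa> *c hh 1" "Em 1 = (-\<kappa>) *c hh (-1)"
    using exp_coeff_1[of fp e] exp_coeff_1[of fm e] by (simp_all add: Ep_def Em_def f_comms) (simp_all add: fp_def fm_def)
  show "(q - inverse q) *c (C *c hh 1 - hh (-1)) = C *c (K' * g 1) + f 2 * K"
  proof -
    have "K' * g 1 = \<kappa> *c hh 1" unfolding g_eq E1 by (simp add: KK e_gen mult_cs_right flip: mult.assoc)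
    moreover have "f 2 * K = (-\<kappa>) *c hh (-1)"
    proof -
      have "f 2 * K = K' * Em 1 * K" by (simp add: f_eq numeral_2_eq_2)
      also have "\<dots> = K' * K * Em 1" by (simp only: mult.assoc E_comms(3))
      finally show ?thesis unfolding E1 by (simp add: KK e_gen mult_cs_right)
    qed
    ultimately show ?thesis unfolding \<kappa>_def[symmetric]
      by (simp add: cs_simps mult.commute)
  qed
  show "f n * g m = g m * f n" for m n
  proof (cases n)
    case (Suc k)
    have "K' * Em k * (K * Ep m) = K * Ep m * (K' * Em k)"
    proof -
      have "K' * Em k * (K * Ep m) = K' * (Em k * K) * Ep m" by (simp only: mult.assoc)
      also have "\<dots> = (K' * K) * (Em k * Ep m)" unfolding E_comms(3)[symmetric] by (simp only: mult.assoc)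
      also have "\<dots> = (K * K') * (Ep m * Em k)" by (simp only: KK EE_comm)
      also have "\<dots> = K * (K' * Ep m) * Em k" by (simp only: mult.assoc)
      also have "\<dots> = K * Ep m * (K' * Em k)" by (simp only: mult.assoc E_comms(2))
      finally show ?thesis .
    qed
    then show ?thesis by (simp add: f_eq g_eq Suc)
  qed (simp add: f_eq)
  show "f n * f m = f m * f n" for m n
  proof (cases "n = 0 \<or> m = 0")
    case True then show ?thesis by (auto simp: f_eq)
  next
    case False
    then obtain k l where kl: "n = Suc k" "m = Suc l" by (auto simp: gr0_conv_Suc)
    have "K' * Em k * (K' * Em l) = K' * (Em k * K') * Em l" for k l by (simp only: mult.assoc)
    then have "K' * Em k * (K' * Em l) = K' * K' * (Em k * Em l)" for k l
      unfolding E_comms(4)[symmetric] by (simp only: mult.assoc)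
    then show ?thesis unfolding kl f_eq by (simp add: EE_comm(2)[of k l])
  qed
  show "f (Suc n) * xp (k + 1) - q powi (-2) *c (f n * xp k) = q powi (-2) *c (xp (k + 1) * f (Suc n)) - xp k * f n"
   "f (Suc n) * xm (k + 1) - q\<^sup>2 *c (f n * xm k) = q\<^sup>2 *c (xm (k + 1) * f (Suc n)) - xm k * f n" for n k
    by (rule f_x)+
  show "(q - inverse q) *c (xp k * xm l - xm l * xp k) = g (nat (k + l))" if "k + l > 0" for k l
    using xpm[of k l] that by (simp add: phi_zero g_def \<kappa>_def)
  show "(q - inverse q) *c (xp k * xm l - xm l * xp k) = K - K'" if "k + l = 0" for k l
    using xpm[of k l] that phi_plus[of 0] phi_minus[of 0] by (simp add: \<kappa>_def exp_coeff_0 e_gen)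
  show "(q - inverse q) *c (xp k * xm l - xm l * xp k) = - f (Suc (nat (- (k + l))))" if "k + l < 0" for k l
    using xpm[of k l] that by (simp add: phi_zero f_def \<kappa>_def add.commute)
  show "xp 0 * xp (-1) = q\<^sup>2 *c (xp (-1) * xp 0)"
    using xx(1)[of "-1" "-1"] by - (rule cs_double, simp add: algebra_simps)
  show "xm (k + 1) * xm l - q powi (-2) *c (xm l * xm (k + 1)) = q powi (-2) *c (xm k * xm (l + 1)) - xm (l + 1) * xm k" for k l
    by (rule xx)
  show xF: "xp k \<in> F 1" "xm k \<in> F (-1)" for k using F_gens[of "Xplus k"] F_gens[of "Xminus k"] by (simp_all add: xp_def xm_def)
  show KF: "K \<in> F 0" using F_gens[of Kgen] by (simp add: K_def)
  have K'F: "K' \<in> F 0" using F_gens[of Kgen_inv] by (simp add: K'_def)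
  have hF: "hh k \<in> F 0" if "k \<noteq> 0" for k using F_gens[of "Hloop k"] that by (simp add: hh_def)
  have F0: "x * y \<in> F 0" if "x \<in> F 0" "y \<in> F 0" for x y using F_mult[OF that] by simp
  have fF: "fp i \<in> F 0" "fm i \<in> F 0" for i
    unfolding fp_def fm_def by (auto intro!: F_zero F_cs hF simp del: cs.scale_minus_left)
  have eF: "e \<in> F 0" using F0[OF KF K'F] by (simp add: KK)
  have EF: "Ep n \<in> F 0" "Em n \<in> F 0" for n unfolding Ep_def Em_def
    using exp_coeff_in[of "F 0" e fp] exp_coeff_in[of "F 0" e fm] F_add F_zero F_cs F0 eF fF by blast+
  show "g n \<in> F 0" "f n \<in> F 0" for n unfolding g_eq f_eq by (auto intro!: F0 KF K'F EF F_zero split: nat.split)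
  have "(-1) *c hh (-1) \<in> F 0" by (rule F_cs) (simp add: hF)
  then show "C *c hh 1 - hh (-1) \<in> F 0" using F_add[OF F_cs[OF hF[of 1], of C], of "(-1) *c hh (-1)"] by (simp add: cs_one)
qed
qed

end

section \<open>From \<open>\<Gamma>\<close> to the grave series\<close>

context coideal_sys begin

text \<open>The coefficient of z^n in phi^-(1/z) phi^+(C z).\<close>

definition "\<Phi> n = (\<Sum>j\<le>n. C ^ j *c (f (Suc (n - j)) * g j))"
definition "grave v b n = (\<Sum>i\<le>n. v i *c b (int (n - i)))" for v :: "nat \<Rightarrow> complex" and b :: "int \<Rightarrow> 'a"

lemma conv_sum: "conv b i n = (\<Sum>t<n. b (i + int t) * f (n - t))"
proof (induction n arbitrary: i)
  case (Suc n)
  show ?case unfolding conv.simps Suc.IH sum.lessThan_Suc_shift by (simp add: add.assoc)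
qed simp

lemma \<Omega>_sum: "\<Omega> b n = (\<Sum>t\<le>n. b (int t) * \<Phi> (n - t))"
proof -
  have "\<Omega> b n = (\<Sum>j\<le>n. \<Sum>t\<le>n - j. C ^ j *c (b (int t) * f (Suc (n - j - t)) * g j))"
    unfolding \<Omega>_def
  proof (intro sum.cong refl)
    fix j assume "j \<in> {..n}"
    then have "Suc n - j = Suc (n - j)" by auto
    then have "conv b 0 (Suc n - j) = (\<Sum>t\<le>n - j. b (int t) * f (Suc (n - j - t)))"
      unfolding conv_sum lessThan_Suc_atMost by (intro sum.cong) (auto simp: Suc_diff_le)
    then show "C ^ j *c (conv b 0 (Suc n - j) * g j) = (\<Sum>t\<le>n - j. C ^ j *c (b (int t) * f (Suc (n - j - t)) * g j))"
      by (simp add: sum_distrib_right cs.scale_sum_right)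
  qed
  also have "\<dots> = (\<Sum>t\<le>n. \<Sum>j\<le>n - t. C ^ j *c (b (int t) * f (Suc (n - t - j)) * g j))"
    by (rule sum_swap_conv[of "\<lambda>j t m. C ^ j *c (b (int t) * f (Suc m) * g j)"])
  also have "\<dots> = (\<Sum>t\<le>n. b (int t) * \<Phi> (n - t))"
    unfolding \<Phi>_def by (simp add: sum_distrib_left mult_cs_right mult.assoc)
  finally show ?thesis .
qed

text \<open>Multiplication by the scalar series \<open>v\<close> commutes with convolution by
  \<open>\<Phi>\<close>, so \<open>\<Gamma>'_approx\<close> carries over termwise.\<close>

theorem grave_approx: "grave v \<Gamma>' n - (\<Sum>t\<le>n. grave v \<Gamma> t * \<Phi> (n - t)) \<in> F 1"
proof -
  have "(\<Sum>t\<le>n. grave v \<Gamma> t * \<Phi> (n - t)) = (\<Sum>k\<le>n. \<Sum>i\<le>k. v i *c (\<Gamma> (int (k - i)) * \<Phi> (n - i - (k - i))))"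
    unfolding grave_def by (simp add: sum_distrib_right mult_cs_left)
  also have "\<dots> = (\<Sum>(i,t)\<in>{(i,t). i + t \<le> n}. v i *c (\<Gamma> (int t) * \<Phi> (n - i - t)))"
    by (rule sum.triangle_reindex_eq[of "\<lambda>i t. v i *c (\<Gamma> (int t) * \<Phi> (n - i - t))" n, symmetric])
  also have "\<dots> = (\<Sum>i\<le>n. \<Sum>t\<le>n - i. v i *c (\<Gamma> (int t) * \<Phi> (n - i - t)))"
    unfolding sum.Sigma[OF finite_atMost ballI[OF finite_atMost]] by (intro sum.cong) auto
  also have "\<dots> = (\<Sum>i\<le>n. v i *c \<Omega> \<Gamma> (n - i))"
    unfolding \<Omega>_sum by (simp add: cs.scale_sum_right)
  finally have "grave v \<Gamma>' n - (\<Sum>t\<le>n. grave v \<Gamma> t * \<Phi> (n - t)) = (\<Sum>i\<le>n. v i *c (\<Gamma>' (int (n - i)) - \<Omega> \<Gamma> (n - i)))"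
    unfolding grave_def by (simp add: sum_subtractf cs.scale_right_diff_distrib)
  then show ?thesis by (simp only:) (intro F_sum F_cs \<Gamma>'_approx)
qed

end

section \<open>The q-Onsager algebra\<close>

lemma onsager_gens [simp]: "Aons r \<in> onsager_gens" "m \<ge> 1 \<Longrightarrow> Hons m \<in> onsager_gens"
  by (auto simp: onsager_gens_def)

interpretation OF: complex_algebra onsager_free
  by (rule free_alg_complex_algebra)

text \<open>\<open>theta\<close> ignores the value of its argument at 0, which is not a generator for \<open>Hons\<close>.\<close>

lemma (in complex_algebra) theta_closed: "(\<And>m. m \<ge> 1 \<Longrightarrow> H m \<in> carrier A) \<Longrightarrow> theta A q H n \<in> carrier A"
  unfolding theta_def by (auto intro!: smult_closed series_exp_closed)

lemma onsager_relators_closed: "onsager_relators q c0 c1 \<subseteq> carrier onsager_free"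
  unfolding onsager_relators_def Let_def
  by (auto intro!: OF.minus_closed OF.m_closed OF.a_closed OF.smult_closed OF.twisted_comm_closed free_gen_closed OF.theta_closed)

lemma onsager_complex_algebra: "complex_algebra (onsager_alg q c0 c1)"
  and onsager_class: "alg_class onsager_free (onsager_relators q c0 c1) \<in> alg_hom onsager_free (onsager_alg q c0 c1)"
  and onsager_class_zero: "x \<in> onsager_relators q c0 c1 \<Longrightarrow> alg_class onsager_free (onsager_relators q c0 c1) x = \<zero>\<^bsub>onsager_alg q c0 c1\<^esub>"
  unfolding onsager_alg_def using OF.quot[OF onsager_relators_closed] by auto

lemma onsager_elt_closed: "w \<in> onsager_gens \<Longrightarrow> onsager_elt q c0 c1 w \<in> carrier (onsager_alg q c0 c1)"
  unfolding onsager_elt_def by (intro alg_homD(1)[OF onsager_class] free_gen_closed)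

definition theta_coeff :: "'a::typed_algebra \<Rightarrow> complex \<Rightarrow> (nat \<Rightarrow> 'a) \<Rightarrow> int \<Rightarrow> 'a" where
  "theta_coeff e q H n = (if n < 0 then 0 else (1 / (q - inverse q)) *c exp_coeff e (\<lambda>i. if i = 0 then 0 else (q - inverse q) *c H i) (nat n))"

lemma (in typed_hom_on) hom_theta:
  assumes "\<And>m. m \<ge> 1 \<Longrightarrow> H m \<in> carrier A"
  shows "\<rho> (theta A q H n) = theta_coeff (\<rho> \<one>) q (\<lambda>m. \<rho> (H m)) n"
proof -
  have "(\<lambda>i. \<rho> (if i = 0 then \<zero> else (q - inverse q) \<odot> H i)) = (\<lambda>i. if i = 0 then 0 else (q - inverse q) *c \<rho> (H i))"
    using assms by (auto simp: hom_zero hom_smult)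
  then show ?thesis using assms unfolding theta_def theta_coeff_def
    by (auto simp: hom_zero intro!: hom_smult[THEN trans] series_exp_closed smult_closed)
       (subst hom_series_exp, auto)
qed

lemma typed_hom_comp:
  assumes "f \<in> alg_hom A B" "typed_hom B \<rho>" shows "typed_hom A (\<lambda>x. \<rho> (f x))"
  using alg_homD[OF assms(1)] assms(2) by (simp add: typed_hom_def)

locale onsager_hom = typed_hom_on "onsager_alg q c0 c1" \<tau> for q c0 c1 and \<tau> :: "(onsager_gen list \<Rightarrow>\<^sub>0 complex) set \<Rightarrow> 'b::typed_algebra" +
  assumes q0: "q \<noteq> 0" and q2: "q ^ 2 \<noteq> 1" and c0: "c0 \<noteq> 0" and c1: "c1 \<noteq> 0"
begin

definition "C = onsager_C q c0 c1"
definition "cl = alg_class onsager_free (onsager_relators q c0 c1)"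
definition "e = \<tau> \<one>\<^bsub>onsager_alg q c0 c1\<^esub>"
definition "a r = \<tau> (onsager_elt q c0 c1 (Aons r))"
definition "H m = \<tau> (onsager_elt q c0 c1 (Hons m))"
definition "\<Theta> n = \<tau> (onsager_theta q c0 c1 n)"
definition "\<Gamma> n = \<Theta> n - (q powi (-2) * C) *c \<Theta> (n - 2)"

lemma \<kappa>0: "q - inverse q \<noteq> 0"
  using q0 q2 by (auto simp: field_simps power2_eq_square)

lemma \<Theta>_eq: "\<Theta> n = theta_coeff e q H n"
  unfolding \<Theta>_def onsager_theta_def e_def H_def
  by (rule hom_theta) (simp add: onsager_elt_closed)

lemma C0: "C \<noteq> 0" using q0 c0 c1 by (simp add: C_def onsager_C_def)

sublocale fr: typed_hom_on onsager_free "\<lambda>x. \<tau> (cl x)"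
proof
  show "typed_hom onsager_free (\<lambda>x. \<tau> (cl x))"
    unfolding cl_def by (rule typed_hom_comp[OF onsager_class typed_hom])
qed

lemma rel: "x \<in> onsager_relators q c0 c1 \<Longrightarrow> \<tau> (cl x) = 0"
  by (simp add: cl_def onsager_class_zero hom_zero)

lemma cl_gens: "\<tau> (cl (free_gen (Aons r))) = a r" "\<tau> (cl (free_gen (Hons m))) = H m"
  by (simp_all add: a_def H_def onsager_elt_def cl_def)

lemma cl_theta: "\<tau> (cl (theta onsager_free q (\<lambda>m. free_gen (Hons m)) n)) = \<Theta> n"
proof -
  have "\<tau> (cl \<one>\<^bsub>onsager_free\<^esub>) = e" unfolding cl_def e_def using alg_homD(4)[OF onsager_class] by simp
  then show ?thesis unfolding \<Theta>_eq by (subst fr.hom_theta) (auto simp: free_gen_closed cl_gens)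
qed

lemma \<Theta>_neg: "n < 0 \<Longrightarrow> \<Theta> n = 0" by (simp add: \<Theta>_eq theta_coeff_def)
lemma \<Gamma>_neg: "n < 0 \<Longrightarrow> \<Gamma> n = 0" by (simp add: \<Gamma>_def \<Theta>_neg)
lemma \<Gamma>_0: "(q - inverse q) *c \<Gamma> 0 = e"
  using \<kappa>0 by (simp add: \<Gamma>_def \<Theta>_neg \<Theta>_eq[of 0] theta_coeff_def exp_coeff_0 cs_cs cs_one)
lemma \<Gamma>_1: "\<Gamma> 1 = H 1"
proof -
  have "e * H 1 = H 1" unfolding e_def H_def by (rule hom_one) (simp add: onsager_elt_closed)
  then show ?thesis using \<kappa>0 exp_coeff_1[of "\<lambda>i. if i = 0 then 0 else (q - inverse q) *c H i" e]
    by (simp add: \<Gamma>_def \<Theta>_neg \<Theta>_eq[of 1] theta_coeff_def cs_simps)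
qed

lemma \<Gamma>_a: "\<Gamma> 1 * a r - a r * \<Gamma> 1 = (q + inverse q) *c (a (r + 1) - C *c a (r - 1))"
proof -
  have "twisted_comm onsager_free 1 (free_gen (Hons 1)) (free_gen (Aons r))
          \<ominus>\<^bsub>onsager_free\<^esub> ((qint q (2 * int 1) / of_nat 1) \<odot>\<^bsub>onsager_free\<^esub>
               (free_gen (Aons (r + int 1)) \<ominus>\<^bsub>onsager_free\<^esub> ((onsager_C q c0 c1 ^ 1) \<odot>\<^bsub>onsager_free\<^esub> free_gen (Aons (r - int 1))))) \<in> onsager_relators q c0 c1"
    unfolding onsager_relators_def Let_def by blast
  from rel[OF this] have "H 1 * a r - a r * H 1 = qint q 2 *c (a (r + 1) - C *c a (r - 1))"
    by (simp add: fr.hom_minus fr.hom_twisted_comm fr.hom_smult free_gen_closed cl_gens[unfolded One_nat_def] cl_gens cs_one C_def)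
  moreover have "qint q 2 = q + inverse q" using \<kappa>0 q0
    by (simp add: qint_def power_int_minus field_simps power2_eq_square)
  ultimately show ?thesis by (simp add: \<Gamma>_1)
qed

text \<open>The four Theta terms combine in pairs to two values of \<open>\<Gamma>\<close>, and the
  factor -q^-2 turns the commutator twisted by q^2 into one twisted by q^-2 with its arguments
  exchanged.\<close>

lemma onsager: "(a r * a (s + 1) - q powi (-2) *c (a (s + 1) * a r))
        + (a s * a (r + 1) - q powi (-2) *c (a (r + 1) * a s)) =
        (c1 * C powi r) *c \<Gamma> (s - r + 1) + (c1 * C powi s) *c \<Gamma> (r - s + 1)"
proof -
  define Th where "Th = theta onsager_free q (\<lambda>m. free_gen (Hons m))"
  have Th: "Th n \<in> carrier onsager_free" "\<tau> (cl (Th n)) = \<Theta> n" for n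
    unfolding Th_def by (simp_all add: cl_theta) (simp add: OF.theta_closed free_gen_closed)
  have s: "q powi (-2) * q\<^sup>2 = 1" "q\<^sup>2 * q powi (-2) = 1" using q0 by (simp_all add: power_int_minus)
  have "(twisted_comm onsager_free (q powi (- 2)) (free_gen (Aons r)) (free_gen (Aons (s + 1)))
            \<ominus>\<^bsub>onsager_free\<^esub> ((q powi (- 2)) \<odot>\<^bsub>onsager_free\<^esub> twisted_comm onsager_free (q\<^sup>2) (free_gen (Aons (r + 1))) (free_gen (Aons s))))
          \<ominus>\<^bsub>onsager_free\<^esub> (((((c1 * onsager_C q c0 c1 powi r) \<odot>\<^bsub>onsager_free\<^esub> Th (s - r + 1))
               \<ominus>\<^bsub>onsager_free\<^esub> ((q powi (- 2) * c1 * onsager_C q c0 c1 powi (r + 1)) \<odot>\<^bsub>onsager_free\<^esub> Th (s - r - 1)))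
               \<oplus>\<^bsub>onsager_free\<^esub> ((c1 * onsager_C q c0 c1 powi s) \<odot>\<^bsub>onsager_free\<^esub> Th (r - s + 1)))
               \<ominus>\<^bsub>onsager_free\<^esub> ((q powi (- 2) * c1 * onsager_C q c0 c1 powi (s + 1)) \<odot>\<^bsub>onsager_free\<^esub> Th (r - s - 1))) \<in> onsager_relators q c0 c1"
    unfolding onsager_relators_def Let_def Th_def by blast
  from rel[OF this] show ?thesis using C0
    by (simp add: fr.hom_minus fr.hom_add fr.hom_twisted_comm fr.hom_smult free_gen_closed cl_gens Th C_def[symmetric] \<Gamma>_def)
       (simp add: algebra_simps cs_simps s power_int_add cs_one)
qed

lemma \<tau>_unit: "a r * e = a r" "\<Gamma> r * e = \<Gamma> r"
proof -
  have "\<Theta> n * e = \<Theta> n" for n unfolding \<Theta>_def e_def onsager_theta_def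
    by (rule hom_one) (intro theta_closed onsager_elt_closed, simp)
  then show "\<Gamma> r * e = \<Gamma> r" by (simp add: \<Gamma>_def left_diff_distrib mult_cs_left)
  show "a r * e = a r" unfolding a_def e_def by (rule hom_one) (simp add: onsager_elt_closed)
qed

lemma \<Gamma>_image: "\<exists>x\<in>carrier (onsager_alg q c0 c1). \<Gamma> n = \<tau> x" "\<exists>x\<in>carrier (onsager_alg q c0 c1). a n = \<tau> x"
proof -
  have "onsager_theta q c0 c1 n \<in> carrier (onsager_alg q c0 c1)" for n
    unfolding onsager_theta_def by (intro theta_closed onsager_elt_closed, simp)
  then show "\<exists>x\<in>carrier (onsager_alg q c0 c1). \<Gamma> n = \<tau> x"
    unfolding \<Gamma>_def \<Theta>_def by (intro bexI[of _ "onsager_theta q c0 c1 n \<ominus>\<^bsub>onsager_alg q c0 c1\<^esub> (q powi (-2) * C) \<odot>\<^bsub>onsager_alg q c0 c1\<^esub> onsager_theta q c0 c1 (n - 2)"])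
      (simp_all add: hom_minus hom_smult)
  show "\<exists>x\<in>carrier (onsager_alg q c0 c1). a n = \<tau> x"
    unfolding a_def by (intro bexI[of _ "onsager_elt q c0 c1 (Aons n)"] refl onsager_elt_closed) simp
qed

end

text \<open>The series (q - q^-1)/(1 - C z^2), that is, the scalar factor of the grave series
  without its numerator, which \<open>\<Gamma>\<close> absorbs
  (\<open>\<tau>_grave\<close>).\<close>

definition grave_coeff :: "complex \<Rightarrow> complex \<Rightarrow> nat \<Rightarrow> complex" where
  "grave_coeff q C n = (q - inverse q) * fps_nth (inverse (1 - fps_const C * fps_X\<^sup>2)) n"

lemma grave_coeff_rec: "grave_coeff q C n - C * (if n < 2 then 0 else grave_coeff q C (n - 2)) = (if n = 0 then q - inverse q else 0)"
proof -
  define v where "v = inverse (1 - fps_const C * fps_X\<^sup>2)"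
  have "v * (1 - fps_const C * fps_X\<^sup>2) = 1" unfolding v_def by (rule inverse_mult_eq_1) simp
  moreover have "v * (1 - fps_const C * fps_X\<^sup>2) = v - fps_const C * (fps_X ^ 2 * v)" by (simp add: algebra_simps)
  ultimately have "fps_nth (v - fps_const C * (fps_X ^ 2 * v)) n = fps_nth 1 n" by simp
  then have "fps_nth v n - C * (if n < 2 then 0 else fps_nth v (n - 2)) = (if n = 0 then 1 else 0)"
    by (simp add: fps_X_power_mult_nth)
  from arg_cong[OF this, of "\<lambda>z. (q - inverse q) * z"] show ?thesis
    unfolding grave_coeff_def v_def[symmetric] by (auto simp: algebra_simps)
qed

lemma grave_factor_nth: "fps_nth (fps_const (q - inverse q) * grave_factor q C) n =
   grave_coeff q C n - q powi (-2) * C * (if n < 2 then 0 else grave_coeff q C (n - 2))"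
proof -
  define v where "v = inverse (1 - fps_const C * fps_X\<^sup>2)"
  have "grave_factor q C = (1 - fps_const (q powi (-2) * C) * fps_X\<^sup>2) * v"
    unfolding grave_factor_def v_def by (rule fps_divide_unit) simp
  then have "fps_const (q - inverse q) * grave_factor q C = fps_const (q - inverse q) * v - fps_const ((q - inverse q) * (q powi (-2) * C)) * (fps_X ^ 2 * v)"
    by (simp only: fps_const_mult[symmetric]) (simp only: algebra_simps mult_1_left mult_1_right)
  then show ?thesis unfolding grave_coeff_def v_def[symmetric] by (simp add: fps_X_power_mult_nth)
qed

context onsager_hom begin

lemma \<tau>_grave: "\<tau> (grave_theta q c0 c1 n) = (\<Sum>i\<le>n. grave_coeff q C i *c \<Gamma> (int (n - i)))"
proof -
  have cl: "onsager_theta q c0 c1 n \<in> carrier (onsager_alg q c0 c1)" for n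
    unfolding onsager_theta_def by (intro theta_closed onsager_elt_closed, simp)
  let ?v = "grave_coeff q C"
  let ?p = "q powi (-2) * C"
  have "\<tau> (grave_theta q c0 c1 n) = (\<Sum>i\<le>n. fps_nth (fps_const (q - inverse q) * grave_factor q C) i *c \<Theta> (int (n - i)))"
    unfolding grave_theta_def cauchy_prod_def using cl by (subst hom_finsum) (auto simp: hom_smult \<Theta>_def C_def)
  also have "\<dots> = (\<Sum>i\<le>n. ?v i *c \<Theta> (int (n - i))) - ?p *c (\<Sum>i\<le>n. (if i < 2 then 0 else ?v (i - 2)) *c \<Theta> (int (n - i)))"
    unfolding grave_factor_nth by (simp add: cs.scale_left_diff_distrib sum_subtractf cs.scale_sum_right cs_cs)
  also have "(\<Sum>i\<le>n. (if i < 2 then 0 else ?v (i - 2)) *c \<Theta> (int (n - i))) = (\<Sum>i\<le>n. ?v i *c \<Theta> (int (n - i) - 2))"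
  proof -
    have "(\<Sum>i\<le>n. (if i < 2 then 0 else ?v (i - 2)) *c \<Theta> (int (n - i))) = (\<Sum>i\<in>{2..n}. ?v (i - 2) *c \<Theta> (int (n - i)))"
      by (intro sum.mono_neutral_cong_right) auto
    also have "\<dots> = (\<Sum>i\<in>{i. i + 2 \<le> n}. ?v i *c \<Theta> (int (n - i) - 2))"
      by (rule sum.reindex_bij_witness[of _ "\<lambda>i. i + 2" "\<lambda>i. i - 2"]) (auto simp: of_nat_diff)
    also have "\<dots> = (\<Sum>i\<le>n. ?v i *c \<Theta> (int (n - i) - 2))"
      by (intro sum.mono_neutral_left) (auto simp: of_nat_diff \<Theta>_neg)
    finally show ?thesis .
  qed
  finally show ?thesis unfolding \<Gamma>_def
    by (simp add: cs.scale_right_diff_distrib sum_subtractf cs.scale_sum_right cs_cs mult_ac)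
qed

end

text \<open>Kept in the free algebra so that one element has images both in U and in the right
  tensor factor.\<close>

definition phi_conv :: "complex \<Rightarrow> complex \<Rightarrow> nat \<Rightarrow> (loop_gen list \<Rightarrow>\<^sub>0 complex)" where
  "phi_conv q C n = (\<Oplus>\<^bsub>loop_free\<^esub>j\<in>{..n}. (C ^ j) \<odot>\<^bsub>loop_free\<^esub> (phi_minus q (- int (n - j)) \<otimes>\<^bsub>loop_free\<^esub> phi_plus q (int j)))"

lemma phi_conv_closed: "phi_conv q C n \<in> carrier loop_free"
  unfolding phi_conv_def by (auto intro!: LF.finsum_closed LF.smult_closed LF.m_closed phi_closed)

lemma (in loop_hom) hom_phi_conv: "\<rho> (phi_conv q C n) = (\<Sum>j\<le>n. C ^ j *c (f (Suc (n - j)) * g j))"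
  unfolding phi_conv_def by (subst hom_finsum) (auto simp: phi_closed hom_smult hom_mult f_def g_def)

text \<open>Only the primed family is fixed. The unprimed one is a homomorphic image in
  \<open>approx_hom\<close> and zero in \<open>approx_trivial\<close>.\<close>

locale coideal_hom = loop_hom \<rho> q + filtration F
  for \<rho> :: "(loop_gen list \<Rightarrow>\<^sub>0 complex) \<Rightarrow> 'b::typed_algebra" and q F +
  fixes c0 c1 :: complex and \<tau>' :: "(onsager_gen list \<Rightarrow>\<^sub>0 complex) set \<Rightarrow> 'b"
  assumes c0: "c0 \<noteq> 0" and c1: "c1 \<noteq> 0" and \<tau>': "typed_hom (onsager_alg q c0 c1) \<tau>'"
    and \<tau>'_one: "\<tau>' \<one>\<^bsub>onsager_alg q c0 c1\<^esub> = \<rho> \<one>\<^bsub>loop_free\<^esub>"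
    and F_gens: "\<And>w. w \<in> loop_gens \<Longrightarrow> \<rho> (free_gen w) \<in> F (loop_deg w)"
begin

abbreviation "C \<equiv> onsager_C q c0 c1"

lemma C_nz: "C \<noteq> 0" using q0 c0 c1 by (simp add: onsager_C_def)

lemma onsager_homI: "typed_hom (onsager_alg q c0 c1) \<tau> \<Longrightarrow> onsager_hom q c0 c1 \<tau>" for \<tau> :: "_ \<Rightarrow> 'b"
  using q0 qn[of 2] c0 c1 by (intro onsager_hom.intro onsager_hom_axioms.intro typed_hom_on.intro typed_hom_on_axioms.intro onsager_complex_algebra) auto

sublocale T': onsager_hom q c0 c1 \<tau>'
  by (rule onsager_homI[OF \<tau>'])

lemma T'_C: "T'.C = C" by (simp add: T'.C_def)
lemma T'_e: "T'.e = e" by (simp add: T'.e_def e_def \<tau>'_one)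

lemma sys: "loop_sys F q C e K K' (C *c hh 1 - hh (-1)) xp xm f g"
  by (rule loop_sys[OF C_nz filtration_axioms F_gens])

lemma approx_coideal_sys:
  assumes "coideal_sys F q C e K K' (C *c hh 1 - hh (-1)) xp xm f g c1 a \<Gamma> T'.a T'.\<Gamma>"
  shows "\<tau>' (grave_theta q c0 c1 n) - (\<Sum>t\<le>n. (\<Sum>i\<le>t. grave_coeff q C i *c \<Gamma> (int (t - i))) * \<rho> (phi_conv q C (n - t))) \<in> F 1"
proof -
  interpret S: coideal_sys F q C e K K' "C *c hh 1 - hh (-1)" xp xm f g c1 a \<Gamma> T'.a T'.\<Gamma> by fact
  show ?thesis using S.grave_approx[of "grave_coeff q C" n]
    by (simp add: T'.\<tau>_grave T'_C hom_phi_conv S.grave_def S.\<Phi>_def)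
qed

lemma approx_hom:
  assumes \<tau>: "typed_hom (onsager_alg q c0 c1) \<tau>" and one: "\<tau> \<one>\<^bsub>onsager_alg q c0 c1\<^esub> = \<rho> \<one>\<^bsub>loop_free\<^esub>"
    and comm: "\<And>x y. x \<in> carrier (onsager_alg q c0 c1) \<Longrightarrow> y \<in> carrier loop_free \<Longrightarrow> \<rho> y * \<tau> x = \<tau> x * \<rho> y"
    and \<tau>F: "\<And>x. x \<in> carrier (onsager_alg q c0 c1) \<Longrightarrow> \<tau> x \<in> F 0"
    and a0: "\<tau>' (onsager_elt q c0 c1 (Aons 0)) = xm 0 + \<tau> (onsager_elt q c0 c1 (Aons 0)) * K' - (c1 * q\<^sup>2) *c (K' * xp 0)"
    and a1: "\<tau>' (onsager_elt q c0 c1 (Aons (-1))) = xm 1 + \<tau> (onsager_elt q c0 c1 (Aons (-1))) * K - (c1 / C) *c (K * xp (-1))"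
  shows "\<tau>' (grave_theta q c0 c1 n) - (\<Sum>t\<le>n. \<tau> (grave_theta q c0 c1 t) * \<rho> (phi_conv q C (n - t))) \<in> F 1"
proof -
  interpret T: onsager_hom q c0 c1 \<tau> by (rule onsager_homI[OF \<tau>])
  have C: "T.C = C" by (simp add: T.C_def)
  have e: "T.e = e" by (simp add: T.e_def e_def one)
  have ca: "\<rho> y * T.a r = T.a r * \<rho> y" "\<rho> y * T.\<Gamma> r = T.\<Gamma> r * \<rho> y" if "y \<in> carrier loop_free" for r y
    using T.\<Gamma>_image[of r] comm that by auto
  note cl = free_gen_closed[of _ loop_gens]
  have cf: "f n * T.a r = T.a r * f n" "f n * T.\<Gamma> r = T.\<Gamma> r * f n" for n r
    by (cases n; simp add: f_def ca phi_closed)+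
  have "coideal_sys F q C e K K' (C *c hh 1 - hh (-1)) xp xm f g c1 T.a T.\<Gamma> T'.a T'.\<Gamma>"
  proof (intro coideal_sys.intro coideal_sys_axioms.intro sys)
    show "(C *c hh 1 - hh (- 1)) * T.a r = T.a r * (C *c hh 1 - hh (- 1))" for r
      by (simp add: left_diff_distrib right_diff_distrib mult_cs_left mult_cs_right hh_def ca cl)
    show "T'.a 0 = xm 0 + T.a 0 * K' - (c1 * q\<^sup>2) *c (K' * xp 0)" using a0 by (simp add: T'.a_def T.a_def)
    show "T'.a (-1) = xm 1 + T.a (-1) * K - (c1 / C) *c (K * xp (-1))" using a1 by (simp add: T'.a_def T.a_def)
    show "T.a r \<in> F 0" "T.\<Gamma> r \<in> F 0" for r using T.\<Gamma>_image[of r] \<tau>F by auto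
  qed (use T.\<Gamma>_0 T'.\<Gamma>_0 T.\<tau>_unit in \<open>simp_all add: c1 C T'_C e T'_e xp_def xm_def K_def g_def ca cl phi_closed cf
        T.\<Gamma>_neg T'.\<Gamma>_neg T.\<Gamma>_a[unfolded C] T'.\<Gamma>_a[unfolded T'_C] T.onsager[unfolded C] T'.onsager[unfolded T'_C]\<close>)
  from approx_coideal_sys[OF this, of n] show ?thesis by (simp add: T.\<tau>_grave C)
qed

lemma approx_trivial:
  assumes a0: "\<tau>' (onsager_elt q c0 c1 (Aons 0)) = xm 0 - (c1 * q\<^sup>2) *c (K' * xp 0)"
    and a1: "\<tau>' (onsager_elt q c0 c1 (Aons (-1))) = xm 1 - (c1 / C) *c (K * xp (-1))"
  shows "\<tau>' (grave_theta q c0 c1 n) - \<rho> (phi_conv q C n) \<in> F 1"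
proof -
  \<comment> \<open>This is (1 - C z^2)/(q - q^-1) times \<open>e\<close>. With \<open>a = 0\<close>
    and the given constant term the q-Onsager relations leave no other choice, and the corresponding
    grave series is \<open>e\<close>.\<close>
  define \<Gamma> where "\<Gamma> n = (if n = 0 then 1 / (q - inverse q) else if n = 2 then - (C / (q - inverse q)) else 0) *c e" for n :: int
  have \<kappa>: "q - inverse q \<noteq> 0" using \<kappa>0 by (simp add: \<kappa>_def)
  have ec: "f m * e = f m" "e * f m = f m" "g m * e = g m" "e * g m = g m" for m
  proof -
    have "\<rho> y * e = \<rho> y" "e * \<rho> y = \<rho> y" if "y \<in> carrier loop_free" for y using that by (simp_all add: e_def hom_one)
    then show "f m * e = f m" "e * f m = f m" "g m * e = g m" "e * g m = g m"
      by (simp_all add: g_def f_def phi_closed split: nat.splits)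
  qed
  have eF: "e \<in> F 0" using F_mult[of K 0 K' 0] F_gens[of Kgen] F_gens[of Kgen_inv] by (simp add: KK K_def[symmetric] K'_def[symmetric])
  have "coideal_sys F q C e K K' (C *c hh 1 - hh (-1)) xp xm f g c1 (\<lambda>r. 0) \<Gamma> T'.a T'.\<Gamma>"
  proof (intro coideal_sys.intro coideal_sys_axioms.intro sys)
    show "T'.a 0 = xm 0 + 0 * K' - (c1 * q\<^sup>2) *c (K' * xp 0)" using a0 by (simp add: T'.a_def)
    show "T'.a (-1) = xm 1 + 0 * K - (c1 / C) *c (K * xp (-1))" using a1 by (simp add: T'.a_def)
    show "(q - inverse q) *c \<Gamma> 0 = e" using \<kappa> by (simp add: \<Gamma>_def cs_cs cs_one)
    show "0 * 0 - q powi - 2 *c (0 * 0) + (0 * 0 - q powi - 2 *c (0 * 0)) = (c1 * C powi r) *c \<Gamma> (s - r + 1) + (c1 * C powi s) *c \<Gamma> (r - s + 1)" for r s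
    proof -
      consider "s = r - 1" | "s = r + 1" | "s \<noteq> r - 1" "s \<noteq> r + 1" by auto
      then show ?thesis
      proof cases
        case 1
        then have "C powi r = C * C powi s" using C_nz by (simp add: power_int_diff)
        then show ?thesis using 1 by (simp add: \<Gamma>_def cs_cs flip: cs_add_left)
      next
        case 2
        then have "C powi s = C * C powi r" using C_nz by (simp add: power_int_add)
        then show ?thesis using 2 by (simp add: \<Gamma>_def cs_cs flip: cs_add_left)
      next
        case 3
        then have "s - r + 1 \<noteq> 0" "s - r + 1 \<noteq> 2" "r - s + 1 \<noteq> 0" "r - s + 1 \<noteq> 2" by auto
        then show ?thesis by (simp add: \<Gamma>_def)
      qed
    qed
    show "(0 :: 'b) \<in> F 0" by (rule F_zero)
    show "\<Gamma> r \<in> F 0" for r unfolding \<Gamma>_def by (rule F_cs[OF eF])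
    show "\<Gamma> r * e = \<Gamma> r" for r by (simp add: \<Gamma>_def mult_cs_left e_gen)
  qed (use T'.\<Gamma>_0 in \<open>simp_all add: c1 T'_C T'_e T'.\<Gamma>_neg T'.\<Gamma>_a[unfolded T'_C] T'.onsager[unfolded T'_C] cs_simps ec e_gen \<Gamma>_def\<close>)
  note S = approx_coideal_sys[OF this, of n]
  have G: "(\<Sum>i\<le>t. grave_coeff q C i *c \<Gamma> (int (t - i))) = (if t = 0 then e else 0)" for t
  proof -
    have "(\<Sum>i\<le>t. grave_coeff q C i *c \<Gamma> (int (t - i))) = (\<Sum>i\<in>{i. i \<le> t \<and> (i = t \<or> i + 2 = t)}. grave_coeff q C i *c \<Gamma> (int (t - i)))"
      by (rule sum.mono_neutral_right) (auto simp: \<Gamma>_def)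
    also have "\<dots> = grave_coeff q C t *c \<Gamma> 0 + (if t < 2 then 0 else grave_coeff q C (t - 2) *c \<Gamma> 2)"
    proof (cases "t < 2")
      case True
      then have "{i. i \<le> t \<and> (i = t \<or> i + 2 = t)} = {t}" by auto
      then show ?thesis using True by simp
    next
      case False
      then have "{i. i \<le> t \<and> (i = t \<or> i + 2 = t)} = {t, t - 2}" "t \<noteq> t - 2" "int (t - (t - 2)) = 2" by auto
      then show ?thesis using False by simp
    qed
    also have "\<dots> = ((1 / (q - inverse q)) * (grave_coeff q C t - C * (if t < 2 then 0 else grave_coeff q C (t - 2)))) *c e"
      by (simp add: \<Gamma>_def cs_cs algebra_simps flip: cs_add_left cs.scale_left_diff_distrib)
    also have "\<dots> = (if t = 0 then e else 0)"
      unfolding grave_coeff_rec using \<kappa> by (simp add: cs_one)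
    finally show ?thesis .
  qed
  have "(\<Sum>t\<le>n. (\<Sum>i\<le>t. grave_coeff q C i *c \<Gamma> (int (t - i))) * \<rho> (phi_conv q C (n - t))) = (\<Sum>t\<in>{0}. e * \<rho> (phi_conv q C (n - t)))"
    unfolding G by (intro sum.mono_neutral_cong_right) auto
  also have "\<dots> = \<rho> (phi_conv q C n)" by (simp add: e_def hom_one phi_conv_closed)
  finally show ?thesis using S by simp
qed

end

section \<open>Spans and the degree filtration\<close>

context complex_algebra begin

lemma submodule_complexI:
  assumes "V \<subseteq> carrier A" "\<zero> \<in> V" "\<And>x y. x \<in> V \<Longrightarrow> y \<in> V \<Longrightarrow> x \<oplus> y \<in> V" "\<And>c x. x \<in> V \<Longrightarrow> c \<odot> x \<in> V"
  shows "submodule V complex_alg A"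
proof -
  \<comment> \<open>Closure under scalars yields additive inverses, as required of a
    subgroup.\<close>
  have inv: "inv\<^bsub>add_monoid A\<^esub> x = (-1) \<odot> x" if "x \<in> carrier A" for x
  proof -
    have "x \<oplus> (-1) \<odot> x = (1 + -1) \<odot> x" using that by (simp only: smult_add_left smult_one)
    also have "\<dots> = \<zero>" using smult_add_left[OF that, of 0 0] that
      by simp
    finally have "\<ominus> x = (-1) \<odot> x" using that by (simp add: minus_equality a_comm)
    then show ?thesis by (simp add: a_inv_def)
  qed
  show ?thesis
    by (intro submodule.intro submodule_axioms.intro subgroup.intro) (use assms inv in \<open>auto simp: complex_alg_def\<close>)
qed

lemma submodule_complexD:
  assumes "submodule V complex_alg A"
  shows "V \<subseteq> carrier A" "\<zero> \<in> V" "\<And>x y. x \<in> V \<Longrightarrow> y \<in> V \<Longrightarrow> x \<oplus> y \<in> V" "\<And>c x. x \<in> V \<Longrightarrow> c \<odot> x \<in> V"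
proof -
  interpret submodule V complex_alg A by fact
  show "V \<subseteq> carrier A" "\<zero> \<in> V" "\<And>x y. x \<in> V \<Longrightarrow> y \<in> V \<Longrightarrow> x \<oplus> y \<in> V" "\<And>c x. x \<in> V \<Longrightarrow> c \<odot> x \<in> V"
    using subset one_closed m_closed smult_closed by (auto simp: complex_alg_def)
qed

lemma lin_span_submodule:
  assumes "S \<subseteq> carrier A"
  shows "submodule (lin_span A S) complex_alg A"
proof (rule submodule_complexI)
  have "submodule (carrier A) complex_alg A" by (rule submodule_complexI) auto
  then show "lin_span A S \<subseteq> carrier A" unfolding lin_span_def using assms by auto
qed (auto simp: lin_span_def dest: submodule_complexD)

lemmas lin_spanD = submodule_complexD[OF lin_span_submodule]

lemma lin_span_superset: "S \<subseteq> lin_span A S"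
  by (auto simp: lin_span_def)

lemma lin_span_minimal: "submodule V complex_alg A \<Longrightarrow> S \<subseteq> V \<Longrightarrow> lin_span A S \<subseteq> V"
  by (auto simp: lin_span_def)

lemma lin_span_mono: "S \<subseteq> S' \<Longrightarrow> lin_span A S \<subseteq> lin_span A S'"
  by (auto simp: lin_span_def)

text \<open>Bilinearity in two steps: the elements that multiply all of S' into the target form a
  submodule, and then the second factor is extended in the same way.\<close>

lemma lin_span_mult:
  assumes S: "S \<subseteq> carrier A" "S' \<subseteq> carrier A" "S'' \<subseteq> carrier A"
    and mult: "\<And>x y. x \<in> S \<Longrightarrow> y \<in> S' \<Longrightarrow> x \<otimes> y \<in> S''"
    and x: "x \<in> lin_span A S" and y: "y \<in> lin_span A S'"
  shows "x \<otimes> y \<in> lin_span A S''"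
proof -
  note D = lin_spanD[OF S(3)]
  have 1: "S \<subseteq> {x \<in> carrier A. \<forall>y\<in>S'. x \<otimes> y \<in> lin_span A S''}"
    using mult S(1) lin_span_superset[of S''] by auto
  have "lin_span A S \<subseteq> {x \<in> carrier A. \<forall>y\<in>S'. x \<otimes> y \<in> lin_span A S''}"
    using S D by (intro lin_span_minimal 1 submodule_complexI) (auto simp: l_distr smult_mult_left subset_iff)
  then have 2: "S' \<subseteq> {y \<in> carrier A. x \<otimes> y \<in> lin_span A S''}" and xc: "x \<in> carrier A"
    using x S(2) by auto
  have "lin_span A S' \<subseteq> {y \<in> carrier A. x \<otimes> y \<in> lin_span A S''}"
    using S D xc by (intro lin_span_minimal 2 submodule_complexI) (auto simp: r_distr smult_mult_right subset_iff)
  then show ?thesis using y by auto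
qed

text \<open>Used for U filtered by degree and for the tensor square filtered by the degree of the
  second factor.\<close>

lemma span_filtration:
  fixes S :: "int \<Rightarrow> 'a set"
  assumes S: "\<And>d. S d \<subseteq> carrier A"
    and mult: "\<And>d d' x y. x \<in> S d \<Longrightarrow> y \<in> S d' \<Longrightarrow> x \<otimes> y \<in> S (d + d')"
    and mono: "\<And>d d'. d \<le> d' \<Longrightarrow> S d' \<subseteq> S d"
  shows "filtration (\<lambda>d. emb A ` lin_span A (S d))"
proof
  interpret E: typed_hom_on A "emb A" by unfold_locales (rule typed_hom_emb, rule complex_algebra_axioms)
  note D = lin_spanD[OF S] and C = subsetD[OF lin_spanD(1)[OF S]]
  let ?F = "\<lambda>d. emb A ` lin_span A (S d)"
  show "x + y \<in> ?F d" if "x \<in> ?F d" "y \<in> ?F d" for d x y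
    using that by (auto simp: D(3) C simp flip: E.hom_add)
  show "0 \<in> ?F d" for d using D(2)[of d] E.hom_zero by (metis imageI)
  show "c *c x \<in> ?F d" if "x \<in> ?F d" for d c x
    using that by (auto simp: D(4) C simp flip: E.hom_smult)
  show "x * y \<in> ?F (d + d')" if "x \<in> ?F d" "y \<in> ?F d'" for d d' x y
    using that lin_span_mult[OF S S S mult] by (auto simp: C simp flip: E.hom_mult)
  show "?F d' \<subseteq> ?F d" if "d \<le> d'" for d d'
    using lin_span_mono[OF mono[OF that]] by auto
qed

end

section \<open>The degree filtration of the quantum loop algebra\<close>

lemma loop_complex_algebra: "complex_algebra (loop_alg q)"
  and loop_class: "alg_class loop_free (loop_relators q) \<in> alg_hom loop_free (loop_alg q)"
  and loop_class_zero: "x \<in> loop_relators q \<Longrightarrow> alg_class loop_free (loop_relators q) x = \<zero>\<^bsub>loop_alg q\<^esub>"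
  unfolding loop_alg_def using LF.quot[OF loop_relators_closed] by auto

lemma loop_elt_closed: "w \<in> loop_gens \<Longrightarrow> loop_elt q w \<in> carrier (loop_alg q)"
  unfolding loop_elt_def by (intro alg_homD(1)[OF loop_class] free_gen_closed)

definition loop_filt :: "complex \<Rightarrow> int \<Rightarrow> (loop_gen list \<Rightarrow>\<^sub>0 complex) set set" where
  "loop_filt q d = (\<Union>e\<in>{d..}. loop_homogeneous q e)"

lemma loop_homogeneous_closed: "loop_homogeneous q d \<subseteq> carrier (loop_alg q)"
  unfolding loop_homogeneous_def using alg_homD(1)[OF loop_class] by blast

lemma loop_filt_closed: "loop_filt q d \<subseteq> carrier (loop_alg q)"
  unfolding loop_filt_def using loop_homogeneous_closed by auto

lemma loop_filt_mono: "d \<le> d' \<Longrightarrow> loop_filt q d' \<subseteq> loop_filt q d"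
  unfolding loop_filt_def by (intro UN_mono) auto

lemma keys_monoid_alg_mult: "Poly_Mapping.keys (f \<otimes>\<^bsub>monoid_alg M\<^esub> g) \<subseteq> {a \<otimes>\<^bsub>M\<^esub> b | a b. a \<in> Poly_Mapping.keys f \<and> b \<in> Poly_Mapping.keys g}"
proof -
  have "f \<otimes>\<^bsub>monoid_alg M\<^esub> g = (\<Sum>a\<in>Poly_Mapping.keys f. \<Sum>b\<in>Poly_Mapping.keys g.
     Poly_Mapping.single (a \<otimes>\<^bsub>M\<^esub> b) (Poly_Mapping.lookup f a * Poly_Mapping.lookup g b))"
    by (simp add: monoid_alg_def)
  also have "Poly_Mapping.keys \<dots> \<subseteq> (\<Union>a\<in>Poly_Mapping.keys f. \<Union>b\<in>Poly_Mapping.keys g. {a \<otimes>\<^bsub>M\<^esub> b})"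
    by (intro order_trans[OF keys_sum] UN_mono order_refl) auto
  finally show ?thesis by blast
qed

lemma loop_homogeneous_mult:
  assumes "x \<in> loop_homogeneous q d" "y \<in> loop_homogeneous q d'"
  shows "x \<otimes>\<^bsub>loop_alg q\<^esub> y \<in> loop_homogeneous q (d + d')"
proof -
  let ?cl = "alg_class loop_free (loop_relators q)"
  obtain f g where f: "x = ?cl f" "f \<in> carrier loop_free" "\<And>w. w \<in> Poly_Mapping.keys f \<Longrightarrow> sum_list (map loop_deg w) = d"
    and g: "y = ?cl g" "g \<in> carrier loop_free" "\<And>w. w \<in> Poly_Mapping.keys g \<Longrightarrow> sum_list (map loop_deg w) = d'"
    using assms unfolding loop_homogeneous_def by auto
  have "x \<otimes>\<^bsub>loop_alg q\<^esub> y = ?cl (f \<otimes>\<^bsub>loop_free\<^esub> g)" using f g alg_homD(2)[OF loop_class] by simp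
  moreover have "sum_list (map loop_deg w) = d + d'" if w: "w \<in> Poly_Mapping.keys (f \<otimes>\<^bsub>loop_free\<^esub> g)" for w
  proof -
    have "w \<in> {a @ b | a b. a \<in> Poly_Mapping.keys f \<and> b \<in> Poly_Mapping.keys g}"
      using subsetD[OF keys_monoid_alg_mult w[unfolded free_alg_def]] by simp
    then show ?thesis using f(3) g(3) by auto
  qed
  ultimately show ?thesis using f g unfolding loop_homogeneous_def by (auto intro!: LF.m_closed)
qed

lemma loop_filt_mult: "x \<in> loop_filt q d \<Longrightarrow> y \<in> loop_filt q d' \<Longrightarrow> x \<otimes>\<^bsub>loop_alg q\<^esub> y \<in> loop_filt q (d + d')"
proof -
  assume "x \<in> loop_filt q d" "y \<in> loop_filt q d'"
  then obtain e e' where "e \<ge> d" "x \<in> loop_homogeneous q e" "e' \<ge> d'" "y \<in> loop_homogeneous q e'"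
    by (auto simp: loop_filt_def)
  then show ?thesis unfolding loop_filt_def
    by (intro UN_I[where a = "e + e'"] loop_homogeneous_mult) auto
qed

lemma loop_elt_homogeneous: "w \<in> loop_gens \<Longrightarrow> loop_elt q w \<in> loop_homogeneous q (loop_deg w)"
  unfolding loop_homogeneous_def loop_elt_def using free_gen_closed[of w loop_gens]
  by (auto simp: free_gen_def intro!: exI[of _ "free_gen w"])

lemma loop_elt_filt: "w \<in> loop_gens \<Longrightarrow> loop_elt q w \<in> lin_span (loop_alg q) (loop_filt q (loop_deg w))"
  by (rule subsetD[OF complex_algebra.lin_span_superset[OF loop_complex_algebra]])
    (auto simp: loop_filt_def intro: loop_elt_homogeneous)

lemma loop_one_filt: "\<one>\<^bsub>loop_alg q\<^esub> \<in> lin_span (loop_alg q) (loop_filt q 0)"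
proof -
  have "\<forall>w\<in>Poly_Mapping.keys \<one>\<^bsub>loop_free\<^esub>. sum_list (map loop_deg w) = 0"
    by (simp add: free_alg_def monoid_alg_simps)
  then have "\<one>\<^bsub>loop_alg q\<^esub> \<in> loop_homogeneous q 0"
    unfolding loop_homogeneous_def mem_Collect_eq alg_homD(4)[OF loop_class, symmetric]
    by (intro exI[of _ "\<one>\<^bsub>loop_free\<^esub>"] conjI refl LF.one_closed)
  then have "\<one>\<^bsub>loop_alg q\<^esub> \<in> loop_filt q 0" by (auto simp: loop_filt_def)
  then show ?thesis by (rule subsetD[OF complex_algebra.lin_span_superset[OF loop_complex_algebra]])
qed

lemma loop_positive_eq: "loop_positive q = lin_span (loop_alg q) (loop_filt q 1)"
  by (simp add: loop_positive_def loop_filt_def)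

locale loop_rep = typed_hom_on "loop_alg q" \<rho>' for q and \<rho>' :: "(loop_gen list \<Rightarrow>\<^sub>0 complex) set \<Rightarrow> 'b::typed_algebra" +
  assumes q0': "q \<noteq> 0" and qn': "\<And>n::nat. n \<ge> 1 \<Longrightarrow> q ^ n \<noteq> 1"
begin

sublocale fr: loop_hom "\<lambda>x. \<rho>' (alg_class loop_free (loop_relators q) x)" q
proof (intro loop_hom.intro loop_hom_axioms.intro typed_hom_on.intro typed_hom_on_axioms.intro free_alg_complex_algebra)
  show "typed_hom loop_free (\<lambda>x. \<rho>' (alg_class loop_free (loop_relators q) x))"
    by (rule typed_hom_comp[OF loop_class typed_hom])
qed (use q0' qn' loop_class_zero in \<open>auto simp: hom_zero\<close>)

lemma gens: "\<rho>' (loop_elt q Kgen) = fr.K" "\<rho>' (loop_elt q Kgen_inv) = fr.K'" "\<rho>' (loop_elt q (Xplus k)) = fr.xp k"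
  "\<rho>' (loop_elt q (Xminus k)) = fr.xm k"
  by (simp_all add: fr.K_def fr.K'_def fr.xp_def fr.xm_def loop_elt_def)

lemma one: "\<rho>' \<one>\<^bsub>loop_alg q\<^esub> = fr.e"
  unfolding fr.e_def using alg_homD(4)[OF loop_class] by simp

end

section \<open>Tensor products\<close>

locale tensor_ctx = A: complex_algebra A + B: complex_algebra B for A :: "(complex, 'a) module" and B :: "(complex, 'b) module"
begin

abbreviation "M \<equiv> monoid_alg (A \<times>\<times> B)"
abbreviation "T \<equiv> tensor_alg A B"
abbreviation "t \<equiv> tensor A B"

sublocale M: complex_algebra M
  by (intro monoid_alg_complex_algebra DirProd_monoid A.monoid_axioms B.monoid_axioms)

lemma single_closed: "a \<in> carrier A \<Longrightarrow> b \<in> carrier B \<Longrightarrow> Poly_Mapping.single (a, b) c \<in> carrier M"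
  by (auto simp: monoid_alg_simps)

lemma diff_closed: "x \<in> carrier M \<Longrightarrow> y \<in> carrier M \<Longrightarrow> x - y \<in> carrier M"
  using keys_diff[of x y] by (auto simp: monoid_alg_simps)

lemma relators_closed: "tensor_relators A B \<subseteq> carrier M"
  unfolding tensor_relators_def
  by (auto intro!: diff_closed single_closed A.smult_closed B.smult_closed A.a_closed B.a_closed)

lemma T_complex_algebra: "complex_algebra T"
  unfolding tensor_alg_def by (rule M.quot_alg_complex_algebra[OF relators_closed])

sublocale T: complex_algebra T by (rule T_complex_algebra)

abbreviation "cl \<equiv> alg_class M (tensor_relators A B)"

lemma cl_hom: "cl \<in> alg_hom M T"
  unfolding tensor_alg_def by (rule M.alg_class_hom[OF relators_closed])

lemma t_closed: "a \<in> carrier A \<Longrightarrow> b \<in> carrier B \<Longrightarrow> t a b \<in> carrier T"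
  unfolding tensor_def by (rule alg_homD(1)[OF cl_hom single_closed])

lemma t_mult: "a \<in> carrier A \<Longrightarrow> b \<in> carrier B \<Longrightarrow> a' \<in> carrier A \<Longrightarrow> b' \<in> carrier B \<Longrightarrow>
    t a b \<otimes>\<^bsub>T\<^esub> t a' b' = t (a \<otimes>\<^bsub>A\<^esub> a') (b \<otimes>\<^bsub>B\<^esub> b')"
  unfolding tensor_def by (simp add: single_closed monoid_alg_mult_single flip: alg_homD(2)[OF cl_hom])

lemma t_one: "t \<one>\<^bsub>A\<^esub> \<one>\<^bsub>B\<^esub> = \<one>\<^bsub>T\<^esub>"
  unfolding tensor_def alg_homD(4)[OF cl_hom, symmetric] by (simp add: monoid_alg_simps)

lemma cl_eq:
  assumes "x \<in> carrier M" "y \<in> carrier M" "x - y \<in> tensor_relators A B"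
  shows "cl x = cl y"
proof -
  have c: "cl x \<in> carrier T" "cl y \<in> carrier T" "cl (x - y) \<in> carrier T"
    using alg_homD(1)[OF cl_hom] assms(1,2) diff_closed by auto
  have "cl (x - y) = \<zero>\<^bsub>T\<^esub>" unfolding tensor_alg_def by (rule M.alg_class_zero[OF relators_closed assms(3)])
  moreover have "cl x = cl (x - y) \<oplus>\<^bsub>T\<^esub> cl y"
    using alg_homD(3)[OF cl_hom diff_closed[OF assms(1,2)] assms(2)] by (simp add: monoid_alg_simps)
  ultimately show ?thesis using c by simp
qed

lemma cl_add_single:
  assumes "a \<in> carrier A" "b \<in> carrier B" "a' \<in> carrier A" "b' \<in> carrier B" "x \<in> carrier A" "y \<in> carrier B"
    and "Poly_Mapping.single (x, y) 1 - Poly_Mapping.single (a, b) 1 - Poly_Mapping.single (a', b') 1 \<in> tensor_relators A B"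
  shows "t x y = t a b \<oplus>\<^bsub>T\<^esub> t a' b'"
proof -
  have "t x y = cl (Poly_Mapping.single (a, b) 1 \<oplus>\<^bsub>M\<^esub> Poly_Mapping.single (a', b') 1)"
    unfolding tensor_def
    by (rule cl_eq[OF single_closed[OF assms(5,6)] M.a_closed[OF single_closed[OF assms(1,2)] single_closed[OF assms(3,4)]]])
      (use assms(7) in \<open>simp add: monoid_alg_simps(4) diff_diff_eq\<close>)
  also have "\<dots> = t a b \<oplus>\<^bsub>T\<^esub> t a' b'"
    unfolding tensor_def using assms by (intro alg_homD(3)[OF cl_hom] single_closed)
  finally show ?thesis .
qed

lemma t_add_left:
  assumes "a \<in> carrier A" "a' \<in> carrier A" "b \<in> carrier B"
  shows "t (a \<oplus>\<^bsub>A\<^esub> a') b = t a b \<oplus>\<^bsub>T\<^esub> t a' b"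
  by (rule cl_add_single) (use assms in \<open>simp_all, unfold tensor_relators_def, blast\<close>)

lemma t_add_right:
  assumes "a \<in> carrier A" "b \<in> carrier B" "b' \<in> carrier B"
  shows "t a (b \<oplus>\<^bsub>B\<^esub> b') = t a b \<oplus>\<^bsub>T\<^esub> t a b'"
  by (rule cl_add_single) (use assms in \<open>simp_all, unfold tensor_relators_def, blast\<close>)

lemma t_smult:
  assumes "a \<in> carrier A" "b \<in> carrier B"
  shows "t (c \<odot>\<^bsub>A\<^esub> a) b = c \<odot>\<^bsub>T\<^esub> t a b" "t a (c \<odot>\<^bsub>B\<^esub> b) = c \<odot>\<^bsub>T\<^esub> t a b"
proof -
  have 1: "c \<odot>\<^bsub>T\<^esub> t a b = cl (Poly_Mapping.single (a, b) c)"
    unfolding tensor_def using alg_homD(5)[OF cl_hom single_closed[OF assms, of 1], of c] by (simp add: monoid_alg_smult_single)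
  have 2: "Poly_Mapping.single (c \<odot>\<^bsub>A\<^esub> a, b) 1 - Poly_Mapping.single (a, b) c \<in> tensor_relators A B"
    "Poly_Mapping.single (a, c \<odot>\<^bsub>B\<^esub> b) 1 - Poly_Mapping.single (a, b) c \<in> tensor_relators A B"
    unfolding tensor_relators_def using assms by blast+
  show "t (c \<odot>\<^bsub>A\<^esub> a) b = c \<odot>\<^bsub>T\<^esub> t a b" "t a (c \<odot>\<^bsub>B\<^esub> b) = c \<odot>\<^bsub>T\<^esub> t a b"
    unfolding 1 unfolding tensor_def
    by (rule cl_eq[OF single_closed single_closed 2(1)] cl_eq[OF single_closed single_closed 2(2)]; simp add: assms)+
qed

text \<open>Two commuting copies of the factors inside one type; by \<open>emb_t\<close> a pure
  tensor is a product of the two images.\<close>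

definition "left x = emb T (t x \<one>\<^bsub>B\<^esub>)"
definition "right x = emb T (t \<one>\<^bsub>A\<^esub> x)"

sublocale E: typed_hom_on T "emb T" by unfold_locales (rule typed_hom_emb, rule T_complex_algebra)

lemma left_typed_hom: "typed_hom A left" and right_typed_hom: "typed_hom B right"
  unfolding typed_hom_def left_def right_def
  by (auto simp: t_closed t_add_left t_add_right t_mult t_smult simp flip: E.hom_add E.hom_mult E.hom_smult)

lemma left_one: "left \<one>\<^bsub>A\<^esub> = emb T \<one>\<^bsub>T\<^esub>" and right_one: "right \<one>\<^bsub>B\<^esub> = emb T \<one>\<^bsub>T\<^esub>"
  by (simp_all add: left_def right_def t_one)

lemma emb_t: "a \<in> carrier A \<Longrightarrow> b \<in> carrier B \<Longrightarrow> emb T (t a b) = left a * right b"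
  unfolding left_def right_def by (simp add: t_closed t_mult flip: E.hom_mult)

lemma left_right: "a \<in> carrier A \<Longrightarrow> b \<in> carrier B \<Longrightarrow> right b * left a = left a * right b"
  unfolding left_def right_def by (simp add: t_closed t_mult flip: E.hom_mult)

end

section \<open>Factorization and coproduct\<close>

lemma grave_closed: "grave_theta q c0 c1 n \<in> carrier (onsager_alg q c0 c1)"
proof -
  interpret Ons: complex_algebra "onsager_alg q c0 c1" by (rule onsager_complex_algebra)
  have "onsager_theta q c0 c1 n \<in> carrier (onsager_alg q c0 c1)" for n
    unfolding onsager_theta_def by (intro Ons.theta_closed onsager_elt_closed, simp)
  then show ?thesis unfolding grave_theta_def cauchy_prod_def by (auto intro!: Ons.finsum_closed)
qed

context loop_rep
begin

lemma coideal_values: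
  assumes "is_coideal_hom q c0 c1 s0 s1 \<eta>" "c0 \<noteq> 0" "c1 \<noteq> 0"
  shows "\<rho>' (\<eta> (onsager_elt q c0 c1 (Aons 0))) = fr.xm 0 - (c1 * q\<^sup>2) *c (fr.K' * fr.xp 0) + s1 *c fr.K'"
    "\<rho>' (\<eta> (onsager_elt q c0 c1 (Aons (-1)))) =
       fr.xm 1 - (c1 / onsager_C q c0 c1) *c (fr.K * fr.xp (-1)) + (q powi (-2) * inverse c0 * s0) *c fr.K"
proof -
  have c: "c1 / onsager_C q c0 c1 = q powi (-4) * inverse c0"
    using assms(2,3) by (simp add: onsager_C_def power_int_minus divide_simps)
  note simps = assms(1)[unfolded is_coideal_hom_def Let_def] hom_add hom_minus hom_uminus hom_smult hom_mult loop_elt_closed gens c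
  show "\<rho>' (\<eta> (onsager_elt q c0 c1 (Aons 0))) = fr.xm 0 - (c1 * q\<^sup>2) *c (fr.K' * fr.xp 0) + s1 *c fr.K'"
    by (simp add: simps)
  show "\<rho>' (\<eta> (onsager_elt q c0 c1 (Aons (-1)))) =
       fr.xm 1 - (c1 / onsager_C q c0 c1) *c (fr.K * fr.xp (-1)) + (q powi (-2) * inverse c0 * s0) *c fr.K"
    by (simp add: simps)
qed

end

locale coideal_setting =
  fixes q c0 c1 :: complex
  assumes q0: "q \<noteq> 0" and qn: "\<And>n::nat. n \<ge> 1 \<Longrightarrow> q ^ n \<noteq> 1" and c0: "c0 \<noteq> 0" and c1: "c1 \<noteq> 0"
begin

abbreviation "U \<equiv> loop_alg q"
abbreviation "Ons \<equiv> onsager_alg q c0 c1"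
abbreviation "C \<equiv> onsager_C q c0 c1"
abbreviation "cl \<equiv> alg_class loop_free (loop_relators q)"

sublocale U: complex_algebra U by (rule loop_complex_algebra)
sublocale Ons: complex_algebra Ons by (rule onsager_complex_algebra)

lemma loop_repI: "typed_hom U \<rho>' \<Longrightarrow> loop_rep q \<rho>'"
  using q0 qn by (intro loop_rep.intro loop_rep_axioms.intro typed_hom_on.intro typed_hom_on_axioms.intro loop_complex_algebra) auto

sublocale R: loop_rep q "emb U"
  by (rule loop_repI[OF typed_hom_emb[OF loop_complex_algebra]])

definition "FU d = emb U ` lin_span U (loop_filt q d)"

lemma emb_FU: "x \<in> carrier U \<Longrightarrow> emb U x \<in> FU 1 \<Longrightarrow> x \<in> loop_positive q"
  unfolding FU_def loop_positive_eq
  using emb_inj[OF loop_complex_algebra] U.lin_spanD(1)[OF loop_filt_closed] by blast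

sublocale FU: filtration FU
  unfolding FU_def[abs_def]
  by (rule U.span_filtration, rule loop_filt_closed, erule (1) loop_filt_mult, erule loop_filt_mono)

lemma coideal_U:
  assumes "\<eta> \<in> alg_hom Ons U"
  shows "coideal_hom (\<lambda>x. emb U (cl x)) q FU c0 c1 (\<lambda>x. emb U (\<eta> x))"
proof (intro coideal_hom.intro coideal_hom_axioms.intro R.fr.loop_hom_axioms FU.filtration_axioms c0 c1 typed_hom_comp[OF assms R.typed_hom])
  show "emb U (\<eta> \<one>\<^bsub>Ons\<^esub>) = emb U (cl \<one>\<^bsub>loop_free\<^esub>)"
    using alg_homD(4)[OF assms] alg_homD(4)[OF loop_class] by simp
  show "emb U (cl (free_gen w)) \<in> FU (loop_deg w)" if "w \<in> loop_gens" for w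
    unfolding FU_def using loop_elt_filt[OF that] by (simp add: loop_elt_def)
qed

text \<open>Lets either theorem trade \<open>phi_conv\<close> for the grave series of
  \<open>\<eta>0\<close>.\<close>

lemma eta0_approx:
  assumes "is_coideal_hom q c0 c1 0 0 \<eta>0"
  shows "\<eta>0 (grave_theta q c0 c1 n) \<ominus>\<^bsub>U\<^esub> cl (phi_conv q C n) \<in> loop_positive q"
proof -
  have h: "\<eta>0 \<in> alg_hom Ons U" using assms by (simp add: is_coideal_hom_def Let_def)
  interpret E: coideal_hom "\<lambda>x. emb U (cl x)" q FU c0 c1 "\<lambda>x. emb U (\<eta>0 x)" by (rule coideal_U[OF h])
  have c: "\<eta>0 (grave_theta q c0 c1 n) \<in> carrier U" "cl (phi_conv q C n) \<in> carrier U"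
    using alg_homD(1)[OF h grave_closed] alg_homD(1)[OF loop_class phi_conv_closed] by auto
  have "emb U (\<eta>0 (grave_theta q c0 c1 n)) - emb U (cl (phi_conv q C n)) \<in> FU 1"
    by (rule E.approx_trivial) (use R.coideal_values[OF assms c0 c1] in simp_all)
  then show ?thesis using c by (intro emb_FU) (simp_all add: R.hom_minus)
qed

theorem factorization:
  assumes \<epsilon>: "is_counit q \<epsilon>" and \<eta>: "is_coideal_hom q c0 c1 s0 s1 \<eta>" and \<eta>0: "is_coideal_hom q c0 c1 0 0 \<eta>0"
  shows "series_cong U (loop_positive q)
       (\<lambda>n. \<eta> (grave_theta q c0 c1 n))
       (cauchy_prod U (smult U)
          (\<lambda>n. \<epsilon> (\<eta> (grave_theta q c0 c1 n)))
          (\<lambda>n. \<eta>0 (grave_theta q c0 c1 n)))"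
proof -
  have h: "\<eta> \<in> alg_hom Ons U" and h0: "\<eta>0 \<in> alg_hom Ons U" using \<eta> \<eta>0 by (simp_all add: is_coideal_hom_def Let_def)
  have he: "\<epsilon> \<in> alg_hom U complex_alg" using \<epsilon> by (simp add: is_counit_def)
  interpret E: coideal_hom "\<lambda>x. emb U (cl x)" q FU c0 c1 "\<lambda>x. emb U (\<eta> x)" by (rule coideal_U[OF h])
  \<comment> \<open>The counit becomes a map into the type that also contains U, so its values form
    an unprimed family that commutes with everything there.\<close>
  define \<epsilon>' where "\<epsilon>' x = \<epsilon> x *c R.fr.e" for x
  have "typed_hom U \<epsilon>'" unfolding typed_hom_def \<epsilon>'_def using alg_homD[OF he]
    by (simp add: complex_alg_def cs_add_left cs_simps R.fr.e_gen)
  then interpret X: loop_rep q \<epsilon>' by (rule loop_repI)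
  have \<epsilon>_chev: "\<epsilon> (chev_E q i) = 0" "\<epsilon> (chev_F q i) = 0" "\<epsilon> (chev_K q i) = 1" if "i \<in> {0, 1}" for i
    using \<epsilon> that by (auto simp: is_counit_def)
  have XE: "X.fr.e = R.fr.e" unfolding X.one[symmetric] using alg_homD(4)[OF he] by (simp add: \<epsilon>'_def complex_alg_def cs_one)
  have K: "X.fr.K = R.fr.e" "X.fr.K' = R.fr.e" unfolding X.gens[symmetric] using \<epsilon>_chev(3)[of 0] \<epsilon>_chev(3)[of 1]
    by (simp_all add: chev_K_def \<epsilon>'_def cs_one)
  have x0: "X.fr.xp 0 = 0" "X.fr.xm 0 = 0" unfolding X.gens[symmetric] using \<epsilon>_chev(1)[of 1] \<epsilon>_chev(2)[of 1]
    by (simp_all add: chev_E_def chev_F_def \<epsilon>'_def)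
  have "\<epsilon>' (chev_E q 0) = 0" "\<epsilon>' (chev_F q 0) = 0" using \<epsilon>_chev by (simp_all add: \<epsilon>'_def)
  then have "X.fr.K' * X.fr.xm 1 = 0" "X.fr.xp (-1) * X.fr.K = 0"
    by (simp_all add: chev_E_def chev_F_def X.hom_uminus X.hom_mult loop_elt_closed X.gens)
  \<comment> \<open>The counit is prescribed on E_0 and F_0, where x^-_1 and x^+_(-1) occur
    multiplied by a power of K; that power is sent to the unit.\<close>
  then have x1: "X.fr.xm 1 = 0" "X.fr.xp (-1) = 0" using K XE X.fr.e_gen by auto
  define \<tau> where "\<tau> x = \<epsilon>' (\<eta> x)" for x
  note X_val = X.coideal_values[OF \<eta> c0 c1, unfolded K x0 x1, folded \<tau>_def]
  have \<tau>_eq: "\<tau> x = \<epsilon> (\<eta> x) *c R.fr.e" for x by (simp add: \<tau>_def \<epsilon>'_def)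
  have e\<rho>: "R.fr.e * emb U (cl y) = emb U (cl y)" "emb U (cl y) * R.fr.e = emb U (cl y)" if "y \<in> carrier loop_free" for y
    unfolding R.fr.e_def using that by (rule R.fr.hom_one)+
  have "emb U (\<eta> (grave_theta q c0 c1 n)) - (\<Sum>t\<le>n. \<tau> (grave_theta q c0 c1 t) * emb U (cl (phi_conv q C (n - t)))) \<in> FU 1" for n
  proof (rule E.approx_hom)
    show "typed_hom Ons \<tau>" unfolding \<tau>_def by (rule typed_hom_comp[OF h X.typed_hom])
    show "\<tau> \<one>\<^bsub>Ons\<^esub> = emb U (cl \<one>\<^bsub>loop_free\<^esub>)" using alg_homD(4)[OF h] by (simp add: \<tau>_def X.one XE R.fr.e_def)
    show "emb U (cl y) * \<tau> x = \<tau> x * emb U (cl y)" if "y \<in> carrier loop_free" for x y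
      using e\<rho>[OF that] by (simp add: \<tau>_eq cs_simps)
    have "R.fr.e \<in> FU 0" unfolding R.one[symmetric] FU_def using loop_one_filt by auto
    then show "\<tau> x \<in> FU 0" for x unfolding \<tau>_eq by (rule FU.F_cs)
  qed (simp_all add: R.coideal_values[OF \<eta> c0 c1] X_val cs_simps R.fr.e_gen)
  then have 1: "emb U (\<eta> (grave_theta q c0 c1 n)) - (\<Sum>t\<le>n. \<epsilon> (\<eta> (grave_theta q c0 c1 t)) *c emb U (cl (phi_conv q C (n - t)))) \<in> FU 1" for n
    by (simp add: \<tau>_eq mult_cs_left e\<rho> phi_conv_closed)
  show ?thesis unfolding series_cong_def
  proof
    fix n
    let ?G = "grave_theta q c0 c1"
    have c: "\<eta> (?G m) \<in> carrier U" "\<eta>0 (?G m) \<in> carrier U" "cl (phi_conv q C m) \<in> carrier U" for m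
      using alg_homD(1)[OF h grave_closed] alg_homD(1)[OF h0 grave_closed] alg_homD(1)[OF loop_class phi_conv_closed] by auto
    let ?c = "cauchy_prod U (smult U) (\<lambda>n. \<epsilon> (\<eta> (?G n))) (\<lambda>n. \<eta>0 (?G n)) n"
    have cc: "?c \<in> carrier U" unfolding cauchy_prod_def using c by (auto intro!: U.finsum_closed)
    have "emb U ?c = (\<Sum>t\<le>n. \<epsilon> (\<eta> (?G t)) *c emb U (\<eta>0 (?G (n - t))))"
      unfolding cauchy_prod_def using c by (subst R.hom_finsum) (auto simp: R.hom_smult)
    then have "emb U (\<eta> (?G n) \<ominus>\<^bsub>U\<^esub> ?c) = (emb U (\<eta> (?G n)) - (\<Sum>t\<le>n. \<epsilon> (\<eta> (?G t)) *c emb U (cl (phi_conv q C (n - t)))))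
       + (\<Sum>t\<le>n. (- \<epsilon> (\<eta> (?G t))) *c emb U (\<eta>0 (?G (n - t)) \<ominus>\<^bsub>U\<^esub> cl (phi_conv q C (n - t))))"
      using c cc by (simp add: R.hom_minus cs.scale_right_diff_distrib sum_subtractf sum_negf)
    also have "\<dots> \<in> FU 1"
    proof (rule FU.F_add[OF 1], rule FU.F_sum)
      show "(- \<epsilon> (\<eta> (?G t))) *c emb U (\<eta>0 (?G (n - t)) \<ominus>\<^bsub>U\<^esub> cl (phi_conv q C (n - t))) \<in> FU 1" for t
        by (rule FU.F_cs) (use eta0_approx[OF \<eta>0] in \<open>auto simp: FU_def loop_positive_eq\<close>)
    qed
    finally show "\<eta> (?G n) \<ominus>\<^bsub>U\<^esub> ?c \<in> loop_positive q"
      using c cc by (intro emb_FU) auto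
  qed
qed

sublocale T: tensor_ctx U U ..

lemma inv_K: "inv\<^bsub>U\<^esub> (loop_elt q Kgen) = loop_elt q Kgen_inv" "inv\<^bsub>U\<^esub> (loop_elt q Kgen_inv) = loop_elt q Kgen"
proof -
  have k: "loop_elt q Kgen \<in> carrier U" "loop_elt q Kgen_inv \<in> carrier U" by (simp_all add: loop_elt_closed)
  have "emb U (loop_elt q Kgen \<otimes>\<^bsub>U\<^esub> loop_elt q Kgen_inv) = emb U \<one>\<^bsub>U\<^esub>"
    "emb U (loop_elt q Kgen_inv \<otimes>\<^bsub>U\<^esub> loop_elt q Kgen) = emb U \<one>\<^bsub>U\<^esub>"
    using k by (simp_all add: R.hom_mult R.gens R.fr.KK R.one)
  note this[THEN emb_inj[OF loop_complex_algebra, rotated 2]]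
  then have "loop_elt q Kgen \<otimes>\<^bsub>U\<^esub> loop_elt q Kgen_inv = \<one>\<^bsub>U\<^esub>" "loop_elt q Kgen_inv \<otimes>\<^bsub>U\<^esub> loop_elt q Kgen = \<one>\<^bsub>U\<^esub>"
    using k by simp_all
  then show "inv\<^bsub>U\<^esub> (loop_elt q Kgen) = loop_elt q Kgen_inv" "inv\<^bsub>U\<^esub> (loop_elt q Kgen_inv) = loop_elt q Kgen"
    using k by (simp_all add: U.inv_char)
qed

text \<open>The right coideal property on generators, in the shape that \<open>approx_hom\<close>
  demands. The parameters \<open>s0\<close>, \<open>s1\<close> occur only inside the left
  factor.\<close>

lemma tensor_coproduct_values:
  assumes \<Delta>: "is_coproduct q \<Delta>" and \<eta>: "is_coideal_hom q c0 c1 s0 s1 \<eta>"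
  defines "xp \<equiv> \<lambda>k. T.right (loop_elt q (Xplus k))" and "xm \<equiv> \<lambda>k. T.right (loop_elt q (Xminus k))"
    and "K \<equiv> T.right (loop_elt q Kgen)" and "K' \<equiv> T.right (loop_elt q Kgen_inv)"
  shows "emb T.T (\<Delta> (\<eta> (onsager_elt q c0 c1 (Aons 0)))) =
      xm 0 + T.left (\<eta> (onsager_elt q c0 c1 (Aons 0))) * K' - (c1 * q\<^sup>2) *c (K' * xp 0)" (is ?A)
    and "emb T.T (\<Delta> (\<eta> (onsager_elt q c0 c1 (Aons (-1))))) =
      xm 1 + T.left (\<eta> (onsager_elt q c0 c1 (Aons (-1)))) * K - (c1 / C) *c (K * xp (-1))" (is ?B)
proof -
  have hD: "\<Delta> \<in> alg_hom U T.T" using \<Delta> by (simp add: is_coproduct_def Let_def)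
  interpret l: loop_rep q T.left by (rule loop_repI[OF T.left_typed_hom])
  interpret r: loop_rep q T.right by (rule loop_repI[OF T.right_typed_hom])
  interpret d: loop_rep q "\<lambda>x. emb T.T (\<Delta> x)" by (rule loop_repI[OF typed_hom_comp[OF hD T.E.typed_hom]])
  have chev: "chev_E q i \<in> carrier U" "chev_F q i \<in> carrier U" "chev_K q i \<in> carrier U" for i
    by (auto simp: chev_E_def chev_F_def chev_K_def loop_elt_closed)
  have invK: "inv\<^bsub>U\<^esub> (chev_K q i) = chev_K q (1 - i)" if "i \<in> {0, 1}" for i
    using that by (auto simp: chev_K_def inv_K)
  have e: "l.fr.e = r.fr.e" using T.left_one T.right_one by (simp add: l.one[symmetric] r.one[symmetric])
  have D: "emb T.T (\<Delta> (chev_E q i)) = T.left (chev_E q i) * r.fr.e + T.left (chev_K q i) * T.right (chev_E q i)"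
    "emb T.T (\<Delta> (chev_F q i)) = T.left (chev_F q i) * T.right (chev_K q (1 - i)) + l.fr.e * T.right (chev_F q i)"
    "emb T.T (\<Delta> (chev_K q i)) = T.left (chev_K q i) * T.right (chev_K q i)" if "i \<in> {0, 1}" for i
    using \<Delta> that chev invK
    by (auto simp: is_coproduct_def Let_def T.E.hom_add T.t_closed T.emb_t l.one[symmetric] r.one[symmetric])
  have lr: "T.right x * T.left y = T.left y * T.right x" if "x \<in> carrier U" "y \<in> carrier U" for x y
    using T.left_right that by simp
  note g = chev_E_def chev_F_def chev_K_def l.gens r.gens d.gens l.hom_mult r.hom_mult d.hom_mult l.hom_uminus r.hom_uminus d.hom_uminus loop_elt_closed
  have comm: "r.fr.K * l.fr.K = l.fr.K * r.fr.K" "r.fr.K * l.fr.K' = l.fr.K' * r.fr.K" "r.fr.K' * l.fr.K = l.fr.K * r.fr.K'" "r.fr.K' * l.fr.K' = l.fr.K' * r.fr.K'"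
    "r.fr.K * l.fr.xp k = l.fr.xp k * r.fr.K" "r.fr.K' * l.fr.xp k = l.fr.xp k * r.fr.K'" "r.fr.K * l.fr.xm k = l.fr.xm k * r.fr.K" "r.fr.K' * l.fr.xm k = l.fr.xm k * r.fr.K'"
    "r.fr.xp m * l.fr.K = l.fr.K * r.fr.xp m" for k m
    unfolding l.gens[symmetric] r.gens[symmetric] by (rule lr; simp add: loop_elt_closed)+
  have eg: "r.fr.e * l.fr.K = l.fr.K" "l.fr.K * r.fr.e = l.fr.K" "l.fr.K' * r.fr.e = l.fr.K'" "l.fr.xp k * r.fr.e = l.fr.xp k" "l.fr.xm k * r.fr.e = l.fr.xm k"
     "r.fr.e * l.fr.xm k = l.fr.xm k"
    for k unfolding e[symmetric] by (simp_all add: l.fr.e_gen)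
  have dK: "d.fr.K = l.fr.K * r.fr.K" "d.fr.K' = l.fr.K' * r.fr.K'"
    using D(3)[of 1] D(3)[of 0] by (simp_all add: g)
  have dx0: "d.fr.xp 0 = l.fr.xp 0 + l.fr.K * r.fr.xp 0" "d.fr.xm 0 = l.fr.xm 0 * r.fr.K' + r.fr.xm 0"
    using D(1)[of 1] D(2)[of 1] by (simp_all add: g eg e r.fr.e_gen)
  have dE0: "d.fr.K' * d.fr.xm 1 = l.fr.K' * l.fr.xm 1 + l.fr.K' * (r.fr.K' * r.fr.xm 1)"
  proof -
    have "- (d.fr.K' * d.fr.xm 1) = - (l.fr.K' * l.fr.xm 1) * r.fr.e + l.fr.K' * (- (r.fr.K' * r.fr.xm 1))"
      using D(1)[of 0] by (simp add: g)
    from arg_cong[OF this, of uminus] show ?thesis by (simp add: mult.assoc eg)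
  qed
  have dF0: "d.fr.xp (-1) * d.fr.K = l.fr.xp (-1) * l.fr.K * r.fr.K + r.fr.xp (-1) * r.fr.K"
  proof -
    have "- (d.fr.xp (-1) * d.fr.K) = - (l.fr.xp (-1) * l.fr.K) * r.fr.K + l.fr.e * (- (r.fr.xp (-1) * r.fr.K))"
      using D(2)[of 0] by (simp add: g)
    moreover have "l.fr.e * (- (r.fr.xp (-1) * r.fr.K)) = - (r.fr.xp (-1) * r.fr.K)"
      unfolding e by (simp add: r.fr.e_gen flip: mult.assoc)
    ultimately have "- (d.fr.xp (-1) * d.fr.K) = - (l.fr.xp (-1) * l.fr.K) * r.fr.K - r.fr.xp (-1) * r.fr.K"
      by simp
    from arg_cong[OF this, of uminus] show ?thesis by (simp add: add.commute)
  qed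
  \<comment> \<open>The coproduct is given on E_0 = -K^-1 x^-_1; multiplying by the coproduct of K
    recovers x^-_1.\<close>
  have dxm1: "d.fr.xm 1 = l.fr.xm 1 * r.fr.K + r.fr.xm 1"
  proof -
    have "d.fr.xm 1 = d.fr.K * (d.fr.K' * d.fr.xm 1)" by (simp add: d.fr.KK d.fr.e_gen flip: mult.assoc)
    also have "\<dots> = l.fr.K * (r.fr.K * l.fr.K') * l.fr.xm 1 + l.fr.K * (r.fr.K * l.fr.K') * (r.fr.K' * r.fr.xm 1)"
      unfolding dE0 unfolding dK(1) by (simp add: distrib_left mult.assoc)
    also have "\<dots> = (l.fr.K * l.fr.K') * (r.fr.K * l.fr.xm 1) + (l.fr.K * l.fr.K') * ((r.fr.K * r.fr.K') * r.fr.xm 1)"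
      unfolding comm(2) by (simp only: mult.assoc)
    also have "\<dots> = l.fr.xm 1 * r.fr.K + r.fr.xm 1"
      unfolding comm l.fr.KK r.fr.KK e by (simp add: r.fr.e_gen eg flip: mult.assoc)
    finally show ?thesis .
  qed
  have dKxp: "d.fr.K * d.fr.xp (-1) = l.fr.K * l.fr.xp (-1) * r.fr.K + r.fr.K * r.fr.xp (-1)"
    unfolding d.fr.K_x l.fr.K_x r.fr.K_x dF0 by (simp add: cs_simps)
  have dK'xp: "d.fr.K' * d.fr.xp 0 = l.fr.K' * l.fr.xp 0 * r.fr.K' + r.fr.K' * r.fr.xp 0"
  proof -
    have "d.fr.K' * d.fr.xp 0 = l.fr.K' * (r.fr.K' * l.fr.xp 0) + l.fr.K' * (r.fr.K' * l.fr.K) * r.fr.xp 0"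
      unfolding dK dx0 by (simp add: distrib_left mult.assoc)
    also have "\<dots> = l.fr.K' * l.fr.xp 0 * r.fr.K' + (l.fr.K' * l.fr.K) * (r.fr.K' * r.fr.xp 0)"
      unfolding comm by (simp only: mult.assoc)
    finally show ?thesis unfolding l.fr.KK e by (simp add: r.fr.e_gen flip: mult.assoc)
  qed
  show ?A unfolding xp_def xm_def K_def K'_def r.gens d.coideal_values[OF \<eta> c0 c1] l.coideal_values[OF \<eta> c0 c1] dK'xp
    unfolding dx0 dK by (simp add: algebra_simps cs_simps)
  show ?B unfolding xp_def xm_def K_def K'_def r.gens d.coideal_values[OF \<eta> c0 c1] l.coideal_values[OF \<eta> c0 c1] dKxp
    unfolding dxm1 dK by (simp add: algebra_simps cs_simps)
qed

theorem coproduct: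
  assumes \<Delta>: "is_coproduct q \<Delta>" and \<eta>: "is_coideal_hom q c0 c1 s0 s1 \<eta>" and \<eta>0: "is_coideal_hom q c0 c1 0 0 \<eta>0"
  shows "series_cong T.T (lin_span T.T {T.t a u | a u. a \<in> \<eta> ` carrier Ons \<and> u \<in> loop_positive q})
       (\<lambda>n. \<Delta> (\<eta> (grave_theta q c0 c1 n)))
       (cauchy_prod T.T T.t
          (\<lambda>n. \<eta> (grave_theta q c0 c1 n))
          (\<lambda>n. \<eta>0 (grave_theta q c0 c1 n)))"
proof -
  have h: "\<eta> \<in> alg_hom Ons U" and h0: "\<eta>0 \<in> alg_hom Ons U" using \<eta> \<eta>0 by (simp_all add: is_coideal_hom_def Let_def)
  have hD: "\<Delta> \<in> alg_hom U T.T" using \<Delta> by (simp add: is_coproduct_def Let_def)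
  interpret l: loop_rep q T.left by (rule loop_repI[OF T.left_typed_hom])
  interpret r: loop_rep q T.right by (rule loop_repI[OF T.right_typed_hom])
  interpret d: loop_rep q "\<lambda>x. emb T.T (\<Delta> x)" by (rule loop_repI[OF typed_hom_comp[OF hD T.E.typed_hom]])
  \<comment> \<open>Only the second factor is filtered, and the first stays in the coideal
    subalgebra: \<open>S 1\<close> spans the submodule of the statement.\<close>
  define S where "S d = {T.t a u | a u. a \<in> \<eta> ` carrier Ons \<and> u \<in> lin_span U (loop_filt q d)}" for d
  define F where "F d = emb T.T ` lin_span T.T (S d)" for d
  note uc = subsetD[OF U.lin_spanD(1)[OF loop_filt_closed]]
  have \<eta>c: "a \<in> carrier U" if "a \<in> \<eta> ` carrier Ons" for a using that alg_homD(1)[OF h] by auto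
  have SI: "T.t a u \<in> S d" if "a \<in> \<eta> ` carrier Ons" "u \<in> lin_span U (loop_filt q d)" for a u d
    unfolding S_def by (rule CollectI, rule exI[of _ a], rule exI[of _ u]) (intro conjI refl that)
  have SE: "\<exists>a u. x = T.t a u \<and> a \<in> \<eta> ` carrier Ons \<and> u \<in> lin_span U (loop_filt q d)" if "x \<in> S d" for x d
    using that unfolding S_def by (rule CollectD)
  have S_closed: "S d \<subseteq> carrier T.T" for d
  proof
    fix x assume "x \<in> S d"
    from SE[OF this] obtain a u where "x = T.t a u" "a \<in> \<eta> ` carrier Ons" "u \<in> lin_span U (loop_filt q d)" by (elim exE conjE)
    then show "x \<in> carrier T.T" by (simp only:) (intro T.t_closed \<eta>c uc)
  qed
  have S_mult: "x \<otimes>\<^bsub>T.T\<^esub> y \<in> S (d + d')" if x: "x \<in> S d" and y: "y \<in> S d'" for d d' x y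
  proof -
    obtain a u where a: "x = T.t a u" "a \<in> \<eta> ` carrier Ons" "u \<in> lin_span U (loop_filt q d)"
      using SE[OF x] by (elim exE conjE)
    obtain b v where b: "y = T.t b v" "b \<in> \<eta> ` carrier Ons" "v \<in> lin_span U (loop_filt q d')"
      using SE[OF y] by (elim exE conjE)
    obtain a' b' where a': "a = \<eta> a'" "a' \<in> carrier Ons" and b': "b = \<eta> b'" "b' \<in> carrier Ons"
      using a(2) b(2) by (elim imageE)
    \<comment> \<open>Here it matters that the first factors range over a subalgebra.\<close>
    have "a \<otimes>\<^bsub>U\<^esub> b = \<eta> (a' \<otimes>\<^bsub>Ons\<^esub> b')" unfolding a' b' by (rule alg_homD(2)[OF h a'(2) b'(2), symmetric])
    then have "a \<otimes>\<^bsub>U\<^esub> b \<in> \<eta> ` carrier Ons" by (simp only:) (intro imageI Ons.m_closed a' b')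
    moreover have "u \<otimes>\<^bsub>U\<^esub> v \<in> lin_span U (loop_filt q (d + d'))"
      by (rule U.lin_span_mult[OF loop_filt_closed loop_filt_closed loop_filt_closed loop_filt_mult a(3) b(3)])
    moreover have "x \<otimes>\<^bsub>T.T\<^esub> y = T.t (a \<otimes>\<^bsub>U\<^esub> b) (u \<otimes>\<^bsub>U\<^esub> v)"
      unfolding a(1) b(1) by (intro T.t_mult \<eta>c uc[OF a(3)] uc[OF b(3)] a(2) b(2))
    ultimately show ?thesis by (simp only:) (rule SI)
  qed
  have S_mono: "S d' \<subseteq> S d" if "d \<le> d'" for d d'
  proof
    fix x assume "x \<in> S d'"
    from SE[OF this] obtain a u where "x = T.t a u" "a \<in> \<eta> ` carrier Ons" "u \<in> lin_span U (loop_filt q d')" by (elim exE conjE)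
    then show "x \<in> S d" using subsetD[OF U.lin_span_mono[OF loop_filt_mono[OF that]]] by (simp only:) (intro SI)
  qed
  interpret F: filtration F
    unfolding F_def[abs_def] by (rule T.T.span_filtration, rule S_closed, erule (1) S_mult, erule S_mono)
  have SF: "emb T.T x \<in> F d" if "x \<in> S d" for x d
    unfolding F_def using subsetD[OF T.T.lin_span_superset that] by (rule imageI)
  have one: "\<one>\<^bsub>U\<^esub> \<in> \<eta> ` carrier Ons" using alg_homD(4)[OF h] Ons.one_closed by (metis imageI)
  have "coideal_hom (\<lambda>x. T.right (cl x)) q F c0 c1 (\<lambda>x. emb T.T (\<Delta> (\<eta> x)))"
  proof (intro coideal_hom.intro coideal_hom_axioms.intro r.fr.loop_hom_axioms F.filtration_axioms c0 c1 typed_hom_comp[OF h d.typed_hom])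
    show "emb T.T (\<Delta> (\<eta> \<one>\<^bsub>Ons\<^esub>)) = T.right (cl \<one>\<^bsub>loop_free\<^esub>)"
      using alg_homD(4)[OF h] alg_homD(4)[OF loop_class] alg_homD(4)[OF hD] T.right_one by simp
    show "T.right (cl (free_gen w)) \<in> F (loop_deg w)" if "w \<in> loop_gens" for w
    proof -
      have "T.t \<one>\<^bsub>U\<^esub> (loop_elt q w) \<in> S (loop_deg w)" by (rule SI[OF one loop_elt_filt[OF that]])
      from SF[OF this] show ?thesis by (simp add: T.right_def loop_elt_def)
    qed
  qed
  then interpret E: coideal_hom "\<lambda>x. T.right (cl x)" q F c0 c1 "\<lambda>x. emb T.T (\<Delta> (\<eta> x))" .
  let ?G = "grave_theta q c0 c1"
  have 1: "emb T.T (\<Delta> (\<eta> (?G n))) - (\<Sum>t\<le>n. T.left (\<eta> (?G t)) * T.right (cl (phi_conv q C (n - t)))) \<in> F 1" for n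
  proof (rule E.approx_hom[of "\<lambda>x. T.left (\<eta> x)"])
    show "typed_hom Ons (\<lambda>x. T.left (\<eta> x))" by (rule typed_hom_comp[OF h l.typed_hom])
    show "T.left (\<eta> \<one>\<^bsub>Ons\<^esub>) = T.right (cl \<one>\<^bsub>loop_free\<^esub>)"
      using alg_homD(4)[OF h] alg_homD(4)[OF loop_class] T.left_one T.right_one by simp
    show "T.right (cl y) * T.left (\<eta> x) = T.left (\<eta> x) * T.right (cl y)" if "x \<in> carrier Ons" "y \<in> carrier loop_free" for x y
      using that alg_homD(1)[OF h] alg_homD(1)[OF loop_class] by (intro T.left_right)
    show "T.left (\<eta> x) \<in> F 0" if "x \<in> carrier Ons" for x
    proof -
      have "T.t (\<eta> x) \<one>\<^bsub>U\<^esub> \<in> S 0" by (rule SI[OF imageI[OF that] loop_one_filt])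
      from SF[OF this] show ?thesis by (simp add: T.left_def)
    qed
  qed (use tensor_coproduct_values[OF \<Delta> \<eta>] in \<open>simp_all add: r.gens\<close>)
  show ?thesis unfolding series_cong_def
  proof
    fix n
    have c: "\<eta> (?G m) \<in> carrier U" "\<eta>0 (?G m) \<in> carrier U" "cl (phi_conv q C m) \<in> carrier U" for m
      using alg_homD(1)[OF h grave_closed] alg_homD(1)[OF h0 grave_closed] alg_homD(1)[OF loop_class phi_conv_closed] by auto
    let ?c = "cauchy_prod T.T T.t (\<lambda>n. \<eta> (?G n)) (\<lambda>n. \<eta>0 (?G n)) n"
    have cc: "?c \<in> carrier T.T" unfolding cauchy_prod_def using c by (auto intro!: T.T.finsum_closed T.t_closed)
    have dc: "\<Delta> (\<eta> (?G n)) \<in> carrier T.T" using alg_homD(1)[OF hD] c by auto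
    \<comment> \<open>The error of replacing \<open>phi_conv\<close> in the second factor; it has an
      element of the coideal on the left and one of positive degree on the right.\<close>
    define P where "P t = T.left (\<eta> (?G t)) * T.right (cl (phi_conv q C (n - t)) \<ominus>\<^bsub>U\<^esub> \<eta>0 (?G (n - t)))" for t
    have "emb T.T ?c = (\<Sum>t\<le>n. T.left (\<eta> (?G t)) * T.right (\<eta>0 (?G (n - t))))"
      unfolding cauchy_prod_def using c by (subst T.E.hom_finsum) (auto simp: T.emb_t T.t_closed)
    then have "emb T.T (\<Delta> (\<eta> (?G n)) \<ominus>\<^bsub>T.T\<^esub> ?c) = (emb T.T (\<Delta> (\<eta> (?G n))) - (\<Sum>t\<le>n. T.left (\<eta> (?G t)) * T.right (cl (phi_conv q C (n - t)))))
       + (\<Sum>t\<le>n. P t)"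
      using c cc dc by (simp add: P_def T.E.hom_minus r.hom_minus right_diff_distrib sum_subtractf)
    also have "\<dots> \<in> F 1"
    proof (rule F.F_add[OF 1], rule F.F_sum)
      show "P t \<in> F 1" for t
      proof -
        let ?u = "\<eta>0 (?G (n - t)) \<ominus>\<^bsub>U\<^esub> cl (phi_conv q C (n - t))"
        have u: "?u \<in> lin_span U (loop_filt q 1)" using eta0_approx[OF \<eta>0] by (simp add: loop_positive_eq)
        have "T.t (\<eta> (?G t)) ?u \<in> S 1" by (rule SI[OF imageI[OF grave_closed] u])
        then have "(-1) *c emb T.T (T.t (\<eta> (?G t)) ?u) \<in> F 1" by (intro F.F_cs SF)
        also have "(-1) *c emb T.T (T.t (\<eta> (?G t)) ?u) = P t"
          using c uc[OF u] by (simp add: P_def T.emb_t r.hom_minus cs_one algebra_simps)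
        finally show ?thesis .
      qed
    qed
    finally have m: "emb T.T (\<Delta> (\<eta> (?G n)) \<ominus>\<^bsub>T.T\<^esub> ?c) \<in> F 1" .
    have "\<Delta> (\<eta> (?G n)) \<ominus>\<^bsub>T.T\<^esub> ?c \<in> lin_span T.T (S 1)"
    proof -
      obtain z where z: "z \<in> lin_span T.T (S 1)" "emb T.T (\<Delta> (\<eta> (?G n)) \<ominus>\<^bsub>T.T\<^esub> ?c) = emb T.T z"
        using m unfolding F_def by blast
      then have "\<Delta> (\<eta> (?G n)) \<ominus>\<^bsub>T.T\<^esub> ?c = z"
        using T.T.lin_spanD(1)[OF S_closed] dc cc by (intro emb_inj[OF T.T_complex_algebra]) auto
      then show ?thesis using z by simp
    qed
    then show "\<Delta> (\<eta> (?G n)) \<ominus>\<^bsub>T.T\<^esub> ?c \<in> lin_span T.T {T.t a u |a u. a \<in> \<eta> ` carrier Ons \<and> u \<in> loop_positive q}"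
      by (simp add: S_def loop_positive_eq)
  qed
qed

end

theorem theorem7p5:
  fixes q c0 c1 s0 s1 :: complex
  assumes "q \<noteq> 0" and "\<And>n::nat. n \<ge> 1 \<Longrightarrow> q ^ n \<noteq> 1"
    and "c0 \<noteq> 0" and "c1 \<noteq> 0"
    and "is_coproduct q \<Delta>" and "is_counit q \<epsilon>"
    and "is_coideal_hom q c0 c1 s0 s1 \<eta>"
    and "is_coideal_hom q c0 c1 0 0 \<eta>0"
  shows
    "series_cong (loop_alg q) (loop_positive q)
       (\<lambda>n. \<eta> (grave_theta q c0 c1 n))
       (cauchy_prod (loop_alg q) (smult (loop_alg q))
          (\<lambda>n. \<epsilon> (\<eta> (grave_theta q c0 c1 n)))
          (\<lambda>n. \<eta>0 (grave_theta q c0 c1 n)))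
     \<and>
     series_cong (tensor_alg (loop_alg q) (loop_alg q))
       (lin_span (tensor_alg (loop_alg q) (loop_alg q))
          {tensor (loop_alg q) (loop_alg q) a u | a u.
             a \<in> \<eta> ` carrier (onsager_alg q c0 c1) \<and> u \<in> loop_positive q})
       (\<lambda>n. \<Delta> (\<eta> (grave_theta q c0 c1 n)))
       (cauchy_prod (tensor_alg (loop_alg q) (loop_alg q)) (tensor (loop_alg q) (loop_alg q))
          (\<lambda>n. \<eta> (grave_theta q c0 c1 n))
          (\<lambda>n. \<eta>0 (grave_theta q c0 c1 n)))"
proof -
  interpret coideal_setting q c0 c1 using assms(1-4) by unfold_locales auto
  show ?thesis using factorization[OF assms(6,7,8)] coproduct[OF assms(5,7,8)] by blast
qed

end
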